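(* Let $\bar A=(A_0,A_1)$ be a compatible couple of (quasi-)Banach spaces with $A_0\cap A_1\neq\{0\}$. Let $0<q_1,r_1\le\infty$ and $a_1,b_1\in SV$ be such that $\left\|s^{-1/r_1}b_1(s)\|u^{-1/q_1}a_1(u)\|_{q_1,(s,1)}\right\|_{r_1,(0,1)}<\infty$, and put $$\chi_1(t)=\left\|s^{-1/r_1}b_1(s)\|u^{-1/q_1}a_1(u)\|_{q_1,(s,t)}\right\|_{r_1,(0,t)}.$$ Let $0<r,r_0,q_0\le\infty$, $a,a_0,b_0\in SV$, and $\left\|s^{-1/r_0}b_0(s)\|u^{-1/q_0}a_0(u)\|_{q_0,(1,s)}\right\|_{r_0,(1,\infty)}<\infty$. Put $\chi_0(t)=\left\|s^{-1/r_0}b_0(s)\|u^{-1/q_0}a_0(u)\|_{q_0,(t,s)}\right\|_{r_0,(t,\infty)}$ and $\rho(t)=t\frac{\chi_0(t)}{\chi_1(t)}$. For given $0\le\theta\le1$ denote $a^{\#}=\chi_0^{1-\theta}\chi_1^{\theta}\,(a\circ\rho)$. (i) If $0<\theta<1$, then $\left(\bar A^{\mathcal L}_{0,r_0,b_0,q_0,a_0},\bar A^{\mathcal R}_{1,r_1,b_1,q_1,a_1}\right)_{\theta,r,a}=\bar A_{\theta,r,a^{\#}}$. (ii) If $\|s^{-1/r}a(s)\|_{r,(1,\infty)}<\infty$, then, with $\theta=0$ (i.e. $a^{\#}=\chi_0\,(a\circ\rho)$), $$\left(\bar A^{\mathcal L}_{0,r_0,b_0,q_0,a_0},\bar A^{\mathcal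 R}_{1,r_1,b_1,q_1,a_1}\right)_{0,r,a}=\bar A_{0,r,a^{\#}}\cap\bar A^{\mathcal L}_{0,r,B_0,q_0,a_0}\cap\bar A^{\mathcal L,\mathcal L}_{0,r,a\circ\rho,r_0,b_0,q_0,a_0},$$ where $B_0(t)=\|s^{-1/r_0}b_0(s)\|_{r_0,(t,\infty)}\,a(\rho(t))$. (iii) If $\|s^{-1/r}a(s)\|_{r,(0,1)}<\infty$, then, with $\theta=1$ (i.e. $a^{\#}=\chi_1\,(a\circ\rho)$), $$\left(\bar A^{\mathcal L}_{0,r_0,b_0,q_0,a_0},\bar A^{\mathcal R}_{1,r_1,b_1,q_1,a_1}\right)_{1,r,a}=\bar A_{1,r,a^{\#}}\cap\bar A^{\mathcal R}_{1,r,B_1,q_1,a_1}\cap\bar A^{\mathcal R,\mathcal R}_{1,r,a\circ\rho,r_1,b_1,q_1,a_1},$$ where $B_1(t)=\|s^{-1/r_1}b_1(s)\|_{r_1,(0,t)}\,a(\rho(t))$.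
   Context: Conventions: $1/\infty=0$; $\|\cdot\|_{q,(a,b)}$ is the usual (quasi-)norm of $L_q$ on the interval $(a,b)$, $0<q\le\infty$. Two positive functions satisfy $f\approx g$ (are equivalent) if $C^{-1}g\le f\le Cg$ for some constant $C>0$ independent of all significant quantities. $b\in SV$ (slowly varying) means that $b$ is a positive Lebesgue measurable function on $(0,\infty)$ such that for each $\varepsilon>0$ the function $t^{\varepsilon}b(t)$ is equivalent to an increasing function and $t^{-\varepsilon}b(t)$ is equivalent to a decreasing function. For a compatible couple $(X_0,X_1)$ of (quasi-)normed spaces, $K(t,f;X_0,X_1)=\inf\{\|f_0\|_{X_0}+t\|f_1\|_{X_1}: f=f_0+f_1,\ f_i\in X_i\}$ for $f\in X_0+X_1$, $t>0$; $K(t,f):=K(t,f;A_0,A_1)$. For $0\le\theta\le1$, $0<q\le\infty$, $b\in SV$, $(X_0,X_1)_{\theta,q,b}$ is the space of all $f\in X_0+X_1$ with finite (quasi-)norm $\|u^{-\theta-1/q}b(u)K(u,f;X_0,X_1)\|_{q,(0,\infty)}$, and $\bar A_{\theta,q,b}:=(A_0,A_1)_{\theta,q,b}$. For $0<p,r,q\le\infty$ and $a,b,c\in SV$, the following are the spaces of all $f\in A_0+A_1$ with finite (quasi-)norm: - $\bar A^{\mathcal L}_{\theta,r,b,q,a}$: $\left\|t^{-1/r}b(t)\|u^{-\theta-1/q}a(u)K(u,f)\|_{q,(0,t)}\right\|_{r,(0,\infty)}$; - $\bar A^{\mathcal R}_{\theta,r,b,q,a}$: $\left\|t^{-1/r}b(t)\|u^{-\theta-1/q}a(u)K(u,f)\|_{q,(t,\infty)}\right\|_{r,(0,\infty)}$;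 - $\bar A^{\mathcal L,\mathcal L}_{\theta,p,c,r,b,q,a}$: $\left\|t^{-1/p}c(t)\left\|u^{-1/r}b(u)\|v^{-\theta-1/q}a(v)K(v,f)\|_{q,(0,u)}\right\|_{r,(0,t)}\right\|_{p,(0,\infty)}$; - $\bar A^{\mathcal R,\mathcal R}_{\theta,p,c,r,b,q,a}$: $\left\|t^{-1/p}c(t)\left\|u^{-1/r}b(u)\|v^{-\theta-1/q}a(v)K(v,f)\|_{q,(u,\infty)}\right\|_{r,(t,\infty)}\right\|_{p,(0,\infty)}$. Equality of (quasi-)normed spaces means that each is continuously embedded in the other; intersections carry the maximum (equivalently, the sum) of the (quasi-)norms. Standing assumption: none of the spaces under consideration is $\{0\}$. *)

theory Defs
  imports "HOL-Analysis.Analysis"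
begin

section \<open>Compatible couples of quasi-normed spaces\<close>

text \<open>Hausdorff topological vector spaces, the ambient spaces of compatible couples.
  Complex spaces are covered by restricting the scalars.\<close>

class hausdorff_tvs = real_vector + topological_ab_group_add + t2_space +
  assumes tendsto_scaleR_Pair:
    "filterlim (\<lambda>p. fst p *\<^sub>R snd p) (nhds (c *\<^sub>R x)) (nhds c \<times>\<^sub>F nhds x)"

text \<open>A subspace \<open>X\<close> of the ambient space together with a quasi-norm on it is encoded by one
  functional, the quasi-norm extended by \<open>\<infinity>\<close> outside \<open>X\<close>; the underlying set \<open>X\<close> is
  recovered as \<open>carrier_of\<close>.\<close>

type_synonym 'a qspace = "'a \<Rightarrow> ennreal"

definition carrier_of :: "'a qspace \<Rightarrow> 'a set" where
  "carrier_of X = {f. X f < \<infinity>}"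

text \<open>Since \<open>0 * \<infinity> = 0\<close> in \<open>ennreal\<close>, homogeneity is consistent with \<open>X 0 = 0\<close>.\<close>

definition quasi_norm :: "'a::real_vector qspace \<Rightarrow> bool" where
  "quasi_norm X \<longleftrightarrow>
     (\<forall>f. X f = 0 \<longleftrightarrow> f = 0) \<and>
     (\<forall>c f. X (c *\<^sub>R f) = ennreal \<bar>c\<bar> * X f) \<and>
     (\<exists>C::real. C \<ge> 1 \<and> (\<forall>f g. X (f + g) \<le> ennreal C * (X f + X g)))"

definition complete_space_of :: "'a::real_vector qspace \<Rightarrow> bool" where
  "complete_space_of X \<longleftrightarrow>
     (\<forall>x :: nat \<Rightarrow> 'a. range x \<subseteq> carrier_of X \<longrightarrow>
        (\<forall>e>0. \<exists>M. \<forall>m\<ge>M. \<forall>n\<ge>M. X (x m - x n) < e) \<longrightarrow>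
        (\<exists>l\<in>carrier_of X. (\<lambda>n. X (x n - l)) \<longlonglongrightarrow> 0))"

definition quasi_Banach :: "'a::real_vector qspace \<Rightarrow> bool" where
  "quasi_Banach X \<longleftrightarrow> quasi_norm X \<and> complete_space_of X"

text \<open>Continuity of the inclusion into the ambient space; by linearity it suffices to ask
  for it at \<open>0\<close>.\<close>

definition embeds_in_ambient :: "'a::hausdorff_tvs qspace \<Rightarrow> bool" where
  "embeds_in_ambient X \<longleftrightarrow>
     (\<forall>U. open U \<longrightarrow> 0 \<in> U \<longrightarrow> (\<exists>d>0. \<forall>f. X f < d \<longrightarrow> f \<in> U))"

definition compatible_quasi_Banach_couple ::
    "'a::hausdorff_tvs qspace \<Rightarrow> 'a qspace \<Rightarrow> bool" where
  "compatible_quasi_Banach_couple A0 A1 \<longleftrightarrow>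
     quasi_Banach A0 \<and> quasi_Banach A1 \<and> embeds_in_ambient A0 \<and> embeds_in_ambient A1"

definition cont_embedded :: "'a qspace \<Rightarrow> 'a qspace \<Rightarrow> bool" where
  "cont_embedded X Y \<longleftrightarrow> carrier_of X \<subseteq> carrier_of Y \<and>
     (\<exists>C::real. C > 0 \<and> (\<forall>f\<in>carrier_of X. Y f \<le> ennreal C * X f))"

definition same_space :: "'a qspace \<Rightarrow> 'a qspace \<Rightarrow> bool" where
  "same_space X Y \<longleftrightarrow> cont_embedded X Y \<and> cont_embedded Y X"

definition inter_space :: "'a qspace \<Rightarrow> 'a qspace \<Rightarrow> 'a qspace" where
  "inter_space X Y = (\<lambda>f. max (X f) (Y f))"

definition sum_set :: "'a::real_vector qspace \<Rightarrow> 'a qspace \<Rightarrow> 'a set" where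
  "sum_set X0 X1 = {f0 + f1 | f0 f1. f0 \<in> carrier_of X0 \<and> f1 \<in> carrier_of X1}"

definition Kfun :: "'a::real_vector qspace \<Rightarrow> 'a qspace \<Rightarrow> real \<Rightarrow> 'a \<Rightarrow> ennreal" where
  "Kfun X0 X1 t f =
     Inf {X0 f0 + ennreal t * X1 f1 | f0 f1.
            f0 \<in> carrier_of X0 \<and> f1 \<in> carrier_of X1 \<and> f = f0 + f1}"

section \<open>Quasi-norms of Lebesgue spaces on intervals\<close>

definition ennpowr :: "ennreal \<Rightarrow> real \<Rightarrow> ennreal" where
  "ennpowr x p = (if x = \<infinity> then \<infinity> else ennreal (enn2real x powr p))"

text \<open>For \<open>q = \<infinity>\<close> this is the essential supremum. The library's \<open>esssup\<close> is set to \<open>\<infinity>\<close> on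
  non-measurable functions; here its defining expression is used for all functions (and,
  likewise, \<open>nn_integral\<close> is the lower integral), because a composition \<open>a \<circ> \<rho>\<close> with \<open>a\<close>
  Lebesgue measurable need not be Lebesgue measurable. A slowly varying \<open>a\<close> is pointwise
  equivalent to a Borel function, so such compositions still have well-behaved norms up to
  equivalence.\<close>

definition Lq_norm :: "ennreal \<Rightarrow> real set \<Rightarrow> (real \<Rightarrow> ennreal) \<Rightarrow> ennreal" where
  "Lq_norm q S g =
     (if q = \<infinity> then Limsup (ae_filter (lebesgue_on S)) g
      else ennpowr (\<integral>\<^sup>+ u. ennpowr (g u) (enn2real q) \<partial>lebesgue_on S) (1 / enn2real q))"

text \<open>The quasi-norm of \<open>u powr (-\<theta> - 1/q) * w u * g u\<close> in \<open>L\<^sub>q\<close> on \<open>S\<close>, with \<open>1/\<infinity> = 0\<close>.\<close>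

definition wnorm ::
    "real \<Rightarrow> ennreal \<Rightarrow> (real \<Rightarrow> real) \<Rightarrow> real set \<Rightarrow> (real \<Rightarrow> ennreal) \<Rightarrow> ennreal" where
  "wnorm \<theta> q w S g =
     Lq_norm q S (\<lambda>u. ennreal (u powr (- \<theta> - enn2real (1 / q)) * w u) * g u)"

section \<open>Slowly varying functions\<close>

definition equiv_pos :: "(real \<Rightarrow> real) \<Rightarrow> (real \<Rightarrow> real) \<Rightarrow> bool" where
  "equiv_pos f g \<longleftrightarrow> (\<exists>C>0. \<forall>t>0. g t / C \<le> f t \<and> f t \<le> C * g t)"

definition SV :: "(real \<Rightarrow> real) set" where
  "SV = {b. b \<in> borel_measurable (lebesgue_on {0<..}) \<and> (\<forall>t>0. b t > 0) \<and>
     (\<forall>\<epsilon>>0.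
        (\<exists>g. (\<forall>t>0. g t > 0) \<and> mono_on {0<..} g \<and> equiv_pos (\<lambda>t. t powr \<epsilon> * b t) g) \<and>
        (\<exists>g. (\<forall>t>0. g t > 0) \<and> antimono_on {0<..} g \<and> equiv_pos (\<lambda>t. t powr (- \<epsilon>) * b t) g))}"

section \<open>Interpolation spaces\<close>

definition restrict_to :: "'a set \<Rightarrow> 'a qspace \<Rightarrow> 'a qspace" where
  "restrict_to S X = (\<lambda>f. if f \<in> S then X f else \<infinity>)"

definition interp_space ::
    "'a::real_vector qspace \<Rightarrow> 'a qspace \<Rightarrow> real \<Rightarrow> ennreal \<Rightarrow> (real \<Rightarrow> real) \<Rightarrow> 'a qspace" where
  "interp_space X0 X1 \<theta> q b =
     restrict_to (sum_set X0 X1) (\<lambda>f. wnorm \<theta> q b {0<..} (\<lambda>u. Kfun X0 X1 u f))"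

definition L_space ::
    "'a::real_vector qspace \<Rightarrow> 'a qspace \<Rightarrow> real \<Rightarrow> ennreal \<Rightarrow> (real \<Rightarrow> real) \<Rightarrow>
     ennreal \<Rightarrow> (real \<Rightarrow> real) \<Rightarrow> 'a qspace" where
  "L_space A0 A1 \<theta> r b q a =
     restrict_to (sum_set A0 A1)
       (\<lambda>f. wnorm 0 r b {0<..} (\<lambda>t. wnorm \<theta> q a {0<..<t} (\<lambda>u. Kfun A0 A1 u f)))"

definition R_space ::
    "'a::real_vector qspace \<Rightarrow> 'a qspace \<Rightarrow> real \<Rightarrow> ennreal \<Rightarrow> (real \<Rightarrow> real) \<Rightarrow>
     ennreal \<Rightarrow> (real \<Rightarrow> real) \<Rightarrow> 'a qspace" where
  "R_space A0 A1 \<theta> r b q a =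
     restrict_to (sum_set A0 A1)
       (\<lambda>f. wnorm 0 r b {0<..} (\<lambda>t. wnorm \<theta> q a {t<..} (\<lambda>u. Kfun A0 A1 u f)))"

definition LL_space ::
    "'a::real_vector qspace \<Rightarrow> 'a qspace \<Rightarrow> real \<Rightarrow> ennreal \<Rightarrow> (real \<Rightarrow> real) \<Rightarrow>
     ennreal \<Rightarrow> (real \<Rightarrow> real) \<Rightarrow> ennreal \<Rightarrow> (real \<Rightarrow> real) \<Rightarrow> 'a qspace" where
  "LL_space A0 A1 \<theta> p c r b q a =
     restrict_to (sum_set A0 A1)
       (\<lambda>f. wnorm 0 p c {0<..} (\<lambda>t. wnorm 0 r b {0<..<t}
              (\<lambda>u. wnorm \<theta> q a {0<..<u} (\<lambda>v. Kfun A0 A1 v f))))"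

definition RR_space ::
    "'a::real_vector qspace \<Rightarrow> 'a qspace \<Rightarrow> real \<Rightarrow> ennreal \<Rightarrow> (real \<Rightarrow> real) \<Rightarrow>
     ennreal \<Rightarrow> (real \<Rightarrow> real) \<Rightarrow> ennreal \<Rightarrow> (real \<Rightarrow> real) \<Rightarrow> 'a qspace" where
  "RR_space A0 A1 \<theta> p c r b q a =
     restrict_to (sum_set A0 A1)
       (\<lambda>f. wnorm 0 p c {0<..} (\<lambda>t. wnorm 0 r b {t<..}
              (\<lambda>u. wnorm \<theta> q a {u<..} (\<lambda>v. Kfun A0 A1 v f))))"

section \<open>The functions built from the parameters\<close>

text \<open>The norms below are finite for all \<open>t > 0\<close> once they are finite for \<open>t = 1\<close> (slowly varying
  functions are bounded above and below on compact subintervals of \<open>(0, \<infinity>)\<close>), so \<open>enn2real\<close>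
  loses nothing.\<close>

definition chi0 :: "ennreal \<Rightarrow> (real \<Rightarrow> real) \<Rightarrow> ennreal \<Rightarrow> (real \<Rightarrow> real) \<Rightarrow> real \<Rightarrow> real" where
  "chi0 r0 b0 q0 a0 t =
     enn2real (wnorm 0 r0 b0 {t<..} (\<lambda>s. wnorm 0 q0 a0 {t<..<s} (\<lambda>_. 1)))"

definition chi1 :: "ennreal \<Rightarrow> (real \<Rightarrow> real) \<Rightarrow> ennreal \<Rightarrow> (real \<Rightarrow> real) \<Rightarrow> real \<Rightarrow> real" where
  "chi1 r1 b1 q1 a1 t =
     enn2real (wnorm 0 r1 b1 {0<..<t} (\<lambda>s. wnorm 0 q1 a1 {s<..<t} (\<lambda>_. 1)))"

definition a_sharp ::
    "(real \<Rightarrow> real) \<Rightarrow> (real \<Rightarrow> real) \<Rightarrow> (real \<Rightarrow> real) \<Rightarrow> (real \<Rightarrow> real) \<Rightarrow> real \<Rightarrow> real \<Rightarrow> real" where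
  "a_sharp c0 c1 \<rho> a \<theta> t = c0 t powr (1 - \<theta>) * c1 t powr \<theta> * a (\<rho> t)"

end

theory Submission
  imports Defs
begin

text \<open>
  The K-functional \<open>K(t, f)\<close> is increasing in \<open>t\<close> and \<open>K(t, f)/t\<close> is decreasing, and slowly varying
  weights change little on dyadic intervals. Hence every norm in the theorem is equivalent, with
  constants independent of \<open>f\<close>, to the corresponding norm of sequences indexed by the integers,
  formed from the values at the points \<open>2\<^sup>k\<close> (\<open>samples\<close>, \<open>wnorm_equivalent_lnorm\<close>,
  \<open>samples_nested\<close>). After this step there is no measure theory left, finite and infinite
  exponents are treated alike, and the \<open>R\<close> spaces become \<open>L\<close> spaces by reflecting the index, which
  corresponds to interchanging \<open>A\<^sub>0\<close> and \<open>A\<^sub>1\<close>.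

  Let \<open>X\<^sub>0\<close> and \<open>X\<^sub>1\<close> be the \<open>L\<close> and the \<open>R\<close> space. A decomposition of \<open>f\<close> that is optimal for
  \<open>K(2\<^sup>n, f)\<close> is nearly optimal for the couple \<open>(X\<^sub>0, X\<^sub>1)\<close> at \<open>\<rho>(2\<^sup>n)\<close>. So \<open>K(\<rho>(2\<^sup>n), f; X\<^sub>0, X\<^sub>1)\<close> is
  equivalent to the norm in \<open>X\<^sub>0\<close> of the sequence \<open>K(2\<^sup>k, f)\<close> stopped at \<open>k = n\<close> plus \<open>\<rho>(2\<^sup>n)\<close> times
  the mirrored expression for \<open>X\<^sub>1\<close> (\<open>holmstedt\<close>). The stopped norm has three parts
  (\<open>Lfun_trunc\<close>): the double norm over indices up to \<open>n\<close>, the norm of \<open>b\<^sub>0\<close> beyond \<open>n\<close> times the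
  inner norm up to \<open>n\<close>, and \<open>\<chi>\<^sub>0(2\<^sup>n) K(2\<^sup>n, f)\<close>. The function \<open>\<rho>\<close> is chosen so that the last part is the
  same for \<open>X\<^sub>0\<close> and for \<open>X\<^sub>1\<close>.

  It remains to take the \<open>l\<^sub>r\<close> norm with weight \<open>\<rho>\<^sup>-\<^sup>\<theta> (a \<circ> \<rho>)\<close>; since \<open>\<rho>(t)/t\<close> varies slowly, the
  points \<open>\<rho>(2\<^sup>n)\<close> are as good as dyadic ones (\<open>change_of_variables\<close>). The common third part
  yields the space with weight \<open>a\<^sup>#\<close>. For \<open>\<theta> > 0\<close> the weight decays geometrically and Hardy's
  inequality bounds the first two parts for \<open>X\<^sub>0\<close> by the third (\<open>hardy_trunc\<close>); symmetrically for
  \<open>X\<^sub>1\<close> when \<open>\<theta> < 1\<close>. For \<open>0 < \<theta> < 1\<close> only the third part is left. For \<open>\<theta> = 0\<close> the first two parts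
  for \<open>X\<^sub>0\<close> remain and are the two additional spaces in the intersection; \<open>\<theta> = 1\<close> is the mirror
  image.
\<close>

section \<open>Domination up to a constant\<close>

text \<open>The index \<open>i\<close> collects everything that the constant must not depend on: usually an element
  of the ambient space, or a sequence, together with a position. Two-sided domination of two
  extended quasi-norms is equality of the spaces.\<close>

definition dominated :: "('i \<Rightarrow> ennreal) \<Rightarrow> ('i \<Rightarrow> ennreal) \<Rightarrow> bool" (infix "\<preceq>" 50) where
  "F \<preceq> G \<longleftrightarrow> (\<exists>C::real. \<forall>i. F i \<le> ennreal C * G i)"

definition equivalent :: "('i \<Rightarrow> ennreal) \<Rightarrow> ('i \<Rightarrow> ennreal) \<Rightarrow> bool" (infix "\<asymp>" 50) where
  "F \<asymp> G \<longleftrightarrow> F \<preceq> G \<and> G \<preceq> F"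

lemma dominatedI: "(\<And>i. F i \<le> ennreal C * G i) \<Longrightarrow> F \<preceq> G"
  unfolding dominated_def by blast

lemma dominated_leI: "(\<And>i. F i \<le> G i) \<Longrightarrow> F \<preceq> G"
  by (rule dominatedI[where C = 1]) simp

lemma dominatedE:
  assumes "F \<preceq> G"
  obtains C where "C \<ge> 1" "\<And>i. F i \<le> ennreal C * G i"
proof -
  from assms obtain C where C: "\<And>i. F i \<le> ennreal C * G i"
    unfolding dominated_def by blast
  have "F i \<le> ennreal (max C 1) * G i" for i
    using C[of i] by (rule order_trans) (intro mult_right_mono ennreal_leI; simp)
  then show ?thesis using that[of "max C 1"] by simp
qed

lemma dominatedE2:
  assumes "(\<lambda>(a, b). F a b) \<preceq> (\<lambda>(a, b). G a b)"
  obtains C where "C \<ge> 1" "\<And>a b. F a b \<le> ennreal C * G a b"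
proof -
  from assms obtain C where "C \<ge> 1"
    and C: "\<And>i. (\<lambda>(a, b). F a b) i \<le> ennreal C * (\<lambda>(a, b). G a b) i"
    using dominatedE by blast
  then show ?thesis using C[of "(a, b)" for a b] by (intro that[of C]) auto
qed

lemma dominatedE3:
  assumes "(\<lambda>(a, b, c). F a b c) \<preceq> (\<lambda>(a, b, c). G a b c)"
  obtains C where "C \<ge> 1" "\<And>a b c. F a b c \<le> ennreal C * G a b c"
proof -
  from assms obtain C where "C \<ge> 1"
    and C: "\<And>i. (\<lambda>(a, b, c). F a b c) i \<le> ennreal C * (\<lambda>(a, b, c). G a b c) i"
    using dominatedE by blast
  then show ?thesis using C[of "(a, b, c)" for a b c] by (intro that[of C]) auto
qed

lemma dominated_refl: "F \<preceq> F"
  by (rule dominated_leI) simp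

lemma dominated_trans [trans]:
  assumes "F \<preceq> G" "G \<preceq> H"
  shows "F \<preceq> H"
proof -
  obtain C where C: "C \<ge> 1" "\<And>i. F i \<le> ennreal C * G i" using dominatedE[OF assms(1)] by blast
  obtain D where D: "D \<ge> 1" "\<And>i. G i \<le> ennreal D * H i" using dominatedE[OF assms(2)] by blast
  show ?thesis
  proof (rule dominatedI)
    fix i
    have "F i \<le> ennreal C * (ennreal D * H i)"
      using C(2)[of i] mult_left_mono[OF D(2)[of i], of "ennreal C"] by (auto intro: order_trans)
    then show "F i \<le> ennreal (C * D) * H i"
      using C(1) D(1) by (simp add: ennreal_mult mult.assoc)
  qed
qed

lemma dominated_comp: "F \<preceq> G \<Longrightarrow> (\<lambda>i. F (h i)) \<preceq> (\<lambda>i. G (h i))"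
  unfolding dominated_def by blast

lemma dominated_mult:
  assumes "F \<preceq> G" "F' \<preceq> G'"
  shows "(\<lambda>i. F i * F' i) \<preceq> (\<lambda>i. G i * G' i)"
proof -
  obtain C where C: "C \<ge> 1" "\<And>i. F i \<le> ennreal C * G i" using dominatedE[OF assms(1)] by blast
  obtain D where D: "D \<ge> 1" "\<And>i. F' i \<le> ennreal D * G' i" using dominatedE[OF assms(2)] by blast
  show ?thesis
  proof (rule dominatedI)
    fix i
    have "F i * F' i \<le> (ennreal C * G i) * (ennreal D * G' i)"
      by (intro mult_mono C D) auto
    then show "F i * F' i \<le> ennreal (C * D) * (G i * G' i)"
      using C(1) D(1) by (simp add: ennreal_mult mult_ac)
  qed
qed

lemma dominated_add:
  assumes "F \<preceq> H" "G \<preceq> H"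
  shows "(\<lambda>i. F i + G i) \<preceq> H"
proof -
  obtain C where C: "C \<ge> 1" "\<And>i. F i \<le> ennreal C * H i" using dominatedE[OF assms(1)] by blast
  obtain D where D: "D \<ge> 1" "\<And>i. G i \<le> ennreal D * H i" using dominatedE[OF assms(2)] by blast
  show ?thesis
  proof (rule dominatedI)
    fix i
    have "F i + G i \<le> ennreal C * H i + ennreal D * H i" by (intro add_mono C D)
    then show "F i + G i \<le> ennreal (C + D) * H i"
      using C(1) D(1) by (simp add: ennreal_plus distrib_right)
  qed
qed

lemma dominated_add_left: "F \<preceq> G \<Longrightarrow> F \<preceq> (\<lambda>i. G i + H i)"
  by (erule dominated_trans) (rule dominated_leI, simp)

lemma dominated_add_right: "F \<preceq> H \<Longrightarrow> F \<preceq> (\<lambda>i. G i + H i)"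
  by (erule dominated_trans) (rule dominated_leI, simp)

lemma dominated_add_mono:
  "F \<preceq> F' \<Longrightarrow> G \<preceq> G' \<Longrightarrow> (\<lambda>i. F i + G i) \<preceq> (\<lambda>i. F' i + G' i)"
  by (intro dominated_add dominated_add_left[of F] dominated_add_right[of G])

lemma equivalentI: "F \<preceq> G \<Longrightarrow> G \<preceq> F \<Longrightarrow> F \<asymp> G"
  unfolding equivalent_def by simp

lemma equivalentD: "F \<asymp> G \<Longrightarrow> F \<preceq> G" "F \<asymp> G \<Longrightarrow> G \<preceq> F"
  unfolding equivalent_def by simp_all

lemma equivalent_sym: "F \<asymp> G \<Longrightarrow> G \<asymp> F"
  unfolding equivalent_def by simp

lemma equivalent_refl: "F \<asymp> F"
  unfolding equivalent_def by (simp add: dominated_refl)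

lemma equivalent_trans [trans]: "F \<asymp> G \<Longrightarrow> G \<asymp> H \<Longrightarrow> F \<asymp> H"
  unfolding equivalent_def by (blast intro: dominated_trans)

lemma equivalent_comp: "F \<asymp> G \<Longrightarrow> (\<lambda>i. F (h i)) \<asymp> (\<lambda>i. G (h i))"
  unfolding equivalent_def by (blast intro: dominated_comp)

lemma equivalent_add:
  "F \<asymp> F' \<Longrightarrow> G \<asymp> G' \<Longrightarrow> (\<lambda>i. F i + G i) \<asymp> (\<lambda>i. F' i + G' i)"
  unfolding equivalent_def by (blast intro: dominated_add_mono)

lemma equivalent_mult:
  "F \<asymp> F' \<Longrightarrow> G \<asymp> G' \<Longrightarrow> (\<lambda>i. F i * G i) \<asymp> (\<lambda>i. F' i * G' i)"
  unfolding equivalent_def by (blast intro: dominated_mult)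

section \<open>Powers of extended nonnegative reals\<close>

lemma ennpowr_ennreal: "x \<ge> 0 \<Longrightarrow> ennpowr (ennreal x) p = ennreal (x powr p)"
  by (simp add: ennpowr_def)

lemma ennpowr_0 [simp]: "ennpowr 0 p = 0"
  by (simp add: ennpowr_def)

lemma ennpowr_top [simp]: "ennpowr top p = top"
  by (simp add: ennpowr_def)

lemma ennpowr_mono: "x \<le> y \<Longrightarrow> p > 0 \<Longrightarrow> ennpowr x p \<le> ennpowr y p"
  by (cases x; cases y) (auto simp: ennpowr_ennreal top_unique intro!: ennreal_leI powr_mono2)

lemma ennpowr_mult: "ennpowr (x * y) p = ennpowr x p * ennpowr y p"
proof (cases x; cases y)
  fix s t assume "0 \<le> s" "x = ennreal s" "0 \<le> t" "y = ennreal t"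
  then show ?thesis
    by (simp add: ennpowr_ennreal powr_mult flip: ennreal_mult)
next
  fix s assume "0 \<le> s" "x = ennreal s" "y = top"
  then show ?thesis
    by (cases "s = 0") (auto simp: ennpowr_ennreal ennreal_mult_top)
next
  fix s assume "0 \<le> s" "y = ennreal s" "x = top"
  then show ?thesis
    by (cases "s = 0") (auto simp: ennpowr_ennreal ennreal_top_mult)
qed simp

lemma ennpowr_ennpowr: "ennpowr (ennpowr x p) s = ennpowr x (p * s)"
  by (cases x) (auto simp: ennpowr_ennreal powr_powr)

lemma ennpowr_1 [simp]: "ennpowr x 1 = x"
  by (cases x) (auto simp: ennpowr_ennreal)

lemma ennpowr_inverse: "p > 0 \<Longrightarrow> ennpowr (ennpowr x p) (1 / p) = x"
  by (simp add: ennpowr_ennpowr)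

lemma ennpowr_inverse': "p > 0 \<Longrightarrow> ennpowr (ennpowr x (1 / p)) p = x"
  by (simp add: ennpowr_ennpowr)

text \<open>From \<open>x + y \<le> 2 max x y\<close>; a single constant serves exponents on both sides of \<open>1\<close>, which is
  why all norms below are only quasi-norms.\<close>

lemma ennpowr_add_le:
  assumes "p > 0"
  shows "ennpowr (x + y) p \<le> ennreal (2 powr p) * (ennpowr x p + ennpowr y p)"
proof -
  have "x + y \<le> ennreal 2 * max x y"
    by (simp add: mult_2 add_mono)
  then have "ennpowr (x + y) p \<le> ennreal (2 powr p) * ennpowr (max x y) p"
    using ennpowr_mono[OF _ assms, of "x + y" "ennreal 2 * max x y"]
    by (simp add: ennpowr_mult ennpowr_ennreal del: ennreal_numeral)
  also have "ennpowr (max x y) p \<le> ennpowr x p + ennpowr y p"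
    by (cases "x \<le> y") (auto simp: max_def)
  finally show ?thesis by (simp add: mult_left_mono)
qed

section \<open>Sequence norms\<close>

text \<open>The norm of \<open>l\<^sub>q\<close> over an index set \<open>S\<close>. A weighted integral norm over \<open>(0, \<infinity>)\<close> of a function
  that is almost constant on dyadic intervals is such a norm of its dyadic values.\<close>

definition lnorm :: "ennreal \<Rightarrow> int set \<Rightarrow> (int \<Rightarrow> ennreal) \<Rightarrow> ennreal" where
  "lnorm q S x =
     (if q = \<infinity> then SUP k\<in>S. x k
      else ennpowr (\<integral>\<^sup>+ k. ennpowr (x k) (enn2real q) \<partial>count_space S) (1 / enn2real q))"

lemma lnorm_infinity: "lnorm top S x = (SUP k\<in>S. x k)"
  by (simp add: lnorm_def)

lemma lnorm_finite:
  assumes "p > 0"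
  shows "lnorm (ennreal p) S x = ennpowr (\<integral>\<^sup>+ k. ennpowr (x k) p \<partial>count_space S) (1 / p)"
  using assms by (simp add: lnorm_def)

lemma exponent_cases [consumes 1, case_names infinity finite]:
  fixes q :: ennreal
  assumes "q > 0" "q = top \<Longrightarrow> P" "\<And>p. p > 0 \<Longrightarrow> q = ennreal p \<Longrightarrow> P"
  shows P
  using assms by (cases q) (auto simp: ennreal_zero_less_top)

lemma lnorm_mono:
  assumes "q > 0" "\<And>k. k \<in> S \<Longrightarrow> x k \<le> y k"
  shows "lnorm q S x \<le> lnorm q S y"
  using assms(1)
proof (cases q rule: exponent_cases)
  case infinity
  then show ?thesis using assms(2) by (auto simp: lnorm_infinity intro!: SUP_mono)
next
  case (finite p)
  then show ?thesis using assms(2)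
    by (auto simp: lnorm_finite intro!: ennpowr_mono nn_integral_mono)
qed

lemma lnorm_cong: "(\<And>k. k \<in> S \<Longrightarrow> x k = y k) \<Longrightarrow> lnorm q S x = lnorm q S y"
  unfolding lnorm_def by (auto intro!: SUP_cong arg_cong[where f = "\<lambda>x. ennpowr x _"] nn_integral_cong)

lemma lnorm_subset:
  assumes "q > 0" "S \<subseteq> T"
  shows "lnorm q S x \<le> lnorm q T x"
  using assms(1)
proof (cases q rule: exponent_cases)
  case infinity
  then show ?thesis using assms(2) by (auto simp: lnorm_infinity intro!: SUP_subset_mono)
next
  case (finite p)
  have "(\<integral>\<^sup>+ k. ennpowr (x k) p \<partial>count_space S) \<le> (\<integral>\<^sup>+ k. ennpowr (x k) p \<partial>count_space T)"
  proof -
    have "(\<integral>\<^sup>+ k. ennpowr (x k) p \<partial>count_space S) =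
        (\<integral>\<^sup>+ k. ennpowr (x k) p * indicator S k \<partial>count_space UNIV)"
      by (simp add: nn_integral_restrict_space[symmetric] restrict_count_space)
    also have "\<dots> \<le> (\<integral>\<^sup>+ k. ennpowr (x k) p * indicator T k \<partial>count_space UNIV)"
      using assms(2) by (intro nn_integral_mono) (auto split: split_indicator)
    also have "\<dots> = (\<integral>\<^sup>+ k. ennpowr (x k) p \<partial>count_space T)"
      by (simp add: nn_integral_restrict_space[symmetric] restrict_count_space)
    finally show ?thesis .
  qed
  then show ?thesis using finite by (auto simp: lnorm_finite intro!: ennpowr_mono)
qed

lemma lnorm_ge:
  assumes "q > 0" "k \<in> S"
  shows "x k \<le> lnorm q S x"
  using assms(1)
proof (cases q rule: exponent_cases)
  case infinity
  then show ?thesis using assms(2) by (auto simp: lnorm_infinity intro: SUP_upper)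
next
  case (finite p)
  have "ennpowr (ennpowr (x k) p) (1 / p) \<le>
      ennpowr (\<integral>\<^sup>+ k. ennpowr (x k) p \<partial>count_space S) (1 / p)"
    using finite(1) by (intro ennpowr_mono nn_integral_ge_point assms(2)) auto
  then show ?thesis using finite by (simp add: lnorm_finite ennpowr_inverse)
qed

lemma lnorm_cmult:
  assumes "q > 0"
  shows "lnorm q S (\<lambda>k. c * x k) = c * lnorm q S x"
  using assms
proof (cases q rule: exponent_cases)
  case infinity
  then show ?thesis by (simp add: lnorm_infinity SUP_mult_left_ennreal)
next
  case (finite p)
  then show ?thesis
    by (simp add: lnorm_finite ennpowr_mult nn_integral_cmult ennpowr_inverse)
qed

text \<open>The constant depends on \<open>q\<close> only, neither on the sequences nor on the index set.\<close>

lemma lnorm_add: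
  assumes "q > 0"
  shows "(\<lambda>(S, x, y). lnorm q S (\<lambda>k. x k + y k)) \<preceq> (\<lambda>(S, x, y). lnorm q S x + lnorm q S y)"
  using assms
proof (cases q rule: exponent_cases)
  case infinity
  have "(SUP k\<in>S. x k + y k) \<le> Sup (x ` S) + Sup (y ` S)"
    for S and x y :: "int \<Rightarrow> ennreal"
    by (intro SUP_least add_mono SUP_upper)
  then show ?thesis
    by (auto simp: infinity lnorm_infinity intro!: dominated_leI)
next
  case (finite p)
  show ?thesis
  proof (rule dominatedI, clarsimp)
    fix S and x y :: "int \<Rightarrow> ennreal"
    let ?I = "\<lambda>x :: int \<Rightarrow> ennreal. \<integral>\<^sup>+ k. ennpowr (x k) p \<partial>count_space S"
    have "?I (\<lambda>k. x k + y k) \<le>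
        (\<integral>\<^sup>+ k. ennreal (2 powr p) * (ennpowr (x k) p + ennpowr (y k) p) \<partial>count_space S)"
      using finite(1) by (intro nn_integral_mono ennpowr_add_le)
    also have "\<dots> = ennreal (2 powr p) * (?I x + ?I y)"
      by (simp add: nn_integral_cmult nn_integral_add)
    finally have "ennpowr (?I (\<lambda>k. x k + y k)) (1 / p) \<le>
        ennpowr (ennreal (2 powr p) * (?I x + ?I y)) (1 / p)"
      using finite(1) by (intro ennpowr_mono) auto
    also have "\<dots> = ennreal 2 * ennpowr (?I x + ?I y) (1 / p)"
      using finite(1) by (simp add: ennpowr_mult ennpowr_ennreal powr_powr)
    also have "\<dots> \<le> ennreal 2 * (ennreal (2 powr (1 / p)) *
        (ennpowr (?I x) (1 / p) + ennpowr (?I y) (1 / p)))"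
      using finite(1) by (intro mult_left_mono ennpowr_add_le) auto
    finally show "lnorm q S (\<lambda>k. x k + y k) \<le>
        ennreal (2 * 2 powr (1 / p)) * (lnorm q S x + lnorm q S y)"
      using finite by (simp add: lnorm_finite ennreal_mult mult.assoc del: ennreal_numeral)
  qed
qed

lemma lnorm_reindex:
  assumes "bij_betw h S T"
  shows "lnorm q S (\<lambda>k. x (h k)) = lnorm q T x"
proof -
  have "(SUP k\<in>S. x (h k)) = Sup (x ` T)"
    using bij_betw_imp_surj_on[OF assms] by (metis image_image)
  then show ?thesis unfolding lnorm_def
    by (simp add: nn_integral_bij_count_space[OF assms, of "\<lambda>k. ennpowr (x k) _"])
qed

lemma lnorm_indicator:
  assumes "q > 0" "S \<subseteq> T"
  shows "lnorm q S x = lnorm q T (\<lambda>k. if k \<in> S then x k else 0)"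
  using assms(1)
proof (cases q rule: exponent_cases)
  case infinity
  show ?thesis unfolding infinity lnorm_infinity
    using assms(2)
  proof (intro antisym SUP_least)
    show "x k \<le> (SUP k\<in>T. if k \<in> S then x k else 0)" if "k \<in> S" for k
      using that assms(2) by (intro SUP_upper2[of k]) auto
  qed (auto intro: SUP_upper)
next
  case (finite p)
  have "(\<integral>\<^sup>+ k. ennpowr (x k) p \<partial>count_space S) =
      (\<integral>\<^sup>+ k. ennpowr (if k \<in> S then x k else 0) p \<partial>count_space T)"
  proof -
    have "(\<integral>\<^sup>+ k. ennpowr (x k) p \<partial>count_space S) =
        (\<integral>\<^sup>+ k. ennpowr (x k) p * indicator S k \<partial>count_space UNIV)"
      by (simp add: nn_integral_restrict_space[symmetric] restrict_count_space)
    also have "\<dots> = (\<integral>\<^sup>+ k. ennpowr (if k \<in> S then x k else 0) p * indicator T k \<partial>count_space UNIV)"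
      using assms(2) by (intro nn_integral_cong) (auto split: split_indicator)
    also have "\<dots> = (\<integral>\<^sup>+ k. ennpowr (if k \<in> S then x k else 0) p \<partial>count_space T)"
      by (simp add: nn_integral_restrict_space[symmetric] restrict_count_space)
    finally show ?thesis .
  qed
  then show ?thesis using finite by (simp add: lnorm_finite)
qed

lemma lnorm_Un:
  assumes "q > 0"
  shows "(\<lambda>(S, T, x). lnorm q (S \<union> T) x) \<preceq> (\<lambda>(S, T, x). lnorm q S x + lnorm q T x)"
proof -
  obtain C where "C \<ge> 1" and C: "\<And>S x y. lnorm q S (\<lambda>k. x k + y k) \<le> ennreal C * (lnorm q S x + lnorm q S y)"
    by (rule dominatedE3[OF lnorm_add[OF assms]]) (rule that)
  show ?thesis
  proof (rule dominatedI[where C = C], clarify)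
    fix S T :: "int set" and x :: "int \<Rightarrow> ennreal"
    let ?r = "\<lambda>A k. if k \<in> A then x k else 0"
    have "lnorm q (S \<union> T) x \<le> lnorm q (S \<union> T) (\<lambda>k. ?r S k + ?r T k)"
      using assms by (intro lnorm_mono) auto
    also have "\<dots> \<le> ennreal C * (lnorm q (S \<union> T) (?r S) + lnorm q (S \<union> T) (?r T))"
      by (rule C)
    also have "\<dots> = ennreal C * (lnorm q S x + lnorm q T x)"
      using lnorm_indicator[OF assms, of S "S \<union> T" x] lnorm_indicator[OF assms, of T "S \<union> T" x]
      by simp
    finally show "lnorm q (S \<union> T) x \<le> ennreal C * (lnorm q S x + lnorm q T x)" .
  qed
qed

text \<open>Two norms with the same exponent commute: Tonelli for finite \<open>q\<close>, exchange of suprema for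
  \<open>q = \<infinity>\<close>.\<close>

lemma lnorm_swap:
  assumes "q > 0"
  shows "lnorm q S (\<lambda>m. lnorm q T (\<lambda>n. z m n)) = lnorm q T (\<lambda>n. lnorm q S (\<lambda>m. z m n))"
  using assms
proof (cases q rule: exponent_cases)
  case infinity
  then show ?thesis by (simp add: lnorm_infinity) (rule SUP_commute)
next
  case (finite p)
  have "(\<integral>\<^sup>+ m. \<integral>\<^sup>+ n. ennpowr (z m n) p \<partial>count_space T \<partial>count_space S) =
      (\<integral>\<^sup>+ n. \<integral>\<^sup>+ m. ennpowr (z m n) p \<partial>count_space S \<partial>count_space T)"
    by (intro nn_integral_count_space_nn_integral) auto
  then show ?thesis
    using finite by (simp add: lnorm_finite ennpowr_inverse')
qed

lemma dominated_lnorm: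
  assumes "q > 0" and "(\<lambda>p. F (fst p) (snd p)) \<preceq> (\<lambda>p. G (fst p) (snd p))"
  shows "(\<lambda>i. lnorm q (S i) (F i)) \<preceq> (\<lambda>i. lnorm q (S i) (G i))"
proof -
  obtain C where C: "\<And>i k. F i k \<le> ennreal C * G i k"
    using assms(2) unfolding dominated_def by auto
  show ?thesis
  proof (rule dominatedI)
    fix i
    have "lnorm q (S i) (F i) \<le> lnorm q (S i) (\<lambda>k. ennreal C * G i k)"
      using assms(1) by (intro lnorm_mono C)
    then show "lnorm q (S i) (F i) \<le> ennreal C * lnorm q (S i) (G i)"
      using assms(1) by (simp add: lnorm_cmult)
  qed
qed

lemma equivalent_lnorm:
  assumes "q > 0" and "(\<lambda>p. F (fst p) (snd p)) \<asymp> (\<lambda>p. G (fst p) (snd p))"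
  shows "(\<lambda>i. lnorm q (S i) (F i)) \<asymp> (\<lambda>i. lnorm q (S i) (G i))"
  using assms by (auto intro!: equivalentI dominated_lnorm dest: equivalentD)

lemma lnorm_add_equivalent:
  assumes "q > 0"
  shows "(\<lambda>i. lnorm q (S i) (\<lambda>k. F i k + G i k)) \<asymp> (\<lambda>i. lnorm q (S i) (F i) + lnorm q (S i) (G i))"
proof (rule equivalentI)
  show "(\<lambda>i. lnorm q (S i) (\<lambda>k. F i k + G i k)) \<preceq> (\<lambda>i. lnorm q (S i) (F i) + lnorm q (S i) (G i))"
    using dominated_comp[OF lnorm_add[OF assms], of "\<lambda>i. (S i, F i, G i)"] by simp
  show "(\<lambda>i. lnorm q (S i) (F i) + lnorm q (S i) (G i)) \<preceq> (\<lambda>i. lnorm q (S i) (\<lambda>k. F i k + G i k))"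
    by (intro dominated_add dominated_leI lnorm_mono assms) auto
qed

lemma lnorm_UN:
  assumes "q > 0" "finite I"
  shows "\<exists>C. \<forall>(S :: 'b \<Rightarrow> int set) x B. (\<forall>i\<in>I. lnorm q (S i) x \<le> B) \<longrightarrow>
    lnorm q (\<Union>i\<in>I. S i) x \<le> ennreal C * B"
  using assms(2)
proof (induction I)
  case empty
  have "lnorm q {} x = 0" for x
    using assms(1) by (cases q rule: exponent_cases) (auto simp: lnorm_infinity lnorm_finite bot_ennreal nn_integral_count_space_finite)
  then show ?case by auto
next
  case (insert i I)
  obtain C where C: "\<And>(S :: 'b \<Rightarrow> int set) x B. (\<forall>i\<in>I. lnorm q (S i) x \<le> B) \<Longrightarrow>
    lnorm q (\<Union>i\<in>I. S i) x \<le> ennreal C * B" using insert.IH by blast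
  obtain D where D: "D \<ge> 1" "\<And>S T x. lnorm q (S \<union> T) x \<le> ennreal D * (lnorm q S x + lnorm q T x)"
    by (rule dominatedE3[OF lnorm_Un[OF assms(1)]]) (rule that)
  show ?case
  proof (intro exI[of _ "D * (1 + max C 0)"] allI impI)
    fix S :: "'b \<Rightarrow> int set" and x B
    assume *: "\<forall>j\<in>insert i I. lnorm q (S j) x \<le> B"
    have "lnorm q (\<Union>j\<in>insert i I. S j) x \<le> ennreal D * (lnorm q (S i) x + lnorm q (\<Union>i\<in>I. S i) x)"
      using D(2)[of "S i" "\<Union>i\<in>I. S i" x] by simp
    also have "\<dots> \<le> ennreal D * (B + ennreal (max C 0) * B)"
      using * C[of S x B]
      by (intro mult_left_mono add_mono) (auto simp: max_def ennreal_neg)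
    also have "\<dots> = ennreal (D * (1 + max C 0)) * B"
      using D(1) by (simp add: ennreal_mult ennreal_plus distrib_right mult.assoc del: ennreal_max_0)
    finally show "lnorm q (\<Union>j\<in>insert i I. S j) x \<le> ennreal (D * (1 + max C 0)) * B" .
  qed
qed

text \<open>The integers split into \<open>L + 1\<close> residue classes modulo \<open>L + 1\<close>, and \<open>\<tau>\<close> is injective on each
  of them.\<close>

lemma lnorm_bounded_to_one:
  fixes \<tau> :: "int \<Rightarrow> int"
  assumes "q > 0" and L: "\<And>m n. \<tau> m = \<tau> n \<Longrightarrow> \<bar>m - n\<bar> \<le> L"
  shows "(\<lambda>x. lnorm q UNIV (\<lambda>n. x (\<tau> n))) \<preceq> (\<lambda>x. lnorm q UNIV x)"
proof -
  have L0: "L \<ge> 0" using L[of 0 0] by simp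
  let ?S = "\<lambda>i. {n::int. n mod (L + 1) = i}"
  obtain C where C: "\<And>(S :: int \<Rightarrow> int set) x B. (\<forall>i\<in>{0..L}. lnorm q (S i) x \<le> B) \<Longrightarrow>
    lnorm q (\<Union>i\<in>{0..L}. S i) x \<le> ennreal C * B" using lnorm_UN[OF assms(1), of "{0..L}"] by blast
  show ?thesis
  proof (rule dominatedI[where C = C])
    fix x :: "int \<Rightarrow> ennreal"
    have "n mod (L + 1) \<in> {0..L}" for n
      using L0 pos_mod_bound[of "L + 1" n] by simp
    then have "(\<Union>i\<in>{0..L}. ?S i) = UNIV" by auto
    moreover have "lnorm q (?S i) (\<lambda>n. x (\<tau> n)) \<le> lnorm q UNIV x" for i
    proof -
      have "inj_on \<tau> (?S i)"
      proof (rule inj_onI)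
        fix m n assume mn: "m \<in> ?S i" "n \<in> ?S i" "\<tau> m = \<tau> n"
        then have "(L + 1) dvd (m - n)" by (auto intro: mod_eq_dvd_iff[THEN iffD1])
        moreover have "\<bar>m - n\<bar> < L + 1" using L[OF mn(3)] by simp
        ultimately show "m = n" using dvd_imp_le_int[of "m - n" "L + 1"] by fastforce
      qed
      then have "lnorm q (?S i) (\<lambda>n. x (\<tau> n)) = lnorm q (\<tau> ` ?S i) x"
        by (intro lnorm_reindex) (rule inj_on_imp_bij_betw)
      also have "\<dots> \<le> lnorm q UNIV x" using assms(1) by (intro lnorm_subset) auto
      finally show ?thesis .
    qed
    ultimately show "lnorm q UNIV (\<lambda>n. x (\<tau> n)) \<le> ennreal C * lnorm q UNIV x"
      using C[of ?S "\<lambda>n. x (\<tau> n)" "lnorm q UNIV x"] by auto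
  qed
qed

section \<open>Dyadic discretization of weighted norms\<close>

text \<open>The level of \<open>u > 0\<close> is the index \<open>k\<close> of the dyadic interval \<open>[2\<^sup>k, 2\<^sup>k\<^sup>+\<^sup>1)\<close> that contains it.\<close>

definition level :: "real \<Rightarrow> int" where
  "level u = \<lfloor>log 2 u\<rfloor>"

lemma level_eq_iff: "u > 0 \<Longrightarrow> level u = k \<longleftrightarrow> 2 powr real_of_int k \<le> u \<and> u < 2 powr (real_of_int k + 1)"
  unfolding level_def using floor_log_eq_powr_iff[of u 2 k] by simp

lemma level_powr [simp]: "level (2 powr real_of_int k) = k"
  by (simp add: level_def)

lemma level_mono: "0 < s \<Longrightarrow> s \<le> t \<Longrightarrow> level s \<le> level t"
  unfolding level_def by (intro floor_mono) auto

lemma dyadic_bounds: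
  assumes "u > 0"
  shows "2 powr real_of_int (level u) \<le> u" "u < 2 powr (real_of_int (level u) + 1)"
  using level_eq_iff[OF assms, of "level u"] by auto

text \<open>The integral of a function of the level; a dyadic interval of level \<open>k\<close> has length \<open>2\<^sup>k\<close>.\<close>

lemma nn_integral_dyadic_step:
  "(\<integral>\<^sup>+ u. h (level u) * indicator {0<..} u \<partial>lebesgue) =
   (\<integral>\<^sup>+ k. h k * ennreal (2 powr real_of_int k) \<partial>count_space UNIV)"
proof -
  let ?I = "\<lambda>k::int. {2 powr real_of_int k..<2 powr (real_of_int k + 1)}"
  have "h (level u) * indicator {0<..} u = (\<integral>\<^sup>+ k. h k * indicator (?I k) u \<partial>count_space UNIV)" for u
  proof (cases "u > 0")
    case True
    have "(\<integral>\<^sup>+ k. h k * indicator (?I k) u \<partial>count_space UNIV) =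
        (\<Sum>k\<in>{level u}. h k * indicator (?I k) u)"
    proof (rule nn_integral_count_space')
      fix k assume "k \<notin> {level u}"
      then have "u \<notin> ?I k" using level_eq_iff[OF True, of k] by auto
      then show "h k * indicator (?I k) u = 0" by simp
    qed auto
    then show ?thesis using dyadic_bounds[OF True] True by simp
  next
    case False
    then have "u \<notin> ?I k" for k
      by (auto simp: not_less dest: order_trans intro: less_le_trans[of 0 "2 powr real_of_int k"])
    then show ?thesis using False by simp
  qed
  then have "(\<integral>\<^sup>+ u. h (level u) * indicator {0<..} u \<partial>lebesgue) =
      (\<integral>\<^sup>+ u. \<integral>\<^sup>+ k. h k * indicator (?I k) u \<partial>count_space UNIV \<partial>lebesgue)"
    by simp
  also have "\<dots> = (\<integral>\<^sup>+ k. \<integral>\<^sup>+ u. h k * indicator (?I k) u \<partial>lebesgue \<partial>count_space UNIV)"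
    by (intro nn_integral_count_space_nn_integral)
      (auto intro!: borel_measurable_times_ennreal borel_measurable_indicator)
  also have "\<dots> = (\<integral>\<^sup>+ k. h k * ennreal (2 powr real_of_int k) \<partial>count_space UNIV)"
    by (intro nn_integral_cong) (simp add: nn_integral_cmult_indicator powr_add)
  finally show ?thesis .
qed

text \<open>The factor \<open>u powr (- 1/p)\<close> in the weight turns \<open>du\<close> into the dilation invariant measure
  \<open>du/u\<close>.\<close>

lemma wnorm_finite:
  assumes "p > 0" "S \<in> sets lebesgue" "S \<subseteq> {0<..}"
  shows "wnorm \<theta> (ennreal p) w S g =
    ennpowr (\<integral>\<^sup>+ u. ennreal (1 / u) * ennpowr (ennreal (u powr -\<theta> * w u) * g u) p * indicator S u
      \<partial>lebesgue) (1 / p)"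
proof -
  have "enn2real (1 / ennreal p) = 1 / p"
    using assms(1) by (simp add: divide_ennreal flip: ennreal_1)
  moreover have "ennpowr (ennreal (u powr (- \<theta> - 1 / p) * w u) * g u) p =
      ennreal (1 / u) * ennpowr (ennreal (u powr -\<theta> * w u) * g u) p" if "u \<in> S" for u
  proof -
    have u: "u > 0" using that assms(3) by auto
    have "u powr (- \<theta> - 1 / p) * w u = u powr (- 1 / p) * (u powr - \<theta> * w u)"
      by (simp add: powr_diff powr_minus field_simps)
    moreover have "(u powr (- 1 / p)) powr p = 1 / u"
    proof -
      have "- 1 / p * p = - 1" using assms(1) by simp
      then show ?thesis using u by (simp only: powr_powr powr_minus_divide) simp
    qed
    ultimately show ?thesis
      by (simp only: ennreal_mult'[OF powr_ge_zero] mult.assoc ennpowr_mult[of "ennreal (u powr (- 1 / p))"]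
          ennpowr_ennreal[OF powr_ge_zero])
  qed
  ultimately show ?thesis
    using assms unfolding wnorm_def Lq_norm_def
    by (simp add: nn_integral_restrict_space)
      (intro arg_cong[where f = "\<lambda>x. ennpowr x _"] nn_integral_cong, auto split: split_indicator)
qed

lemma wnorm_infinity:
  "wnorm \<theta> top w S g = Limsup (ae_filter (lebesgue_on S)) (\<lambda>u. ennreal (u powr -\<theta> * w u) * g u)"
  by (simp add: wnorm_def Lq_norm_def)

text \<open>This lemma and the next are the only contact with integration. Weights such as \<open>a \<circ> \<rho>\<close> may be
  non-measurable, so the lower integral is never split or scaled: it is only compared, by
  monotonicity, with the integral of a step function, and the essential supremum with a
  supremum over levels.\<close>

lemma wnorm_le_lnorm:
  assumes "q > 0" "S \<in> sets lebesgue"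
    and S: "\<And>u. u \<in> S \<Longrightarrow> u > 0" "\<And>u. u \<in> S \<Longrightarrow> level u \<in> J"
    and le: "\<And>u. u \<in> S \<Longrightarrow> ennreal (u powr -\<theta> * w u) * g u \<le> x (level u)"
  shows "wnorm \<theta> q w S g \<le> lnorm q J x"
  using assms(1)
proof (cases q rule: exponent_cases)
  case infinity
  show ?thesis unfolding infinity wnorm_infinity lnorm_infinity
  proof (intro Limsup_bounded AE_I2)
    fix u assume "u \<in> space (lebesgue_on S)"
    then have "u \<in> S" by simp
    then show "ennreal (u powr -\<theta> * w u) * g u \<le> Sup (x ` J)"
      by (meson le S(2) SUP_upper order_trans)
  qed
next
  case (finite p)
  let ?X = "\<lambda>k. ennpowr (x k) p"
  let ?h = "\<lambda>k. ennreal (2 powr - real_of_int k) * (?X k * indicator J k)"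
  have "ennreal (1 / u) * ennpowr (ennreal (u powr -\<theta> * w u) * g u) p * indicator S u \<le>
      ?h (level u) * indicator {0<..} u" for u
  proof (cases "u \<in> S")
    case True
    have "1 / u \<le> 2 powr - real_of_int (level u)"
      using dyadic_bounds(1)[OF S(1)[OF True]] by (simp add: powr_minus field_simps S(1)[OF True])
    moreover have "ennpowr (ennreal (u powr -\<theta> * w u) * g u) p \<le> ?X (level u)"
      using le[OF True] finite(1) by (rule ennpowr_mono)
    ultimately show ?thesis using S[OF True] True
      by (simp add: mult_mono ennreal_leI)
  qed simp
  then have "(\<integral>\<^sup>+ u. ennreal (1 / u) * ennpowr (ennreal (u powr -\<theta> * w u) * g u) p * indicator S u
      \<partial>lebesgue) \<le> (\<integral>\<^sup>+ u. ?h (level u) * indicator {0<..} u \<partial>lebesgue)"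
    by (intro nn_integral_mono)
  also have "\<dots> = (\<integral>\<^sup>+ k. ?h k * ennreal (2 powr real_of_int k) \<partial>count_space UNIV)"
    by (rule nn_integral_dyadic_step)
  also have "\<dots> = (\<integral>\<^sup>+ k. ?X k * indicator J k \<partial>count_space UNIV)"
  proof (intro nn_integral_cong)
    fix k
    have "ennreal (2 powr - real_of_int k) * ennreal (2 powr real_of_int k) = 1"
      by (simp add: powr_minus flip: ennreal_mult)
    then show "?h k * ennreal (2 powr real_of_int k) = ?X k * indicator J k"
      by (metis mult.commute mult.assoc mult_1)
  qed
  also have "\<dots> = (\<integral>\<^sup>+ k. ?X k \<partial>count_space J)"
    by (simp add: nn_integral_restrict_space[symmetric] restrict_count_space)
  finally show ?thesis
    using finite assms(2) S(1) unfolding finite(2)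
    by (subst wnorm_finite) (auto simp: lnorm_finite intro!: ennpowr_mono)
qed

text \<open>For \<open>q = \<infinity>\<close> the point is that a dyadic interval is not a null set. For finite \<open>q\<close> its measure
  with respect to \<open>du/u\<close> is at least \<open>1/2\<close>, whence the factor \<open>2 powr (1/q)\<close>.\<close>

lemma lnorm_le_wnorm:
  assumes "q > 0" "S \<in> sets lebesgue" "S \<subseteq> {0<..}" "c > 0"
    and S: "\<And>u. u > 0 \<Longrightarrow> level u \<in> J \<Longrightarrow> u \<in> S"
    and le: "\<And>u. u > 0 \<Longrightarrow> level u \<in> J \<Longrightarrow> x (level u) \<le> ennreal c * (ennreal (u powr -\<theta> * w u) * g u)"
  shows "lnorm q J x \<le> ennreal (c * 2 powr enn2real (1 / q)) * wnorm \<theta> q w S g"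
proof -
  let ?Y = "\<lambda>u. ennreal (u powr -\<theta> * w u) * g u"
  define y where "y k = ennreal (1 / c) * x k" for k
  have le': "y (level u) \<le> ?Y u" if "u > 0" "level u \<in> J" for u
  proof -
    have "y (level u) \<le> ennreal (1 / c) * (ennreal c * ?Y u)"
      unfolding y_def by (intro mult_left_mono le that) auto
    also have "\<dots> = ?Y u" using assms(4) by (simp flip: mult.assoc ennreal_mult)
    finally show ?thesis .
  qed
  have x: "x k = ennreal c * y k" for k
    using assms(4) unfolding y_def by (simp flip: mult.assoc ennreal_mult)
  have "lnorm q J y \<le> ennreal (2 powr enn2real (1 / q)) * wnorm \<theta> q w S g"
    using assms(1)
  proof (cases q rule: exponent_cases)
    case infinity
    have "y k \<le> Limsup (ae_filter (lebesgue_on S)) ?Y" if k: "k \<in> J" for k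
    proof (rule ccontr)
      let ?I = "{2 powr real_of_int k..<2 powr (real_of_int k + 1)}"
      have I: "u > 0" "level u = k" if "u \<in> ?I" for u
      proof -
        show "u > 0" using that by (auto intro: less_le_trans[of 0 "2 powr real_of_int k"])
        then show "level u = k" using that by (simp add: level_eq_iff)
      qed
      assume "\<not> y k \<le> Limsup (ae_filter (lebesgue_on S)) ?Y"
      then have "\<forall>\<^sub>F u in ae_filter (lebesgue_on S). ?Y u < y k"
        by (intro Limsup_lessD) simp
      then have "AE u in lebesgue. u \<in> S \<longrightarrow> ?Y u < y k"
        using assms(2) by (simp add: AE_restrict_space_iff)
      then have "AE u in lebesgue. u \<notin> ?I"
      proof (rule AE_mp, intro AE_I2 impI)
        fix u assume *: "u \<in> S \<longrightarrow> ?Y u < y k"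
        show "u \<notin> ?I"
        proof
          assume u: "u \<in> ?I"
          show False using * le'[of u] S[of u] I[OF u] k by auto
        qed
      qed
      then have "emeasure lebesgue ?I = 0"
        by (subst (asm) AE_iff_measurable[where N = ?I]) auto
      then show False by (simp add: powr_add)
    qed
    then show ?thesis
      by (auto simp: infinity lnorm_infinity wnorm_infinity intro!: SUP_least)
  next
    case (finite p)
    let ?X = "\<lambda>k. ennpowr (y k) p"
    let ?h = "\<lambda>k. ennreal (2 powr (- real_of_int k - 1)) * (?X k * indicator J k)"
    have "(\<integral>\<^sup>+ k. ?X k \<partial>count_space J) = (\<integral>\<^sup>+ k. ?X k * indicator J k \<partial>count_space UNIV)"
      by (simp add: nn_integral_restrict_space[symmetric] restrict_count_space)
    also have "\<dots> = (\<integral>\<^sup>+ k. ennreal 2 * (?h k * ennreal (2 powr real_of_int k)) \<partial>count_space UNIV)"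
    proof (intro nn_integral_cong)
      fix k
      have "ennreal 2 * (ennreal (2 powr (- real_of_int k - 1)) * ennreal (2 powr real_of_int k)) = 1"
      proof -
        have "2 * (2 powr (- real_of_int k - 1) * 2 powr real_of_int k) = (1::real)"
          by (simp flip: powr_add)
        then show ?thesis by (simp only: ennreal_mult[symmetric] powr_ge_zero mult_nonneg_nonneg
            zero_le_numeral ennreal_1)
      qed
      then show "?X k * indicator J k = ennreal 2 * (?h k * ennreal (2 powr real_of_int k))"
        by (metis mult.commute mult.assoc mult_1)
    qed
    also have "\<dots> = ennreal 2 * (\<integral>\<^sup>+ k. ?h k * ennreal (2 powr real_of_int k) \<partial>count_space UNIV)"
      by (rule nn_integral_cmult) simp
    also have "\<dots> = ennreal 2 * (\<integral>\<^sup>+ u. ?h (level u) * indicator {0<..} u \<partial>lebesgue)"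
      unfolding nn_integral_dyadic_step[of ?h, symmetric] ..
    also have "\<dots> \<le> ennreal 2 * (\<integral>\<^sup>+ u. ennreal (1 / u) * ennpowr (?Y u) p * indicator S u \<partial>lebesgue)"
    proof (intro mult_left_mono nn_integral_mono)
      fix u :: real
      show "?h (level u) * indicator {0<..} u \<le> ennreal (1 / u) * ennpowr (?Y u) p * indicator S u"
      proof (cases "u > 0 \<and> level u \<in> J")
        case True
        have "2 powr (- real_of_int (level u) - 1) \<le> 1 / u"
          using dyadic_bounds(2)[of u] True by (simp add: powr_minus powr_diff powr_add field_simps)
        moreover have "?X (level u) \<le> ennpowr (?Y u) p"
          using le'[of u] True finite(1) by (intro ennpowr_mono) auto
        ultimately have "ennreal (2 powr (- real_of_int (level u) - 1)) * ?X (level u) \<le>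
            ennreal (1 / u) * ennpowr (?Y u) p"
          by (intro mult_mono ennreal_leI) auto
        then show ?thesis using True S[of u] by (simp add: mult.assoc)
      qed auto
    qed simp
    finally have "ennpowr (\<integral>\<^sup>+ k. ?X k \<partial>count_space J) (1 / p) \<le>
        ennpowr (ennreal 2 * (\<integral>\<^sup>+ u. ennreal (1 / u) * ennpowr (?Y u) p * indicator S u \<partial>lebesgue)) (1 / p)"
      using finite(1) by (intro ennpowr_mono) auto
    moreover have "enn2real (1 / ennreal p) = 1 / p"
      using finite(1) by (simp add: divide_ennreal flip: ennreal_1)
    ultimately show ?thesis
      using finite(1) assms(2,3) unfolding finite(2)
      by (simp add: lnorm_finite wnorm_finite ennpowr_mult ennpowr_ennreal del: ennreal_numeral)
  qed
  then have "ennreal c * lnorm q J y \<le> ennreal c * (ennreal (2 powr enn2real (1 / q)) * wnorm \<theta> q w S g)"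
    by (intro mult_left_mono) auto
  moreover have "lnorm q J x = ennreal c * lnorm q J y"
    using lnorm_cmult[OF assms(1), of J "ennreal c" y] by (simp flip: x)
  ultimately show ?thesis
    using assms(4) by (simp add: ennreal_mult mult.assoc)
qed

section \<open>Families of functions and their dyadic samples\<close>

text \<open>\<open>samples G X\<close> says that, uniformly in \<open>i\<close>, the function \<open>G i\<close> is comparable on each dyadic
  interval with the value of \<open>X i\<close> at the level of that interval, and that neighbouring values
  of \<open>X i\<close> are comparable. The second half makes the relation stable under products and under
  passage to norms over rays \<open>(0, t)\<close> and \<open>(t, \<infinity>)\<close>, so that iterated norms can be discretized
  from the inside out.\<close>

definition samples :: "('i \<Rightarrow> real \<Rightarrow> ennreal) \<Rightarrow> ('i \<Rightarrow> int \<Rightarrow> ennreal) \<Rightarrow> bool" where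
  "samples G X \<longleftrightarrow> (\<exists>D::real.
     (\<forall>i. \<forall>u>0. G i u \<le> ennreal D * X i (level u) \<and> X i (level u) \<le> ennreal D * G i u) \<and>
     (\<forall>i k. X i k \<le> ennreal D * X i (k + 1) \<and> X i (k + 1) \<le> ennreal D * X i k))"

lemma samplesE:
  assumes "samples G X"
  obtains D where "D \<ge> 1"
    "\<And>i u. u > 0 \<Longrightarrow> G i u \<le> ennreal D * X i (level u)"
    "\<And>i u. u > 0 \<Longrightarrow> X i (level u) \<le> ennreal D * G i u"
    "\<And>i k. X i k \<le> ennreal D * X i (k + 1)"
    "\<And>i k. X i (k + 1) \<le> ennreal D * X i k"
proof -
  from assms obtain D where D:
    "\<And>i u. u > 0 \<Longrightarrow> G i u \<le> ennreal D * X i (level u)"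
    "\<And>i u. u > 0 \<Longrightarrow> X i (level u) \<le> ennreal D * G i u"
    "\<And>i k. X i k \<le> ennreal D * X i (k + 1)"
    "\<And>i k. X i (k + 1) \<le> ennreal D * X i k"
    unfolding samples_def by blast
  have "ennreal D * z \<le> ennreal (max D 1) * z" for z
    by (intro mult_right_mono ennreal_leI) auto
  then show ?thesis
    by (intro that[of "max D 1"]) (blast intro: D order_trans max.cobounded2)+
qed

lemma samplesI:
  assumes "C \<ge> 0" "D \<ge> 0"
    "\<And>i u. u > 0 \<Longrightarrow> G i u \<le> ennreal C * X i (level u)"
    "\<And>i u. u > 0 \<Longrightarrow> X i (level u) \<le> ennreal C * G i u"
    "\<And>i k. X i k \<le> ennreal D * X i (k + 1)"
    "\<And>i k. X i (k + 1) \<le> ennreal D * X i k"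
  shows "samples G X"
  unfolding samples_def
proof (rule exI[of _ "C + D"], intro conjI allI impI)
  have 1: "ennreal C * z \<le> ennreal (C + D) * z" "ennreal D * z \<le> ennreal (C + D) * z" for z
    using assms(1,2) by (auto intro!: mult_right_mono ennreal_leI)
  fix i
  show "G i u \<le> ennreal (C + D) * X i (level u)" "X i (level u) \<le> ennreal (C + D) * G i u" if "u > 0" for u
    using assms(3,4)[OF that] 1 by (blast intro: order_trans)+
  show "X i k \<le> ennreal (C + D) * X i (k + 1)" "X i (k + 1) \<le> ennreal (C + D) * X i k" for k
    using assms(5,6) 1 by (blast intro: order_trans)+
qed

lemma samples_cong:
  assumes "samples G X" "\<And>i u. u > 0 \<Longrightarrow> G i u = H i u"
  shows "samples H X"
  using assms unfolding samples_def by simp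

lemma samples_const_1: "samples (\<lambda>_ _. 1) (\<lambda>_ _. 1)"
  by (rule samplesI[of 1 1]) auto

lemma ennreal_mult_le_mult:
  assumes "x \<le> ennreal C * y" "z \<le> ennreal D * w" "C \<ge> 0" "D \<ge> 0"
  shows "x * z \<le> ennreal (C * D) * (y * w)"
proof -
  have "x * z \<le> (ennreal C * y) * (ennreal D * w)" using assms by (intro mult_mono) auto
  then show ?thesis using assms by (simp add: ennreal_mult mult_ac)
qed

lemma samples_mult:
  assumes "samples G X" "samples H Y"
  shows "samples (\<lambda>i u. G i u * H i u) (\<lambda>i k. X i k * Y i k)"
proof -
  obtain C where C: "C \<ge> 1"
    "\<And>i u. u > 0 \<Longrightarrow> G i u \<le> ennreal C * X i (level u)"
    "\<And>i u. u > 0 \<Longrightarrow> X i (level u) \<le> ennreal C * G i u"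
    "\<And>i k. X i k \<le> ennreal C * X i (k + 1)"
    "\<And>i k. X i (k + 1) \<le> ennreal C * X i k"
    using assms(1) by (rule samplesE) (rule that)
  obtain D where D: "D \<ge> 1"
    "\<And>i u. u > 0 \<Longrightarrow> H i u \<le> ennreal D * Y i (level u)"
    "\<And>i u. u > 0 \<Longrightarrow> Y i (level u) \<le> ennreal D * H i u"
    "\<And>i k. Y i k \<le> ennreal D * Y i (k + 1)"
    "\<And>i k. Y i (k + 1) \<le> ennreal D * Y i k"
    using assms(2) by (rule samplesE) (rule that)
  show ?thesis
    by (rule samplesI[of "C * D" "C * D"]) (use C(1) D(1) in \<open>auto intro!: ennreal_mult_le_mult C D\<close>)
qed

lemma lnorm_shift:
  assumes "q > 0" "(\<lambda>k. k + j) ` S = T" "\<And>k. k \<in> S \<Longrightarrow> x k \<le> ennreal C * y (k + j)"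
  shows "lnorm q S x \<le> ennreal C * lnorm q T y"
proof -
  have "bij_betw (\<lambda>k. k + j) S T" using assms(2) by (auto intro!: bij_betw_imageI inj_onI)
  from lnorm_reindex[OF this, of q y] show ?thesis
    using lnorm_mono[OF assms(1), of S x "\<lambda>k. ennreal C * y (k + j)"] assms(1,3)
    by (simp add: lnorm_cmult)
qed

lemma shift_images:
  "(\<lambda>k. k + j) ` {..n::int} = {..n + j}" "(\<lambda>k. k + j) ` {n::int..} = {n + j..}"
  "(\<lambda>k. k + j) ` {m..n::int} = {m + j..n + j}"
  by (auto simp: image_iff Bex_def) presburger+

text \<open>The intervals \<open>(t, \<infinity>)\<close>, with levels \<open>{n..}\<close> and step \<open>d = 1\<close>, and \<open>(0, t)\<close>, with levels
  \<open>{..n}\<close> and \<open>d = - 1\<close>, are treated together. Levels in \<open>N (level t)\<close> cover the interval; levels in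
  \<open>N (level t + d)\<close>, where the dyadic interval of \<open>t\<close> itself has been dropped, lie inside it.\<close>

locale dyadic_ray =
  fixes I :: "real \<Rightarrow> real set" and N :: "int \<Rightarrow> int set" and d :: int
  assumes unit_step: "d = 1 \<or> d = - 1"
    and ray_sets: "\<And>t. t > 0 \<Longrightarrow> I t \<in> sets lebesgue"
    and ray_pos: "\<And>t u. t > 0 \<Longrightarrow> u \<in> I t \<Longrightarrow> u > 0"
    and ray_index: "\<And>t u. t > 0 \<Longrightarrow> u \<in> I t \<Longrightarrow> level u \<in> N (level t)"
    and index_ray: "\<And>t u. t > 0 \<Longrightarrow> u > 0 \<Longrightarrow> level u \<in> N (level t + d) \<Longrightarrow> u \<in> I t"
    and index_shift: "\<And>n. (\<lambda>k. k + d) ` N n = N (n + d)"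
    and index_subset: "\<And>n. N (n + d) \<subseteq> N n"
begin

lemma neighbours:
  fixes x :: "'i \<Rightarrow> int \<Rightarrow> ennreal"
  assumes "\<And>i n. x i n \<le> ennreal D * x i (n + d)" "\<And>i n. x i (n + d) \<le> ennreal D * x i n"
  shows "x i n \<le> ennreal D * x i (n + 1)" "x i (n + 1) \<le> ennreal D * x i n"
  using unit_step assms[of i n] assms[of i "n + 1"] by auto

lemma neighbours':
  fixes x :: "'i \<Rightarrow> int \<Rightarrow> ennreal"
  assumes "\<And>i n. x i n \<le> ennreal D * x i (n + 1)" "\<And>i n. x i (n + 1) \<le> ennreal D * x i n"
  shows "x i n \<le> ennreal D * x i (n + d)" "x i (n + d) \<le> ennreal D * x i n"
  using unit_step assms[of i n] assms[of i "n - 1"] by auto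

text \<open>Dropping one level from the ray loses at most a constant factor, because shifting a sequence
  with comparable neighbours by one position does.\<close>

lemma samples_wnorm:
  assumes "q > 0" and G: "samples (\<lambda>i u. ennreal (u powr -\<theta> * w u) * G i u) X"
  shows "samples (\<lambda>i t. wnorm \<theta> q w (I t) (G i)) (\<lambda>i n. lnorm q (N n) (X i))"
proof -
  obtain D where D: "D \<ge> 1"
    "\<And>i u. u > 0 \<Longrightarrow> ennreal (u powr -\<theta> * w u) * G i u \<le> ennreal D * X i (level u)"
    "\<And>i u. u > 0 \<Longrightarrow> X i (level u) \<le> ennreal D * (ennreal (u powr -\<theta> * w u) * G i u)"
    "\<And>i k. X i k \<le> ennreal D * X i (k + 1)"
    "\<And>i k. X i (k + 1) \<le> ennreal D * X i k"
    using G by (rule samplesE) (rule that)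
  define E where "E = D * 2 powr enn2real (1 / q)"
  have E: "E \<ge> 1" using D(1) by (auto simp: E_def intro!: mult_ge1_I ge_one_powr_ge_zero)
  have shift: "lnorm q (N n) (X i) \<le> ennreal D * lnorm q (N (n + d)) (X i)" for i n
    by (intro lnorm_shift[where j = d] assms(1) index_shift neighbours'(1)[where x = X] D(4,5))
  have unshift: "lnorm q (N (n + d)) (X i) \<le> ennreal D * lnorm q (N n) (X i)" for i n
  proof -
    have "lnorm q (N (n + d)) (X i) \<le> 1 * lnorm q (N n) (X i)"
      using lnorm_subset[OF assms(1) index_subset] by simp
    also have "\<dots> \<le> ennreal D * lnorm q (N n) (X i)" using D(1) by (intro mult_right_mono) auto
    finally show ?thesis .
  qed
  show ?thesis
  proof (rule samplesI[of "D * E" D])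
    fix i and t :: real assume t: "t > 0"
    have "wnorm \<theta> q w (I t) (G i) \<le> lnorm q (N (level t)) (\<lambda>k. ennreal D * X i k)"
      using D(2) ray_pos[OF t] by (intro wnorm_le_lnorm assms(1) ray_sets t ray_index) auto
    also have "\<dots> = ennreal D * lnorm q (N (level t)) (X i)" by (rule lnorm_cmult[OF assms(1)])
    also have "\<dots> \<le> ennreal (D * E) * lnorm q (N (level t)) (X i)"
      using D(1) E by (intro mult_right_mono ennreal_leI) auto
    finally show "wnorm \<theta> q w (I t) (G i) \<le> ennreal (D * E) * lnorm q (N (level t)) (X i)" .
    have "lnorm q (N (level t + d)) (X i) \<le> ennreal E * wnorm \<theta> q w (I t) (G i)"
      unfolding E_def using D(1,3) ray_pos[OF t]
      by (intro lnorm_le_wnorm assms(1) ray_sets t index_ray) auto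
    then have "ennreal D * lnorm q (N (level t + d)) (X i) \<le> ennreal (D * E) * wnorm \<theta> q w (I t) (G i)"
      using D(1) E by (simp add: ennreal_mult mult.assoc mult_left_mono)
    then show "lnorm q (N (level t)) (X i) \<le> ennreal (D * E) * wnorm \<theta> q w (I t) (G i)"
      by (rule order_trans[OF shift])
  qed (use D(1) E in \<open>auto intro!: neighbours[where x = "\<lambda>i n. lnorm q (N n) (X i)"] shift unshift\<close>)
qed

end

text \<open>In addition to a ray, the segments between \<open>t\<close> and a point \<open>s\<close> of the ray, for the double norms
  \<open>\<chi>\<^sub>0\<close> and \<open>\<chi>\<^sub>1\<close>. Now both end levels have to be dropped to stay inside the segment.\<close>

locale dyadic_segments = dyadic_ray I N d for I N d +
  fixes J :: "real \<Rightarrow> real \<Rightarrow> real set" and M :: "int \<Rightarrow> int \<Rightarrow> int set"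
  assumes segment_sets: "\<And>t s. J t s \<in> sets lebesgue"
    and segment_pos: "\<And>t s u. t > 0 \<Longrightarrow> s > 0 \<Longrightarrow> u \<in> J t s \<Longrightarrow> u > 0"
    and segment_index: "\<And>t s u. t > 0 \<Longrightarrow> s > 0 \<Longrightarrow> u \<in> J t s \<Longrightarrow> level u \<in> M (level t) (level s)"
    and index_segment: "\<And>t s u. t > 0 \<Longrightarrow> s > 0 \<Longrightarrow> u > 0 \<Longrightarrow>
      level u \<in> M (level t + d) (level s - d) \<Longrightarrow> u \<in> J t s"
    and segment_shift: "\<And>n k. (\<lambda>j. j + d) ` M n k = M (n + d) (k + d)"
    and segment_subset: "\<And>n k. M n k \<subseteq> M n (k + d)"
    and segment_cover: "\<And>n k. k \<in> N (n + d + d) \<Longrightarrow>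
      M n k \<subseteq> M n (k - d - d) \<union> (M (n + d) (k - d) \<union> M (n + d + d) k)"
begin

text \<open>Provided that at least three levels are present, the two end levels are controlled by their
  inner neighbours.\<close>

lemma segment_shrink:
  assumes "q > 0" "D \<ge> 1" "\<And>k. A k \<le> ennreal D * A (k + 1)" "\<And>k. A (k + 1) \<le> ennreal D * A k"
  obtains C where "C > 0"
    "\<And>n k. k \<in> N (n + d + d) \<Longrightarrow> lnorm q (M n k) A \<le> ennreal C * lnorm q (M (n + d) (k - d)) A"
proof -
  obtain E where E: "E \<ge> 1" "\<And>S T x. lnorm q (S \<union> T) x \<le> ennreal E * (lnorm q S x + lnorm q T x)"
    by (rule dominatedE3[OF lnorm_Un[OF assms(1)]]) (rule that)
  note A = neighbours'[where x = "\<lambda>_ :: unit. A", OF assms(3,4)]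
  have "lnorm q (M n k) A \<le> ennreal (E * (D + E * (1 + D))) * lnorm q (M (n + d) (k - d)) A"
    if "k \<in> N (n + d + d)" for n k
  proof -
    let ?L = "lnorm q (M (n + d) (k - d)) A"
    have 1: "lnorm q (M n (k - d - d)) A \<le> ennreal D * ?L"
      using segment_shift[of n "k - d - d"] A(1) by (intro lnorm_shift[where j = d] assms(1)) auto
    have 2: "lnorm q (M (n + d + d) k) A \<le> ennreal D * ?L"
    proof (intro lnorm_shift[where j = "- d"] assms(1))
      show "(\<lambda>j. j + - d) ` M (n + d + d) k = M (n + d) (k - d)"
        using segment_shift[of "n + d" "k - d", symmetric] by (simp add: image_image)
      show "A j \<le> ennreal D * A (j + - d)" for j using A(2)[of "j - d"] by simp
    qed
    have "lnorm q (M n k) A \<le> lnorm q (M n (k - d - d) \<union> (M (n + d) (k - d) \<union> M (n + d + d) k)) A"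
      by (rule lnorm_subset[OF assms(1) segment_cover[OF that]])
    also have "\<dots> \<le> ennreal E * (lnorm q (M n (k - d - d)) A + ennreal E * (?L + lnorm q (M (n + d + d) k) A))"
      by (rule order_trans[OF E(2) mult_left_mono[OF add_left_mono[OF E(2)]]]) simp
    also have "\<dots> \<le> ennreal E * (ennreal D * ?L + ennreal E * (?L + ennreal D * ?L))"
      by (intro mult_left_mono add_mono order_refl zero_le 1 2)
    also have "\<dots> = ennreal (E * (D + E * (1 + D))) * ?L"
      using assms(2) E(1) by (simp add: ennreal_mult ennreal_plus distrib_left distrib_right mult.assoc)
    finally show ?thesis .
  qed
  moreover have "E * (D + E * (1 + D)) > 0" using assms(2) E(1) by (intro mult_pos_pos add_pos_pos) auto
  ultimately show ?thesis by (rule that[rotated])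
qed

text \<open>The inner norm tends to \<open>0\<close> as \<open>s\<close> approaches \<open>t\<close>, so as a function of \<open>s\<close> it is not comparable
  with any sequence that has comparable neighbours. The lower bound therefore keeps only those
  \<open>s\<close> that are at least two levels away from \<open>t\<close>, where the segment norm can be shrunk, and then
  recovers the two missing levels by shifting the outer norm.\<close>

lemma samples_nested:
  assumes "r > 0" "q > 0"
    and a: "samples (\<lambda>_ :: unit. \<lambda>u. ennreal (a u)) (\<lambda>_. A)"
    and b: "samples (\<lambda>_ :: unit. \<lambda>u. ennreal (b u)) (\<lambda>_. B)"
  shows "samples (\<lambda>_ :: unit. \<lambda>t. wnorm 0 r b (I t) (\<lambda>s. wnorm 0 q a (J t s) (\<lambda>_. 1)))
    (\<lambda>_ n. lnorm r (N n) (\<lambda>k. B k * lnorm q (M n k) A))"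
proof -
  obtain D1 where D1: "D1 \<ge> 1"
    "\<And>u. u > 0 \<Longrightarrow> ennreal (a u) \<le> ennreal D1 * A (level u)"
    "\<And>u. u > 0 \<Longrightarrow> A (level u) \<le> ennreal D1 * ennreal (a u)"
    "\<And>k. A k \<le> ennreal D1 * A (k + 1)"
    "\<And>k. A (k + 1) \<le> ennreal D1 * A k"
    using a by (rule samplesE) (rule that)
  obtain D2 where D2: "D2 \<ge> 1"
    "\<And>u. u > 0 \<Longrightarrow> ennreal (b u) \<le> ennreal D2 * B (level u)"
    "\<And>u. u > 0 \<Longrightarrow> B (level u) \<le> ennreal D2 * ennreal (b u)"
    "\<And>k. B k \<le> ennreal D2 * B (k + 1)"
    "\<And>k. B (k + 1) \<le> ennreal D2 * B k"
    using b by (rule samplesE) (rule that)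
  obtain C where C: "C > 0"
    "\<And>n k. k \<in> N (n + d + d) \<Longrightarrow> lnorm q (M n k) A \<le> ennreal C * lnorm q (M (n + d) (k - d)) A"
    by (rule segment_shrink[where A = A, OF assms(2) D1(1,4,5)]) (rule that)
  note A = neighbours'[where x = "\<lambda>_ :: unit. A", OF D1(4,5)]
  note B = neighbours'[where x = "\<lambda>_ :: unit. B", OF D2(4,5)]
  define E1 where "E1 = D1 * 2 powr enn2real (1 / q)"
  define E where "E = D2 * (C * E1) * 2 powr enn2real (1 / r)"
  have E1: "E1 > 0" using D1(1) by (simp add: E1_def)
  have E: "E > 0" using C E1 D2(1) by (simp add: E_def)
  define Y where "Y n k = B k * lnorm q (M n k) A" for n k
  define X where "X n = lnorm r (N n) (Y n)" for n
  define W where "W t = wnorm 0 r b (I t) (\<lambda>s. wnorm 0 q a (J t s) (\<lambda>_. 1))" for t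
  have up: "W t \<le> ennreal (D1 * D2) * X (level t)" if t: "t > 0" for t
  proof -
    have "wnorm 0 q a (J t s) (\<lambda>_. 1) \<le> ennreal D1 * lnorm q (M (level t) (level s)) A" if s: "s > 0" for s
      unfolding lnorm_cmult[OF assms(2), symmetric]
      using segment_pos[OF t s] D1(2) by (intro wnorm_le_lnorm assms(2) segment_sets segment_index t s) auto
    then have "W t \<le> lnorm r (N (level t)) (\<lambda>k. ennreal (D2 * D1) * Y (level t) k)"
      using ray_pos[OF t] D1(1) D2(1) unfolding Y_def W_def
      by (intro wnorm_le_lnorm assms(1) ray_sets ray_index t)
        (auto intro!: ennreal_mult_le_mult D2(2))
    then show ?thesis by (simp add: lnorm_cmult[OF assms(1)] X_def mult.commute)
  qed
  have low: "lnorm r (N (level t + d + d)) (Y (level t)) \<le> ennreal E * W t" if t: "t > 0" for t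
    unfolding E_def W_def
  proof (intro lnorm_le_wnorm assms(1) ray_sets t)
    fix s :: real assume s: "s > 0" "level s \<in> N (level t + d + d)"
    then show "s \<in> I t" using index_ray[OF t s(1)] index_subset[of "level t + d"] by blast
    have inner: "lnorm q (M (level t + d) (level s - d)) A \<le> ennreal E1 * wnorm 0 q a (J t s) (\<lambda>_. 1)"
      unfolding E1_def using segment_pos[OF t s(1)] D1(1,3)
      by (intro lnorm_le_wnorm assms(2) segment_sets index_segment t s(1)) auto
    have "lnorm q (M (level t) (level s)) A \<le> ennreal C * (ennreal E1 * wnorm 0 q a (J t s) (\<lambda>_. 1))"
      by (rule order_trans[OF C(2)[OF s(2)] mult_left_mono[OF inner]]) simp
    then have "lnorm q (M (level t) (level s)) A \<le> ennreal (C * E1) * wnorm 0 q a (J t s) (\<lambda>_. 1)"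
      using C(1) E1 by (simp add: ennreal_mult mult.assoc)
    then show "Y (level t) (level s) \<le> ennreal (D2 * (C * E1)) *
        (ennreal (s powr - 0 * b s) * wnorm 0 q a (J t s) (\<lambda>_. 1))"
      unfolding Y_def using s C(1) E1 D2(1,3) by (intro ennreal_mult_le_mult) auto
  qed (use ray_pos[OF t] C E1 D2(1) in auto)
  have Y: "Y n k \<le> ennreal D2 * Y n (k + d)" for n k
  proof -
    have "Y n k \<le> ennreal (D2 * 1) * (B (k + d) * lnorm q (M n (k + d)) A)"
      unfolding Y_def using D2(1) B(1) lnorm_subset[OF assms(2) segment_subset]
      by (intro ennreal_mult_le_mult) auto
    then show ?thesis by (simp add: Y_def)
  qed
  have one_step: "lnorm r (N m) (Y n) \<le> ennreal D2 * lnorm r (N (m + d)) (Y n)" for m n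
    by (intro lnorm_shift[where j = d] assms(1) index_shift Y)
  have two_steps: "X n \<le> ennreal (D2 * D2) * lnorm r (N (n + d + d)) (Y n)" for n
  proof -
    have "X n \<le> ennreal D2 * (ennreal D2 * lnorm r (N (n + d + d)) (Y n))"
      unfolding X_def by (rule order_trans[OF one_step mult_left_mono[OF one_step]]) simp
    then show ?thesis using D2(1) by (simp add: ennreal_mult mult.assoc)
  qed
  have X_le: "X n \<le> ennreal (D2 * D1) * X (n + d)" for n
    unfolding X_def Y_def using D1(1) D2(1) A(1) B(1)
    by (intro lnorm_shift[where j = d] ennreal_mult_le_mult assms(1,2) index_shift segment_shift) auto
  have X_ge: "X (n + d) \<le> ennreal (D2 * D1) * X n" for n
    unfolding X_def Y_def
  proof (intro lnorm_shift[where j = "- d"] ennreal_mult_le_mult assms(1,2))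
    show "(\<lambda>k. k + - d) ` N (n + d) = N n"
      using index_shift[of n, symmetric] by (simp add: image_image)
    show "(\<lambda>j. j + - d) ` M (n + d) k = M n (k + - d)" for k
      using segment_shift[of n "k - d", symmetric] by (simp add: image_image)
    show "A j \<le> ennreal D1 * A (j + - d)" "B j \<le> ennreal D2 * B (j + - d)" for j
      using A(2)[of "j - d"] B(2)[of "j - d"] by auto
  qed (use D1(1) D2(1) in auto)
  have "samples (\<lambda>_ :: unit. W) (\<lambda>_. X)"
  proof (rule samplesI[of "D1 * D2 + (D2 * D2) * E" "D2 * D1"])
    let ?C = "D1 * D2 + (D2 * D2) * E"
    fix t :: real assume t: "t > 0"
    show "W t \<le> ennreal ?C * X (level t)"
      using E D2(1) by (intro order_trans[OF up[OF t]] mult_right_mono ennreal_leI) auto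
    have "X (level t) \<le> ennreal (D2 * D2) * (ennreal E * W t)"
      by (rule order_trans[OF two_steps mult_left_mono[OF low[OF t]]]) simp
    also have "\<dots> = ennreal (D2 * D2 * E) * W t"
      using D2(1) E by (simp add: ennreal_mult mult.assoc)
    also have "\<dots> \<le> ennreal ?C * W t"
      using D1(1) D2(1) by (intro mult_right_mono ennreal_leI) auto
    finally show "X (level t) \<le> ennreal ?C * W t" .
  qed (use D1(1) D2(1) E in \<open>auto intro!: neighbours[where x = "\<lambda>_ :: unit. X"] X_le X_ge\<close>)
  then show ?thesis by (simp add: W_def[abs_def] X_def[abs_def] Y_def[abs_def])
qed

end

interpretation upward: dyadic_segments "\<lambda>t. {t<..}" "\<lambda>n. {n..}" 1 "\<lambda>t s. {t<..<s}" "\<lambda>n k. {n..k}"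
proof
  show "u \<in> {t<..}" if "t > 0" "u > 0" "level u \<in> {level t + 1..}" for t u
    using that level_mono[of u t] by (cases "u \<le> t") auto
  show "u \<in> {t<..<s}" if "t > 0" "s > 0" "u > 0" "level u \<in> {level t + 1..level s - 1}" for t s u
    using that level_mono[of u t] level_mono[of s u] by (cases "u \<le> t"; cases "s \<le> u") auto
qed (auto simp: shift_images intro: level_mono)

interpretation downward: dyadic_segments "\<lambda>t. {0<..<t}" "\<lambda>n. {..n}" "- 1"
  "\<lambda>t s. {s<..<t}" "\<lambda>n k. {k..n}"
proof
  show "u \<in> {0<..<t}" if "t > 0" "u > 0" "level u \<in> {..level t + - 1}" for t u
    using that level_mono[of t u] by (cases "t \<le> u") auto
  show "u \<in> {s<..<t}" if "t > 0" "s > 0" "u > 0" "level u \<in> {level s - - 1..level t + - 1}" for t s u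
    using that level_mono[of u s] level_mono[of t u] by (cases "u \<le> s"; cases "t \<le> u") auto
  show "(\<lambda>k. k + - 1) ` {..n} = {..n + - 1}" for n :: int by (rule shift_images)
  show "(\<lambda>j. j + - 1) ` {k..n} = {k + - 1..n + - 1}" for n k :: int by (rule shift_images)
qed (auto intro: level_mono)

lemma wnorm_equivalent_lnorm:
  assumes "q > 0" and G: "samples (\<lambda>i u. ennreal (u powr -\<theta> * w u) * G i u) X"
  shows "(\<lambda>i. wnorm \<theta> q w {0<..} (G i)) \<asymp> (\<lambda>i. lnorm q UNIV (X i))"
proof -
  obtain D where D: "D \<ge> 1"
    "\<And>i u. u > 0 \<Longrightarrow> ennreal (u powr -\<theta> * w u) * G i u \<le> ennreal D * X i (level u)"
    "\<And>i u. u > 0 \<Longrightarrow> X i (level u) \<le> ennreal D * (ennreal (u powr -\<theta> * w u) * G i u)"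
    using G by (rule samplesE) (rule that)
  show ?thesis
  proof (rule equivalentI)
    show "(\<lambda>i. wnorm \<theta> q w {0<..} (G i)) \<preceq> (\<lambda>i. lnorm q UNIV (X i))"
    proof (rule dominatedI)
      fix i
      have "wnorm \<theta> q w {0<..} (G i) \<le> lnorm q UNIV (\<lambda>k. ennreal D * X i k)"
        using D(2) by (intro wnorm_le_lnorm assms(1)) auto
      then show "wnorm \<theta> q w {0<..} (G i) \<le> ennreal D * lnorm q UNIV (X i)"
        by (simp add: lnorm_cmult[OF assms(1)])
    qed
    show "(\<lambda>i. lnorm q UNIV (X i)) \<preceq> (\<lambda>i. wnorm \<theta> q w {0<..} (G i))"
      using D(1,3) by (intro dominatedI[where C = "D * 2 powr enn2real (1 / q)"] lnorm_le_wnorm assms(1)) auto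
  qed
qed

text \<open>The discrete \<open>\<chi>\<^sub>0\<close>; the discrete \<open>\<chi>\<^sub>1\<close> is its reflection \<open>k \<mapsto> - k\<close>.\<close>

definition chi_seq ::
    "ennreal \<Rightarrow> (int \<Rightarrow> ennreal) \<Rightarrow> ennreal \<Rightarrow> (int \<Rightarrow> ennreal) \<Rightarrow> int \<Rightarrow> ennreal" where
  "chi_seq r b q a n = lnorm r {n..} (\<lambda>k. b k * lnorm q {n..k} a)"

section \<open>Slowly varying and decaying sequences\<close>

text \<open>Slow variation and geometric decay of sequences of extended reals. Values \<open>0\<close> and \<open>\<infinity>\<close> are
  allowed, so that norms of slowly varying weights can be tested without knowing that they are
  finite.\<close>

definition slow :: "(int \<Rightarrow> ennreal) \<Rightarrow> bool" where
  "slow w \<longleftrightarrow> (\<forall>\<epsilon>>0. \<exists>C>0. \<forall>m n.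
     w m \<le> ennreal (C * 2 powr (\<epsilon> * \<bar>real_of_int m - real_of_int n\<bar>)) * w n)"

definition decays :: "(int \<Rightarrow> ennreal) \<Rightarrow> bool" where
  "decays v \<longleftrightarrow> (\<exists>C>0. \<exists>\<eta>>0. \<forall>k n. k \<le> n \<longrightarrow>
     v n \<le> ennreal (C * 2 powr (- \<eta> * (real_of_int n - real_of_int k))) * v k)"

definition flip :: "(int \<Rightarrow> ennreal) \<Rightarrow> int \<Rightarrow> ennreal" where
  "flip w k = w (- k)"

lemma decaysI:
  assumes "C > 0" "\<eta> > 0"
    "\<And>k n. k \<le> n \<Longrightarrow> v n \<le> ennreal (C * 2 powr (- \<eta> * (real_of_int n - real_of_int k))) * v k"
  shows "decays v"
  using assms unfolding decays_def by blast

lemma slowE: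
  assumes "slow w" "\<epsilon> > 0"
  obtains C where "C > 0"
    "\<And>m n. w m \<le> ennreal (C * 2 powr (\<epsilon> * \<bar>real_of_int m - real_of_int n\<bar>)) * w n"
  using assms unfolding slow_def by blast

lemma slow_mult:
  assumes "slow v" "slow w"
  shows "slow (\<lambda>n. v n * w n)"
  unfolding slow_def
proof (intro allI impI)
  fix \<epsilon> :: real assume \<epsilon>: "\<epsilon> > 0"
  obtain C where C: "C > 0"
    "\<And>m n. v m \<le> ennreal (C * 2 powr (\<epsilon> / 2 * \<bar>real_of_int m - real_of_int n\<bar>)) * v n"
    by (rule slowE[OF assms(1), of "\<epsilon> / 2"]) (use \<epsilon> in \<open>auto intro: that\<close>)
  obtain D where D: "D > 0"
    "\<And>m n. w m \<le> ennreal (D * 2 powr (\<epsilon> / 2 * \<bar>real_of_int m - real_of_int n\<bar>)) * w n"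
    by (rule slowE[OF assms(2), of "\<epsilon> / 2"]) (use \<epsilon> in \<open>auto intro: that\<close>)
  show "\<exists>C>0. \<forall>m n. v m * w m \<le>
      ennreal (C * 2 powr (\<epsilon> * \<bar>real_of_int m - real_of_int n\<bar>)) * (v n * w n)"
  proof (intro exI[of _ "C * D"] conjI allI)
    fix m n
    let ?d = "\<bar>real_of_int m - real_of_int n\<bar>"
    have "C * 2 powr (\<epsilon> / 2 * ?d) * (D * 2 powr (\<epsilon> / 2 * ?d)) = C * D * 2 powr (\<epsilon> * ?d)"
      by (simp add: mult.assoc mult.left_commute flip: powr_add)
    moreover have "v m * w m \<le>
        ennreal (C * 2 powr (\<epsilon> / 2 * ?d) * (D * 2 powr (\<epsilon> / 2 * ?d))) * (v n * w n)"
      using C(1) D(1) by (intro ennreal_mult_le_mult C(2) D(2)) auto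
    ultimately show "v m * w m \<le> ennreal (C * D * 2 powr (\<epsilon> * ?d)) * (v n * w n)"
      by (simp only:)
  qed (use C(1) D(1) in simp)
qed

lemma slow_flip: "slow w \<Longrightarrow> slow (flip w)"
  unfolding slow_def
proof (intro allI impI)
  fix \<epsilon> :: real assume *: "\<forall>\<epsilon>>0. \<exists>C>0. \<forall>m n.
     w m \<le> ennreal (C * 2 powr (\<epsilon> * \<bar>real_of_int m - real_of_int n\<bar>)) * w n" "\<epsilon> > 0"
  then obtain C where C: "C > 0"
    "\<And>m n. w m \<le> ennreal (C * 2 powr (\<epsilon> * \<bar>real_of_int m - real_of_int n\<bar>)) * w n" by blast
  have "\<bar>- real_of_int m + real_of_int n\<bar> = \<bar>real_of_int m - real_of_int n\<bar>" for m n by simp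
  then have "flip w m \<le> ennreal (C * 2 powr (\<epsilon> * \<bar>real_of_int m - real_of_int n\<bar>)) * flip w n" for m n
    using C(2)[of "-m" "-n"] by (simp add: flip_def)
  then show "\<exists>C>0. \<forall>m n.
     flip w m \<le> ennreal (C * 2 powr (\<epsilon> * \<bar>real_of_int m - real_of_int n\<bar>)) * flip w n"
    using C(1) by blast
qed

text \<open>Shifting the index set by \<open>n - m\<close> is the same as shifting the weight.\<close>

lemma slow_lnorm_atLeast:
  assumes "r > 0" "slow b"
  shows "slow (\<lambda>n. lnorm r {n..} b)"
  unfolding slow_def
proof (intro allI impI)
  fix \<epsilon> :: real assume \<epsilon>: "\<epsilon> > 0"
  obtain C where C: "C > 0"
    "\<And>m n. b m \<le> ennreal (C * 2 powr (\<epsilon> * \<bar>real_of_int m - real_of_int n\<bar>)) * b n"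
    by (rule slowE[OF assms(2) \<epsilon>]) (rule that)
  show "\<exists>C>0. \<forall>m n. lnorm r {m..} b \<le>
      ennreal (C * 2 powr (\<epsilon> * \<bar>real_of_int m - real_of_int n\<bar>)) * lnorm r {n..} b"
  proof (intro exI[of _ C] conjI allI)
    fix m n
    have "b k \<le> ennreal (C * 2 powr (\<epsilon> * \<bar>real_of_int m - real_of_int n\<bar>)) * b (k + (n - m))" for k
      using C(2)[of k "k + (n - m)"] by (simp add: abs_minus_commute)
    then show "lnorm r {m..} b \<le>
        ennreal (C * 2 powr (\<epsilon> * \<bar>real_of_int m - real_of_int n\<bar>)) * lnorm r {n..} b"
      by (intro lnorm_shift[where j = "n - m"] assms(1)) (simp_all add: shift_images)
  qed (rule C)
qed

lemma slow_chi_seq: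
  assumes "r > 0" "q > 0" "slow b" "slow a"
  shows "slow (chi_seq r b q a)"
  unfolding slow_def
proof (intro allI impI)
  fix \<epsilon> :: real assume \<epsilon>: "\<epsilon> > 0"
  obtain C where C: "C > 0"
    "\<And>m n. b m \<le> ennreal (C * 2 powr (\<epsilon> / 2 * \<bar>real_of_int m - real_of_int n\<bar>)) * b n"
    by (rule slowE[OF assms(3), of "\<epsilon> / 2"]) (use \<epsilon> in \<open>auto intro: that\<close>)
  obtain D where D: "D > 0"
    "\<And>m n. a m \<le> ennreal (D * 2 powr (\<epsilon> / 2 * \<bar>real_of_int m - real_of_int n\<bar>)) * a n"
    by (rule slowE[OF assms(4), of "\<epsilon> / 2"]) (use \<epsilon> in \<open>auto intro: that\<close>)
  show "\<exists>C>0. \<forall>m n. chi_seq r b q a m \<le>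
      ennreal (C * 2 powr (\<epsilon> * \<bar>real_of_int m - real_of_int n\<bar>)) * chi_seq r b q a n"
  proof (intro exI[of _ "C * D"] conjI allI)
    fix m n
    let ?p = "2 powr (\<epsilon> / 2 * \<bar>real_of_int m - real_of_int n\<bar>)"
    have a: "a k \<le> ennreal (D * ?p) * a (k + (n - m))" for k
      using D(2)[of k "k + (n - m)"] by (simp add: abs_minus_commute)
    have b: "b k \<le> ennreal (C * ?p) * b (k + (n - m))" for k
      using C(2)[of k "k + (n - m)"] by (simp add: abs_minus_commute)
    have "b k * lnorm q {m..k} a \<le>
        ennreal (C * ?p * (D * ?p)) * (b (k + (n - m)) * lnorm q {n..k + (n - m)} a)" for k
      using C(1) D(1) a b
      by (intro ennreal_mult_le_mult lnorm_shift[where j = "n - m"] assms(2))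
        (auto simp: shift_images)
    moreover have eq: "C * ?p * (D * ?p) = C * D * 2 powr (\<epsilon> * \<bar>real_of_int m - real_of_int n\<bar>)"
      by (simp add: mult.assoc mult.left_commute flip: powr_add)
    ultimately show "chi_seq r b q a m \<le>
        ennreal (C * D * 2 powr (\<epsilon> * \<bar>real_of_int m - real_of_int n\<bar>)) * chi_seq r b q a n"
      unfolding eq[symmetric] chi_seq_def
      by (intro lnorm_shift[where j = "n - m"] assms(1)) (simp_all add: shift_images)
  qed (use C(1) D(1) in simp)
qed

lemma decays_mult_slow:
  assumes "decays v" "slow w"
  shows "decays (\<lambda>n. v n * w n)"
proof -
  from assms(1) obtain C \<eta> where C: "C > 0" "\<eta> > 0"
    "\<And>k n. k \<le> n \<Longrightarrow> v n \<le> ennreal (C * 2 powr (- \<eta> * (real_of_int n - real_of_int k))) * v k"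
    unfolding decays_def by blast
  obtain D where D: "D > 0"
    "\<And>m n. w m \<le> ennreal (D * 2 powr (\<eta> / 2 * \<bar>real_of_int m - real_of_int n\<bar>)) * w n"
    by (rule slowE[OF assms(2), of "\<eta> / 2"]) (use C(2) in \<open>auto intro: that\<close>)
  show ?thesis
  proof (rule decaysI[of "C * D" "\<eta> / 2"])
    fix k n :: int assume kn: "k \<le> n"
    let ?d = "real_of_int n - real_of_int k"
    have eq: "C * 2 powr (- \<eta> * ?d) * (D * 2 powr (\<eta> / 2 * \<bar>?d\<bar>)) =
        C * D * 2 powr (- (\<eta> / 2) * ?d)"
    proof -
      have "- \<eta> * ?d + \<eta> / 2 * ?d = - (\<eta> / 2) * ?d" by (simp add: field_simps)
      then have "2 powr (- \<eta> * ?d) * 2 powr (\<eta> / 2 * ?d) = 2 powr (- (\<eta> / 2) * ?d)"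
        by (simp only: powr_add[symmetric])
      moreover have "\<bar>?d\<bar> = ?d" using kn by simp
      ultimately show ?thesis by (simp only: mult.assoc mult.left_commute[of _ D])
    qed
    have "v n * w n \<le>
        ennreal (C * 2 powr (- \<eta> * ?d) * (D * 2 powr (\<eta> / 2 * \<bar>?d\<bar>))) * (v k * w k)"
      using C(1) D(1) by (intro ennreal_mult_le_mult C(3) kn D(2)) auto
    then show "v n * w n \<le> ennreal (C * D * 2 powr (- (\<eta> / 2) * ?d)) * (v k * w k)"
      by (simp only: eq)
  qed (use C D in auto)
qed

lemma decays_powr:
  assumes "\<theta> > 0"
  shows "decays (\<lambda>n. ennreal (2 powr (- \<theta> * real_of_int n)))"
  by (rule decaysI[of 1 \<theta>])
    (use assms in \<open>auto simp: field_simps simp flip: ennreal_mult powr_add\<close>)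

lemma lnorm_geometric:
  assumes "q > 0" "\<eta> > 0"
  obtains C where "C > 0"
    "\<And>n. lnorm q {..n} (\<lambda>k. ennreal (2 powr (- \<eta> * (real_of_int n - real_of_int k)))) \<le> ennreal C"
  using assms(1)
proof (cases q rule: exponent_cases)
  case infinity
  show ?thesis
  proof (rule that[of 1])
    show "lnorm q {..n} (\<lambda>k. ennreal (2 powr (- \<eta> * (real_of_int n - real_of_int k)))) \<le> ennreal 1" for n
      unfolding infinity lnorm_infinity
    proof (intro SUP_least ennreal_leI)
      fix k assume "k \<in> {..n}"
      then have "- \<eta> * (real_of_int n - real_of_int k) \<le> 0" using assms(2) by simp
      then have "2 powr (- \<eta> * (real_of_int n - real_of_int k)) \<le> 2 powr 0"
        by (intro powr_mono) auto
      then show "2 powr (- \<eta> * (real_of_int n - real_of_int k)) \<le> 1" by simp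
    qed
  qed simp
next
  case (finite p)
  define x where "x = 2 powr (- (\<eta> * p))"
  have x: "0 < x" "x < 1" using finite assms(2) using powr_less_mono[of "- (\<eta> * p)" 0 2]
    by (auto simp: x_def)
  have "lnorm q {..n} (\<lambda>k. ennreal (2 powr (- \<eta> * (real_of_int n - real_of_int k)))) =
      ennreal ((1 / (1 - x)) powr (1 / p))" for n
  proof -
    have "bij_betw (\<lambda>j. n - int j) UNIV {..n}"
    proof (rule bij_betw_imageI)
      show "range (\<lambda>j. n - int j) = {..n}"
      proof (intro equalityI subsetI)
        fix k assume "k \<in> {..n}"
        then have "k = n - int (nat (n - k))" by simp
        then show "k \<in> range (\<lambda>j. n - int j)" by (rule range_eqI)
      qed auto
    qed (auto intro: inj_onI)
    note reindexed = nn_integral_bij_count_space[OF this,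
        of "\<lambda>k. ennpowr (ennreal (2 powr (- \<eta> * (real_of_int n - real_of_int k)))) p"]
    have "(\<integral>\<^sup>+ k. ennpowr (ennreal (2 powr (- \<eta> * (real_of_int n - real_of_int k)))) p \<partial>count_space {..n}) =
        (\<integral>\<^sup>+ j. ennreal (x ^ j) \<partial>count_space (UNIV :: nat set))"
    proof -
      have "2 powr - (\<eta> * real j * p) = x ^ j" for j
        by (simp add: x_def powr_realpow[symmetric] powr_powr mult_ac)
      then show ?thesis
        unfolding reindexed[symmetric] by (simp add: ennpowr_ennreal powr_powr)
    qed
    also have "\<dots> = (\<Sum>j. ennreal (x ^ j))" by (rule nn_integral_count_space_nat)
    also have "\<dots> = ennreal (1 / (1 - x))"
      using x geometric_sums[of x] by (intro suminf_ennreal_eq) auto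
    finally show ?thesis
      using finite x by (simp add: lnorm_finite ennpowr_ennreal)
  qed
  moreover have "(1 / (1 - x)) powr (1 / p) > 0" using x by simp
  ultimately show ?thesis by (intro that) auto
qed

section \<open>Hardy's inequality\<close>

text \<open>With \<open>y k = v k * x k\<close> and \<open>\<eta>\<close> the rate of decay, \<open>v n * x k\<close> is at most a constant times
  \<open>2 powr (- \<eta> (n - k)) * y k\<close> for \<open>k \<le> n\<close>. Half of the geometric factor makes the \<open>l\<^sub>q\<close> norm over
  \<open>k \<le> n\<close> bounded by the supremum of the rest, hence by its \<open>l\<^sub>r\<close> norm; the other half pays
  for exchanging that \<open>l\<^sub>r\<close> norm with the outer one. This works for all exponents, in any order.\<close>

lemma hardy:
  assumes "r > 0" "q > 0" "decays v"
  shows "(\<lambda>x. lnorm r UNIV (\<lambda>n. v n * lnorm q {..n} x)) \<preceq> (\<lambda>x. lnorm r UNIV (\<lambda>n. v n * x n))"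
proof -
  from assms(3) obtain C \<eta> where C: "C > 0" "\<eta> > 0"
    "\<And>k n. k \<le> n \<Longrightarrow> v n \<le> ennreal (C * 2 powr (- \<eta> * (real_of_int n - real_of_int k))) * v k"
    unfolding decays_def by blast
  define g where "g j = ennreal (2 powr (- (\<eta> / 2) * real_of_int j))" for j
  obtain Q where Q: "Q > 0" "\<And>n. lnorm q {..n} (\<lambda>k. g (n - k)) \<le> ennreal Q"
    by (rule lnorm_geometric[OF assms(2), of "\<eta> / 2"]) (use C(2) in \<open>auto simp: g_def intro: that\<close>)
  obtain R where R: "R > 0" "\<And>n. lnorm r {..n} (\<lambda>k. g (n - k)) \<le> ennreal R"
    by (rule lnorm_geometric[OF assms(1), of "\<eta> / 2"]) (use C(2) in \<open>auto simp: g_def intro: that\<close>)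
  show ?thesis
  proof (rule dominatedI[where C = "C * Q * R"])
    fix x :: "int \<Rightarrow> ennreal"
    define y where "y k = v k * x k" for k
    define S where "S n = lnorm r {0..} (\<lambda>j. g j * y (n - j))" for n
    have S: "lnorm r {..n} (\<lambda>k. g (n - k) * y k) = S n" for n
    proof -
      have "bij_betw (\<lambda>j. n - j) {0..} {..n}"
        by (rule bij_betw_byWitness[of _ "\<lambda>k. n - k"]) auto
      from lnorm_reindex[OF this, of r "\<lambda>k. g (n - k) * y k"] show ?thesis by (simp add: S_def)
    qed
    have "v n * lnorm q {..n} x \<le> ennreal (C * Q) * S n" for n
    proof -
      have "v n * x k \<le> (ennreal C * S n) * g (n - k)" if "k \<in> {..n}" for k
      proof -
        have "v n * x k \<le> ennreal (C * 2 powr (- \<eta> * (real_of_int n - real_of_int k))) * v k * x k"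
          using that by (intro mult_right_mono C(3)) auto
        also have "2 powr (- \<eta> * (real_of_int n - real_of_int k)) =
            2 powr (- (\<eta> / 2) * real_of_int (n - k)) * 2 powr (- (\<eta> / 2) * real_of_int (n - k))"
          unfolding powr_add[symmetric] by (rule arg_cong[where f = "(powr) 2"]) (simp add: field_simps)
        also have "ennreal (C * \<dots>) * v k * x k = (ennreal C * (g (n - k) * y k)) * g (n - k)"
          using C(1) by (simp add: g_def y_def ennreal_mult mult_ac)
        also have "\<dots> \<le> (ennreal C * S n) * g (n - k)"
          unfolding S[symmetric] using that
          by (intro mult_right_mono mult_left_mono lnorm_ge[of r k "{..n}" "\<lambda>k. g (n - k) * y k"] assms(1)) auto
        finally show ?thesis .
      qed
      then have "lnorm q {..n} (\<lambda>k. v n * x k) \<le> lnorm q {..n} (\<lambda>k. (ennreal C * S n) * g (n - k))"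
        by (intro lnorm_mono assms(2))
      also have "\<dots> \<le> (ennreal C * S n) * ennreal Q"
        unfolding lnorm_cmult[OF assms(2)] by (intro mult_left_mono Q) auto
      finally show ?thesis
        using C(1) Q(1) by (simp add: lnorm_cmult[OF assms(2)] ennreal_mult mult_ac)
    qed
    then have "lnorm r UNIV (\<lambda>n. v n * lnorm q {..n} x) \<le> lnorm r UNIV (\<lambda>n. ennreal (C * Q) * S n)"
      by (intro lnorm_mono assms(1))
    also have "\<dots> = ennreal (C * Q) * lnorm r UNIV S" by (rule lnorm_cmult[OF assms(1)])
    also have "lnorm r UNIV S = lnorm r {0..} (\<lambda>j. lnorm r UNIV (\<lambda>n. g j * y (n - j)))"
      unfolding S_def by (rule lnorm_swap[OF assms(1)])
    also have "\<dots> = lnorm r {0..} (\<lambda>j. lnorm r UNIV y * g j)"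
    proof (rule lnorm_cong)
      fix j :: int
      have "bij_betw (\<lambda>n. n - j) UNIV UNIV"
        by (rule bij_betw_byWitness[of _ "\<lambda>k. k + j"]) auto
      from lnorm_reindex[OF this, of r y]
      show "lnorm r UNIV (\<lambda>n. g j * y (n - j)) = lnorm r UNIV y * g j"
        by (simp add: lnorm_cmult[OF assms(1)] mult.commute)
    qed
    also have "\<dots> = lnorm r UNIV y * lnorm r {0..} g" by (rule lnorm_cmult[OF assms(1)])
    also have "lnorm r {0..} g = lnorm r {..0} (\<lambda>k. g (0 - k))"
    proof -
      have "bij_betw (\<lambda>j::int. - j) {..0} {0..}"
        by (rule bij_betw_byWitness[of _ uminus]) auto
      from lnorm_reindex[OF this, of r g] show ?thesis by simp
    qed
    also have "ennreal (C * Q) * (lnorm r UNIV y * lnorm r {..0} (\<lambda>k. g (0 - k))) \<le>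
        ennreal (C * Q) * (lnorm r UNIV y * ennreal R)"
      by (intro mult_left_mono R) auto
    finally show "lnorm r UNIV (\<lambda>n. v n * lnorm q {..n} x) \<le>
        ennreal (C * Q * R) * lnorm r UNIV (\<lambda>n. v n * x n)"
      using C(1) Q(1) R(1) by (simp add: y_def[abs_def] ennreal_mult mult_ac)
  qed
qed

section \<open>Truncated sequences and iterated norms\<close>

text \<open>The discrete norm of the \<open>L\<close> space, as a functional of the dyadic values of the K-functional.
  The \<open>R\<close> space has the same norm with reflected weights, applied to the mirrored sequence.\<close>

definition Lfun ::
    "ennreal \<Rightarrow> (int \<Rightarrow> ennreal) \<Rightarrow> ennreal \<Rightarrow> (int \<Rightarrow> ennreal) \<Rightarrow> (int \<Rightarrow> ennreal) \<Rightarrow> ennreal" where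
  "Lfun r b q a x = lnorm r UNIV (\<lambda>k. b k * lnorm q {..k} (\<lambda>j. a j * x j))"

text \<open>Constant continuation beyond \<open>n\<close>: up to constants, what the K-functional of \<open>f\<close> becomes when
  \<open>f\<close> is replaced by the \<open>A\<^sub>0\<close> part of a decomposition that is optimal at \<open>2\<^sup>n\<close>.\<close>

definition trunc :: "int \<Rightarrow> (int \<Rightarrow> ennreal) \<Rightarrow> int \<Rightarrow> ennreal" where
  "trunc n x k = x (min k n)"

text \<open>Interchanging the two spaces of a couple turns \<open>K(t, f)\<close> into \<open>t K(1/t, f)\<close>; on dyadic values
  this is \<open>mirror\<close>. It carries everything proved for the \<open>L\<close> space over to the \<open>R\<close> space.\<close>

definition mirror :: "(int \<Rightarrow> ennreal) \<Rightarrow> int \<Rightarrow> ennreal" where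
  "mirror x k = ennreal (2 powr real_of_int k) * x (- k)"

lemma Lfun_mono: "r > 0 \<Longrightarrow> q > 0 \<Longrightarrow> (\<And>k. x k \<le> y k) \<Longrightarrow> Lfun r b q a x \<le> Lfun r b q a y"
  unfolding Lfun_def by (intro lnorm_mono mult_left_mono) auto

lemma Lfun_cmult: "r > 0 \<Longrightarrow> q > 0 \<Longrightarrow> Lfun r b q a (\<lambda>k. c * x k) = c * Lfun r b q a x"
  unfolding Lfun_def by (simp add: lnorm_cmult mult.left_commute[of _ c])

lemma Lfun_add:
  assumes "r > 0" "q > 0"
  shows "(\<lambda>(x, y). Lfun r b q a (\<lambda>k. x k + y k)) \<preceq> (\<lambda>(x, y). Lfun r b q a x + Lfun r b q a y)"
proof -
  obtain C where C: "C \<ge> 1" "\<And>S x y. lnorm r S (\<lambda>k. x k + y k) \<le> ennreal C * (lnorm r S x + lnorm r S y)"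
    by (rule dominatedE3[OF lnorm_add[OF assms(1)]]) (rule that)
  obtain D where D: "D \<ge> 1" "\<And>S x y. lnorm q S (\<lambda>k. x k + y k) \<le> ennreal D * (lnorm q S x + lnorm q S y)"
    by (rule dominatedE3[OF lnorm_add[OF assms(2)]]) (rule that)
  show ?thesis
  proof (rule dominatedI[where C = "D * C"], clarify)
    fix x y :: "int \<Rightarrow> ennreal"
    let ?P = "\<lambda>x k. b k * lnorm q {..k} (\<lambda>j. a j * x j)"
    have "Lfun r b q a (\<lambda>k. x k + y k) \<le> lnorm r UNIV (\<lambda>k. ennreal D * (?P x k + ?P y k))"
      unfolding Lfun_def
    proof (rule lnorm_mono[OF assms(1)])
      fix k
      show "b k * lnorm q {..k} (\<lambda>j. a j * (x j + y j)) \<le> ennreal D * (?P x k + ?P y k)"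
        using mult_left_mono[OF D(2), of "b k"] by (simp add: distrib_left mult.left_commute)
    qed
    also have "\<dots> \<le> ennreal D * (ennreal C * (Lfun r b q a x + Lfun r b q a y))"
      unfolding lnorm_cmult[OF assms(1)] Lfun_def by (intro mult_left_mono C) auto
    finally show "Lfun r b q a (\<lambda>k. x k + y k) \<le> ennreal (D * C) * (Lfun r b q a x + Lfun r b q a y)"
      using C(1) D(1) by (simp add: ennreal_mult mult.assoc)
  qed
qed

lemma chi_seq_ge:
  assumes "r > 0" "q > 0"
  shows "lnorm r {n..} b * a n \<le> chi_seq r b q a n" "b n * a n \<le> chi_seq r b q a n"
proof -
  have "lnorm r {n..} b * a n = lnorm r {n..} (\<lambda>k. a n * b k)"
    by (simp add: lnorm_cmult[OF assms(1)] mult.commute)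
  also have "\<dots> \<le> chi_seq r b q a n"
    unfolding chi_seq_def
  proof (rule lnorm_mono[OF assms(1)])
    fix k assume "k \<in> {n..}"
    then have "a n \<le> lnorm q {n..k} a" by (intro lnorm_ge assms(2)) auto
    then show "a n * b k \<le> b k * lnorm q {n..k} a"
      by (subst mult.commute) (rule mult_left_mono, auto)
  qed
  finally show *: "lnorm r {n..} b * a n \<le> chi_seq r b q a n" .
  have "b n * a n \<le> lnorm r {n..} b * a n"
    by (intro mult_right_mono lnorm_ge assms(1)) auto
  then show "b n * a n \<le> chi_seq r b q a n" using * by (rule order_trans)
qed

text \<open>Restrict both norms to indices from \<open>n\<close> on. For nondecreasing \<open>x\<close> this bounds \<open>x n\<close> by a
  multiple of the norm of \<open>x\<close>.\<close>

lemma chi_seq_le_Lfun: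
  assumes "r > 0" "q > 0" "\<And>k. n \<le> k \<Longrightarrow> z \<le> x k"
  shows "chi_seq r b q a n * z \<le> Lfun r b q a x"
proof -
  have "chi_seq r b q a n * z = lnorm r {n..} (\<lambda>k. b k * lnorm q {n..k} (\<lambda>j. z * a j))"
    unfolding chi_seq_def by (simp add: lnorm_cmult assms(1,2) mult.left_commute mult.commute[of _ z])
  also have "\<dots> \<le> lnorm r {n..} (\<lambda>k. b k * lnorm q {..k} (\<lambda>j. a j * x j))"
  proof (intro lnorm_mono assms(1) mult_left_mono)
    fix k
    have "lnorm q {n..k} (\<lambda>j. z * a j) \<le> lnorm q {n..k} (\<lambda>j. a j * x j)"
      using assms(3) by (intro lnorm_mono assms(2)) (auto simp: mult.commute[of z] mult_left_mono)
    also have "\<dots> \<le> lnorm q {..k} (\<lambda>j. a j * x j)" by (intro lnorm_subset assms(2)) auto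
    finally show "lnorm q {n..k} (\<lambda>j. z * a j) \<le> lnorm q {..k} (\<lambda>j. a j * x j)" .
  qed simp
  also have "\<dots> \<le> Lfun r b q a x" unfolding Lfun_def by (intro lnorm_subset assms(1)) auto
  finally show ?thesis .
qed

text \<open>The outer norm is split at \<open>n\<close>. Beyond \<open>n\<close> the inner norm is that of \<open>x\<close> up to \<open>n\<close> plus
  \<open>x n\<close> times the norm of the weight between \<open>n\<close> and \<open>k\<close>. The three terms give rise to the
  \<open>L,L\<close> space, the \<open>L\<close> space with weight \<open>B\<^sub>0\<close>, and the space with weight \<open>a\<^sup>#\<close>.\<close>

lemma Lfun_trunc:
  assumes r: "r > 0" and q: "q > 0"
  shows "(\<lambda>(x, n). Lfun r b q a (trunc n x)) \<asymp>
    (\<lambda>(x, n). (lnorm r {..n} (\<lambda>k. b k * lnorm q {..k} (\<lambda>j. a j * x j)) +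
      lnorm r {n..} b * lnorm q {..n} (\<lambda>j. a j * x j)) + chi_seq r b q a n * x n)"
proof (rule equivalentI)
  let ?P = "\<lambda>x k. lnorm q {..k} (\<lambda>j. a j * x j)"
  obtain C where C: "C \<ge> 1" "\<And>S T x. lnorm r (S \<union> T) x \<le> ennreal C * (lnorm r S x + lnorm r T x)"
    by (rule dominatedE3[OF lnorm_Un[OF r]]) (rule that)
  obtain D where D: "D \<ge> 1" "\<And>S T x. lnorm q (S \<union> T) x \<le> ennreal D * (lnorm q S x + lnorm q T x)"
    by (rule dominatedE3[OF lnorm_Un[OF q]]) (rule that)
  obtain E where E: "E \<ge> 1" "\<And>S x y. lnorm r S (\<lambda>k. x k + y k) \<le> ennreal E * (lnorm r S x + lnorm r S y)"
    by (rule dominatedE3[OF lnorm_add[OF r]]) (rule that)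
  show "(\<lambda>(x, n). Lfun r b q a (trunc n x)) \<preceq>
      (\<lambda>(x, n). (lnorm r {..n} (\<lambda>k. b k * ?P x k) + lnorm r {n..} b * ?P x n) + chi_seq r b q a n * x n)"
  proof (rule dominatedI[where C = "C * (1 + D * E)"], clarify)
    fix x :: "int \<Rightarrow> ennreal" and n :: int
    let ?J1 = "lnorm r {..n} (\<lambda>k. b k * ?P x k)"
    let ?J2 = "lnorm r {n..} b * ?P x n"
    let ?J3 = "chi_seq r b q a n * x n"
    have P_low: "?P (trunc n x) k = ?P x k" if "k \<le> n" for k
      using that by (intro lnorm_cong) (auto simp: trunc_def min_def)
    have P_high: "?P (trunc n x) k \<le> ennreal D * (?P x n + x n * lnorm q {n..k} a)" if "n \<le> k" for k
    proof -
      have "{..k} = {..n} \<union> {n..k}" using that by auto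
      then have "?P (trunc n x) k \<le> ennreal D *
          (?P (trunc n x) n + lnorm q {n..k} (\<lambda>j. a j * trunc n x j))"
        using D(2)[of "{..n}" "{n..k}" "\<lambda>j. a j * trunc n x j"] by simp
      also have "lnorm q {n..k} (\<lambda>j. a j * trunc n x j) = lnorm q {n..k} (\<lambda>j. x n * a j)"
        by (intro lnorm_cong) (auto simp: trunc_def mult.commute)
      finally show ?thesis by (simp add: P_low lnorm_cmult[OF q])
    qed
    have "lnorm r {n..} (\<lambda>k. b k * ?P (trunc n x) k) \<le>
        lnorm r {n..} (\<lambda>k. ennreal D * (?P x n * b k + x n * (b k * lnorm q {n..k} a)))"
    proof (rule lnorm_mono[OF r])
      fix k assume "k \<in> {n..}"
      then show "b k * ?P (trunc n x) k \<le> ennreal D * (?P x n * b k + x n * (b k * lnorm q {n..k} a))"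
        using mult_left_mono[OF P_high, of k "b k"] by (simp add: distrib_left mult_ac)
    qed
    also have "\<dots> \<le> ennreal D * (ennreal E * (lnorm r {n..} (\<lambda>k. ?P x n * b k) +
        lnorm r {n..} (\<lambda>k. x n * (b k * lnorm q {n..k} a))))"
      unfolding lnorm_cmult[OF r, of _ "ennreal D"] by (intro mult_left_mono E) auto
    also have "\<dots> = ennreal (D * E) * (?J2 + ?J3)"
      unfolding lnorm_cmult[OF r] chi_seq_def
      using D(1) E(1) by (simp add: ennreal_mult mult_ac)
    finally have high: "lnorm r {n..} (\<lambda>k. b k * ?P (trunc n x) k) \<le> ennreal (D * E) * (?J2 + ?J3)" .
    have low: "lnorm r {..n} (\<lambda>k. b k * ?P (trunc n x) k) = ?J1"
      by (intro lnorm_cong) (simp add: P_low)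
    have "UNIV = {..n} \<union> {n..}" by auto
    then have "Lfun r b q a (trunc n x) \<le> ennreal C * (?J1 + lnorm r {n..} (\<lambda>k. b k * ?P (trunc n x) k))"
      using C(2)[of "{..n}" "{n..}" "\<lambda>k. b k * ?P (trunc n x) k"] by (simp add: Lfun_def low)
    also have "\<dots> \<le> ennreal C * (?J1 + ennreal (D * E) * (?J2 + ?J3))"
      by (intro mult_left_mono add_left_mono high) auto
    also have "\<dots> \<le> ennreal C * (ennreal (1 + D * E) * ?J1 + ennreal (1 + D * E) * (?J2 + ?J3))"
    proof (intro mult_left_mono add_mono)
      have "1 * ?J1 \<le> ennreal (1 + D * E) * ?J1"
        using D(1) E(1) by (intro mult_right_mono) (auto simp flip: ennreal_1 intro!: ennreal_leI)
      then show "?J1 \<le> ennreal (1 + D * E) * ?J1" by simp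
    qed (auto intro!: mult_right_mono ennreal_leI)
    also have "\<dots> = ennreal (C * (1 + D * E)) * (?J1 + ?J2 + ?J3)"
    proof -
      have "ennreal (C * (1 + D * E)) = ennreal C * ennreal (1 + D * E)"
        using C(1) D(1) E(1) by (intro ennreal_mult) auto
      then show ?thesis by (simp add: distrib_left mult.assoc add.assoc)
    qed
    finally show "Lfun r b q a (trunc n x) \<le> ennreal (C * (1 + D * E)) * (?J1 + ?J2 + ?J3)" .
  qed
  show "(\<lambda>(x, n). (lnorm r {..n} (\<lambda>k. b k * ?P x k) + lnorm r {n..} b * ?P x n) + chi_seq r b q a n * x n) \<preceq>
      (\<lambda>(x, n). Lfun r b q a (trunc n x))"
  proof (rule dominatedI[where C = 3], clarify)
    fix x :: "int \<Rightarrow> ennreal" and n :: int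
    let ?L = "Lfun r b q a (trunc n x)"
    have P_low: "?P (trunc n x) k = ?P x k" if "k \<le> n" for k
      using that by (intro lnorm_cong) (auto simp: trunc_def min_def)
    have "lnorm r {..n} (\<lambda>k. b k * ?P x k) = lnorm r {..n} (\<lambda>k. b k * ?P (trunc n x) k)"
      by (intro lnorm_cong) (simp add: P_low)
    also have "\<dots> \<le> ?L" unfolding Lfun_def by (intro lnorm_subset r) auto
    finally have J1: "lnorm r {..n} (\<lambda>k. b k * ?P x k) \<le> ?L" .
    have "lnorm r {n..} b * ?P x n = lnorm r {n..} (\<lambda>k. ?P (trunc n x) n * b k)"
      unfolding lnorm_cmult[OF r] by (simp add: P_low mult.commute)
    also have "\<dots> \<le> lnorm r {n..} (\<lambda>k. b k * ?P (trunc n x) k)"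
      by (intro lnorm_mono r) (auto simp: mult.commute intro!: mult_left_mono lnorm_subset q)
    also have "\<dots> \<le> ?L" unfolding Lfun_def by (intro lnorm_subset r) auto
    finally have J2: "lnorm r {n..} b * ?P x n \<le> ?L" .
    have J3: "chi_seq r b q a n * x n \<le> ?L"
      by (intro chi_seq_le_Lfun r q) (auto simp: trunc_def min_def)
    have "(lnorm r {..n} (\<lambda>k. b k * ?P x k) + lnorm r {n..} b * ?P x n) + chi_seq r b q a n * x n \<le> (?L + ?L) + ?L"
      by (intro add_mono J1 J2 J3)
    also have "\<dots> = ennreal 3 * ?L"
    proof -
      have three: "ennreal 3 = 1 + 1 + 1" by simp
      show ?thesis unfolding three by (simp only: distrib_right mult_1)
    qed
    finally show "(lnorm r {..n} (\<lambda>k. b k * ?P x k) + lnorm r {n..} b * ?P x n) + chi_seq r b q a n * x n \<le>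
        ennreal 3 * ?L" .
  qed
qed

lemma lnorm_Lfun_trunc:
  assumes s: "s > 0" and r: "r > 0" and q: "q > 0"
  shows "(\<lambda>x. lnorm s UNIV (\<lambda>n. v n * Lfun r b q a (trunc n x))) \<asymp>
    (\<lambda>x. (lnorm s UNIV (\<lambda>n. v n * lnorm r {..n} (\<lambda>k. b k * lnorm q {..k} (\<lambda>j. a j * x j))) +
      lnorm s UNIV (\<lambda>n. v n * (lnorm r {n..} b * lnorm q {..n} (\<lambda>j. a j * x j)))) +
      lnorm s UNIV (\<lambda>n. v n * (chi_seq r b q a n * x n)))"
proof -
  let ?P = "\<lambda>x k. lnorm q {..k} (\<lambda>j. a j * x j)"
  let ?J1 = "\<lambda>x n. lnorm r {..n} (\<lambda>k. b k * ?P x k)"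
  let ?J2 = "\<lambda>x n. lnorm r {n..} b * ?P x n"
  let ?J3 = "\<lambda>x n. chi_seq r b q a n * x n"
  have "(\<lambda>x. lnorm s UNIV (\<lambda>n. v n * Lfun r b q a (trunc n x))) \<asymp>
      (\<lambda>x. lnorm s UNIV (\<lambda>n. (v n * ?J1 x n + v n * ?J2 x n) + v n * ?J3 x n))"
    using equivalent_mult[OF equivalent_refl Lfun_trunc[OF r q, of b a], of "\<lambda>p. v (snd p)"]
    by (intro equivalent_lnorm s) (simp add: case_prod_unfold distrib_left)
  also have "\<dots> \<asymp> (\<lambda>x. lnorm s UNIV (\<lambda>n. v n * ?J1 x n + v n * ?J2 x n) + lnorm s UNIV (\<lambda>n. v n * ?J3 x n))"
    by (rule lnorm_add_equivalent[OF s])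
  also have "\<dots> \<asymp> (\<lambda>x. (lnorm s UNIV (\<lambda>n. v n * ?J1 x n) + lnorm s UNIV (\<lambda>n. v n * ?J2 x n)) +
      lnorm s UNIV (\<lambda>n. v n * ?J3 x n))"
    by (intro equivalent_add equivalent_refl lnorm_add_equivalent[OF s])
  finally show ?thesis .
qed

text \<open>Under a decaying weight the first two of the three terms are absorbed by the third: Hardy's
  inequality replaces each norm over \<open>k \<le> n\<close> by the value at \<open>n\<close>, and the products of weights
  that remain are at most \<open>chi_seq\<close>.\<close>

lemma hardy_trunc:
  assumes s: "s > 0" and r: "r > 0" and q: "q > 0" and v: "decays v" and b: "slow b"
  shows "(\<lambda>x. lnorm s UNIV (\<lambda>n. v n * Lfun r b q a (trunc n x))) \<preceq>
    (\<lambda>x. lnorm s UNIV (\<lambda>n. v n * (chi_seq r b q a n * x n)))"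
proof -
  let ?P = "\<lambda>x k. lnorm q {..k} (\<lambda>j. a j * x j)"
  let ?J1 = "\<lambda>x n. lnorm r {..n} (\<lambda>k. b k * ?P x k)"
  let ?J2 = "\<lambda>x n. lnorm r {n..} b * ?P x n"
  let ?J3 = "\<lambda>x n. chi_seq r b q a n * x n"
  let ?R = "\<lambda>x. lnorm s UNIV (\<lambda>n. v n * ?J3 x n)"
  have "(\<lambda>x. lnorm s UNIV (\<lambda>n. v n * ?J1 x n)) \<preceq> (\<lambda>x. lnorm s UNIV (\<lambda>n. v n * (b n * ?P x n)))"
    by (rule dominated_comp[OF hardy[OF s r v]])
  also have "(\<lambda>x. lnorm s UNIV (\<lambda>n. v n * (b n * ?P x n))) \<preceq> (\<lambda>x. lnorm s UNIV (\<lambda>n. v n * (b n * (a n * x n))))"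
    using dominated_comp[OF hardy[OF s q decays_mult_slow[OF v b]], of "\<lambda>x j. a j * x j"]
    by (simp add: mult.assoc)
  also have "\<dots> \<preceq> ?R"
    by (intro dominated_leI lnorm_mono s mult_left_mono)
      (auto simp: mult.assoc[symmetric] intro!: mult_right_mono chi_seq_ge r q)
  finally have J1: "(\<lambda>x. lnorm s UNIV (\<lambda>n. v n * ?J1 x n)) \<preceq> ?R" .
  have "(\<lambda>x. lnorm s UNIV (\<lambda>n. v n * ?J2 x n)) \<preceq>
      (\<lambda>x. lnorm s UNIV (\<lambda>n. v n * (lnorm r {n..} b * (a n * x n))))"
    using dominated_comp[OF hardy[OF s q decays_mult_slow[OF v slow_lnorm_atLeast[OF r b]]],
        of "\<lambda>x j. a j * x j"]
    by (simp add: mult.assoc)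
  also have "\<dots> \<preceq> ?R"
    by (intro dominated_leI lnorm_mono s mult_left_mono)
      (auto simp: mult.assoc[symmetric] intro!: mult_right_mono chi_seq_ge r q)
  finally have J2: "(\<lambda>x. lnorm s UNIV (\<lambda>n. v n * ?J2 x n)) \<preceq> ?R" .
  note equivalentD(1)[OF lnorm_Lfun_trunc[OF s r q, of v b a]]
  also have "(\<lambda>x. (lnorm s UNIV (\<lambda>n. v n * ?J1 x n) + lnorm s UNIV (\<lambda>n. v n * ?J2 x n)) + ?R x) \<preceq> ?R"
    by (intro dominated_add J1 J2 dominated_refl)
  finally show ?thesis .
qed

section \<open>The K-functional\<close>

lemma quasi_norm_zero: "quasi_norm X \<Longrightarrow> X 0 = 0"
  unfolding quasi_norm_def by blast

lemma quasi_norm_uminus: "quasi_norm X \<Longrightarrow> X (- f) = X f"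
  unfolding quasi_norm_def by (metis abs_1 abs_minus_cancel ennreal_1 mult_1 scaleR_minus1_left)

lemma Kfun_le:
  assumes "t > 0"
  shows "Kfun X0 X1 t (f0 + f1) \<le> X0 f0 + ennreal t * X1 f1"
proof (cases "f0 \<in> carrier_of X0 \<and> f1 \<in> carrier_of X1")
  case True
  then show ?thesis unfolding Kfun_def by (intro Inf_lower) auto
next
  case False
  then have "X0 f0 + ennreal t * X1 f1 = top"
    using assms by (auto simp: carrier_of_def ennreal_mult_top less_top[symmetric])
  then show ?thesis by (simp only: top_greatest)
qed

lemma Kfun_eq_top: "f \<notin> sum_set X0 X1 \<Longrightarrow> Kfun X0 X1 t f = top"
proof -
  assume "f \<notin> sum_set X0 X1"
  then have "{X0 f0 + ennreal t * X1 f1 | f0 f1.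
      f0 \<in> carrier_of X0 \<and> f1 \<in> carrier_of X1 \<and> f = f0 + f1} = {}"
    unfolding sum_set_def by auto
  then show ?thesis unfolding Kfun_def by (simp only: Inf_empty)
qed

lemma le_cmult_Kfun:
  assumes "C > 0" "\<And>f0 f1. f = f0 + f1 \<Longrightarrow> y \<le> ennreal C * (X0 f0 + ennreal t * X1 f1)"
  shows "y \<le> ennreal C * Kfun X0 X1 t f"
proof -
  have cancel: "ennreal (1 / C) * (ennreal C * z) = z" "ennreal C * (ennreal (1 / C) * z) = z" for z
    using assms(1) by (simp_all flip: mult.assoc ennreal_mult)
  have "ennreal (1 / C) * y \<le> Kfun X0 X1 t f"
    unfolding Kfun_def
  proof (rule Inf_greatest, clarify)
    fix f0 f1
    show "ennreal (1 / C) * y \<le> X0 f0 + ennreal t * X1 f1" if "f = f0 + f1"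
      using mult_left_mono[OF assms(2)[OF that] zero_le[of "ennreal (1 / C)"]] by (simp only: cancel)
  qed
  then have "ennreal C * (ennreal (1 / C) * y) \<le> ennreal C * Kfun X0 X1 t f"
    by (rule mult_left_mono) simp
  then show ?thesis by (simp only: cancel)
qed

lemma Kfun_mono:
  assumes "0 < s" "s \<le> t"
  shows "Kfun X0 X1 s f \<le> Kfun X0 X1 t f"
proof -
  have "Kfun X0 X1 s f \<le> ennreal 1 * Kfun X0 X1 t f"
  proof (rule le_cmult_Kfun)
    fix f0 f1 assume "f = f0 + f1"
    then have "Kfun X0 X1 s f \<le> X0 f0 + ennreal s * X1 f1" using Kfun_le[OF assms(1)] by simp
    also have "\<dots> \<le> X0 f0 + ennreal t * X1 f1"
      using assms by (intro add_left_mono mult_right_mono ennreal_leI) auto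
    finally show "Kfun X0 X1 s f \<le> ennreal 1 * (X0 f0 + ennreal t * X1 f1)" by simp
  qed simp
  then show ?thesis by simp
qed

lemma Kfun_scale:
  assumes "0 < s" "s \<le> t"
  shows "Kfun X0 X1 t f \<le> ennreal (t / s) * Kfun X0 X1 s f"
proof (rule le_cmult_Kfun)
  fix f0 f1 assume "f = f0 + f1"
  then have "Kfun X0 X1 t f \<le> 1 * X0 f0 + ennreal (t / s * s) * X1 f1"
    using Kfun_le[of t X0 X1 f0 f1] assms by simp
  also have "\<dots> \<le> ennreal (t / s) * X0 f0 + ennreal (t / s * s) * X1 f1"
    using assms by (intro add_right_mono mult_right_mono) (auto simp flip: ennreal_1 intro!: ennreal_leI)
  also have "ennreal (t / s * s) = ennreal (t / s) * ennreal s"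
    using assms by (intro ennreal_mult) auto
  finally show "Kfun X0 X1 t f \<le> ennreal (t / s) * (X0 f0 + ennreal s * X1 f1)"
    by (simp add: distrib_left mult.assoc)
qed (use assms in simp)

definition Kseq :: "'a::real_vector qspace \<Rightarrow> 'a qspace \<Rightarrow> 'a \<Rightarrow> int \<Rightarrow> ennreal" where
  "Kseq X0 X1 f k = Kfun X0 X1 (2 powr real_of_int k) f"

lemma Kseq_mono: "j \<le> k \<Longrightarrow> Kseq X0 X1 f j \<le> Kseq X0 X1 f k"
  unfolding Kseq_def by (intro Kfun_mono) auto

lemma mirror_Kseq_mono:
  assumes "j \<le> k"
  shows "mirror (Kseq X0 X1 f) j \<le> mirror (Kseq X0 X1 f) k"
proof -
  have "Kseq X0 X1 f (- j) \<le> ennreal (2 powr - real_of_int j / 2 powr - real_of_int k) * Kseq X0 X1 f (- k)"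
    using Kfun_scale[of "2 powr real_of_int (- k)" "2 powr real_of_int (- j)" X0 X1 f] assms
    by (simp add: Kseq_def)
  then have "mirror (Kseq X0 X1 f) j \<le> ennreal (2 powr real_of_int j) *
      (ennreal (2 powr - real_of_int j / 2 powr - real_of_int k) * Kseq X0 X1 f (- k))"
    unfolding mirror_def by (intro mult_left_mono) auto
  also have "\<dots> = mirror (Kseq X0 X1 f) k"
    unfolding mirror_def mult.assoc[symmetric]
    by (simp add: powr_minus divide_simps flip: ennreal_mult)
  finally show ?thesis .
qed

lemma samples_Kfun: "samples (\<lambda>f u. Kfun X0 X1 u f) (Kseq X0 X1)"
proof -
  have double: "Kfun X0 X1 t f \<le> ennreal 2 * Kfun X0 X1 s f" if "0 < s" "s \<le> t" "t \<le> 2 * s" for s t f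
  proof -
    have "t / s \<le> 2" using that by (simp add: divide_simps)
    then show ?thesis
      using Kfun_scale[OF that(1,2), of X0 X1 f] by (elim order_trans) (intro mult_right_mono ennreal_leI, auto)
  qed
  have weaken: "z \<le> ennreal 2 * w" if "z \<le> w" for z w :: ennreal
  proof -
    have "w \<le> ennreal 2 * w" using mult_right_mono[of 1 2 w] by simp
    with that show ?thesis by (rule order_trans)
  qed
  show ?thesis
  proof (rule samplesI[of 2 2])
    fix f and u :: real assume u: "u > 0"
    show "Kfun X0 X1 u f \<le> ennreal 2 * Kseq X0 X1 f (level u)"
      unfolding Kseq_def using dyadic_bounds[OF u] by (intro double) (auto simp: powr_add)
    show "Kseq X0 X1 f (level u) \<le> ennreal 2 * Kfun X0 X1 u f"
      unfolding Kseq_def using dyadic_bounds[OF u] by (intro weaken Kfun_mono) auto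
  next
    fix f k
    show "Kseq X0 X1 f k \<le> ennreal 2 * Kseq X0 X1 f (k + 1)" by (intro weaken Kseq_mono) auto
    show "Kseq X0 X1 f (k + 1) \<le> ennreal 2 * Kseq X0 X1 f k"
      unfolding Kseq_def by (intro double) (auto simp: powr_add)
  qed auto
qed

locale quasi_Banach_couple =
  fixes A0 A1 :: "'a::hausdorff_tvs qspace"
  assumes couple: "compatible_quasi_Banach_couple A0 A1"
begin

lemma quasi_norms: "quasi_norm A0" "quasi_norm A1"
  using couple unfolding compatible_quasi_Banach_couple_def quasi_Banach_def by auto

text \<open>If both parts of a decomposition of \<open>f\<close> had arbitrarily small norms, they would converge to
  \<open>0\<close> in the ambient Hausdorff space, and so would their sum \<open>f\<close>.\<close>

lemma Kfun_pos:
  assumes t: "t > 0" and f: "f \<noteq> 0"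
  shows "Kfun A0 A1 t f > 0"
proof -
  have emb: "embeds_in_ambient A0" "embeds_in_ambient A1"
    using couple unfolding compatible_quasi_Banach_couple_def by auto
  have "\<forall>\<^sub>F g in nhds (0::'a). g \<noteq> f"
    using f by (auto simp: eventually_nhds intro!: exI[of _ "- {f}"])
  moreover have "((\<lambda>x::'a \<times> 'a. fst x + snd x) \<longlongrightarrow> 0 + 0) (nhds 0 \<times>\<^sub>F nhds 0)"
    by (rule tendsto_add_Pair)
  ultimately have "\<forall>\<^sub>F x in nhds (0::'a) \<times>\<^sub>F nhds 0. fst x + snd x \<noteq> f"
    using eventually_compose_filterlim[of "\<lambda>g. g \<noteq> f" "nhds 0"] by simp
  then obtain P Q where P: "\<forall>\<^sub>F x in nhds (0::'a). P x" and Q: "\<forall>\<^sub>F x in nhds (0::'a). Q x"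
    and PQ: "\<And>x y. P x \<Longrightarrow> Q y \<Longrightarrow> x + y \<noteq> f"
    unfolding eventually_prod_filter by auto
  obtain d0 where d0: "d0 > 0" "\<And>f. A0 f < d0 \<Longrightarrow> P f"
    using P emb(1) unfolding eventually_nhds embeds_in_ambient_def by metis
  obtain d1 where d1: "d1 > 0" "\<And>f. A1 f < d1 \<Longrightarrow> Q f"
    using Q emb(2) unfolding eventually_nhds embeds_in_ambient_def by metis
  have "min d0 (ennreal t * d1) \<le> ennreal 1 * Kfun A0 A1 t f"
  proof (rule le_cmult_Kfun)
    fix f0 f1 assume "f = f0 + f1"
    then have "\<not> P f0 \<or> \<not> Q f1" using PQ by blast
    then have "d0 \<le> A0 f0 \<or> d1 \<le> A1 f1" using d0(2) d1(2) by (meson not_le)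
    then show "min d0 (ennreal t * d1) \<le> ennreal 1 * (A0 f0 + ennreal t * A1 f1)"
    proof
      assume "d0 \<le> A0 f0"
      then show ?thesis by (intro min.coboundedI1) (simp add: add_increasing2)
    next
      assume "d1 \<le> A1 f1"
      then have "ennreal t * d1 \<le> ennreal t * A1 f1" by (rule mult_left_mono) simp
      then show ?thesis by (intro min.coboundedI2) (simp add: add_increasing)
    qed
  qed simp
  moreover have "min d0 (ennreal t * d1) > 0"
    using t d0(1) d1(1) by (simp add: ennreal_zero_less_mult_iff)
  ultimately have "0 < ennreal 1 * Kfun A0 A1 t f" by (rule less_le_trans[rotated])
  then show ?thesis by simp
qed

text \<open>Since \<open>K(t, f)\<close> vanishes only for \<open>f = 0\<close>, the infimum is attained up to the factor \<open>2\<close>.\<close>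

lemma near_optimal_decomposition:
  assumes t: "t > 0" and fin: "Kfun A0 A1 t f < top"
  obtains f0 f1 where "f = f0 + f1" "A0 f0 + ennreal t * A1 f1 \<le> 2 * Kfun A0 A1 t f"
proof (cases "f = 0")
  case True
  then show ?thesis
    using that[of 0 0] quasi_norms by (simp add: quasi_norm_zero)
next
  case False
  let ?K = "Kfun A0 A1 t f"
  have "?K < 2 * ?K"
    using Kfun_pos[OF t False] fin
    by (cases ?K) (auto simp: ennreal_zero_less_top simp flip: ennreal_numeral ennreal_mult intro!: ennreal_lessI)
  then obtain f0 f1 where "f = f0 + f1" "A0 f0 + ennreal t * A1 f1 < 2 * ?K"
    unfolding Kfun_def[of A0 A1 t f] Inf_less_iff by blast
  then show ?thesis by (intro that[of f0 f1] less_imp_le)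
qed

lemma Kfun_add:
  obtains C where "C \<ge> 1"
    "\<And>t f g. t > 0 \<Longrightarrow> Kfun A0 A1 t (f + g) \<le> ennreal C * (Kfun A0 A1 t f + Kfun A0 A1 t g)"
proof -
  obtain C0 where C0: "C0 \<ge> 1" "\<And>f g. A0 (f + g) \<le> ennreal C0 * (A0 f + A0 g)"
    using quasi_norms(1) unfolding quasi_norm_def by blast
  obtain C1 where C1: "C1 \<ge> 1" "\<And>f g. A1 (f + g) \<le> ennreal C1 * (A1 f + A1 g)"
    using quasi_norms(2) unfolding quasi_norm_def by blast
  define C where "C = max C0 C1"
  have C: "A0 (f + g) \<le> ennreal C * (A0 f + A0 g)" "A1 (f + g) \<le> ennreal C * (A1 f + A1 g)" for f g
    unfolding C_def
    by (rule order_trans[OF C0(2)], intro mult_right_mono ennreal_leI, auto)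
      (rule order_trans[OF C1(2)], intro mult_right_mono ennreal_leI, auto)
  have "Kfun A0 A1 t (f + g) \<le> ennreal (C * 2) * (Kfun A0 A1 t f + Kfun A0 A1 t g)" if t: "t > 0" for t f g
  proof (cases "Kfun A0 A1 t f = top \<or> Kfun A0 A1 t g = top")
    case True
    then have "ennreal (C * 2) * (Kfun A0 A1 t f + Kfun A0 A1 t g) = top"
      using C0(1) by (auto simp: ennreal_mult_top C_def max_def)
    then show ?thesis by simp
  next
    case False
    obtain f0 f1 where f: "f = f0 + f1" "A0 f0 + ennreal t * A1 f1 \<le> 2 * Kfun A0 A1 t f"
      by (rule near_optimal_decomposition[OF t, of f]) (use False in \<open>auto simp: less_top\<close>)
    obtain g0 g1 where g: "g = g0 + g1" "A0 g0 + ennreal t * A1 g1 \<le> 2 * Kfun A0 A1 t g"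
      by (rule near_optimal_decomposition[OF t, of g]) (use False in \<open>auto simp: less_top\<close>)
    have "f + g = (f0 + g0) + (f1 + g1)" using f(1) g(1) by simp
    then have "Kfun A0 A1 t (f + g) \<le> A0 (f0 + g0) + ennreal t * A1 (f1 + g1)"
      using Kfun_le[OF t] by metis
    also have "\<dots> \<le> ennreal C * (A0 f0 + A0 g0) + ennreal t * (ennreal C * (A1 f1 + A1 g1))"
      by (intro add_mono mult_left_mono C) auto
    also have "\<dots> = ennreal C * ((A0 f0 + ennreal t * A1 f1) + (A0 g0 + ennreal t * A1 g1))"
      by (simp add: distrib_left mult_ac add_ac)
    also have "\<dots> \<le> ennreal C * (2 * Kfun A0 A1 t f + 2 * Kfun A0 A1 t g)"
      by (intro mult_left_mono add_mono f g) auto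
    also have "\<dots> = ennreal (C * 2) * (Kfun A0 A1 t f + Kfun A0 A1 t g)"
      using C0(1) by (simp add: C_def ennreal_mult' ennreal_mult'' distrib_left mult.assoc)
    finally show ?thesis .
  qed
  moreover have "C * 2 \<ge> 1" using C0(1) by (auto simp: C_def max_def)
  ultimately show ?thesis using that by blast
qed

abbreviation K :: "'a \<Rightarrow> int \<Rightarrow> ennreal" where "K \<equiv> Kseq A0 A1"

lemma Kseq_add:
  obtains C where "C \<ge> 1" "\<And>f g k. K (f + g) k \<le> ennreal C * (K f k + K g k)"
  by (rule Kfun_add) (auto simp: Kseq_def intro: that)

text \<open>For indices on one side of \<open>n\<close> the bound is the norm of the respective part itself; on the
  other side \<open>f0 = f - f1\<close> and the bound for \<open>f1\<close> applies.\<close>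

lemma dyadic_decomposition:
  obtains C where "C > 0"
    "\<And>f n. K f n < top \<Longrightarrow> \<exists>f0 f1. f = f0 + f1 \<and>
      (\<forall>k. K f0 k \<le> ennreal C * trunc n (K f) k) \<and>
      (\<forall>k. mirror (K f1) k \<le> ennreal C * trunc (- n) (mirror (K f)) k)"
proof -
  obtain C where C: "C \<ge> 1" "\<And>f g k. K (f + g) k \<le> ennreal C * (K f k + K g k)"
    by (rule Kseq_add) (rule that)
  have C2: "2 * z \<le> ennreal (C * 3) * z" for z
  proof -
    have "ennreal 2 * z \<le> ennreal (C * 3) * z" using C(1) by (intro mult_right_mono ennreal_leI) auto
    then show ?thesis by simp
  qed
  have C3: "y \<le> ennreal (C * 3) * x" if "y \<le> ennreal C * (x + w)" "w \<le> 2 * x" for x y w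
  proof -
    have "y \<le> ennreal C * (1 * x + 2 * x)"
      using that(2) by (intro order_trans[OF that(1)] mult_left_mono add_mono) auto
    also have "1 * x + 2 * x = ennreal 3 * x" by (subst distrib_right[symmetric]) simp
    finally show ?thesis using C(1) by (simp add: ennreal_mult mult.assoc)
  qed
  have K_le: "K f0 k \<le> A0 f0" "K f1 k \<le> ennreal (2 powr real_of_int k) * A1 f1" for f0 f1 k
    using Kfun_le[of "2 powr real_of_int k" A0 A1 f0 0] Kfun_le[of "2 powr real_of_int k" A0 A1 0 f1] quasi_norms
    by (simp_all add: Kseq_def quasi_norm_zero)
  have "\<exists>f0 f1. f = f0 + f1 \<and> (\<forall>k. K f0 k \<le> ennreal (C * 3) * trunc n (K f) k) \<and>
      (\<forall>k. mirror (K f1) k \<le> ennreal (C * 3) * trunc (- n) (mirror (K f)) k)"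
    if fin: "K f n < top" for f n
  proof -
    obtain f0 f1 where f: "f = f0 + f1" "A0 f0 + ennreal (2 powr real_of_int n) * A1 f1 \<le> 2 * K f n"
      unfolding Kseq_def
      by (rule near_optimal_decomposition[of "2 powr real_of_int n" f]) (use fin in \<open>auto simp: Kseq_def\<close>)
    have A0: "A0 f0 \<le> 2 * K f n"
      by (rule order_trans[OF _ f(2)]) simp
    have "ennreal (2 powr real_of_int n) * A1 f1 \<le> 2 * K f n"
      by (rule order_trans[OF _ f(2)]) simp
    then have "ennreal (2 powr - real_of_int n) * (ennreal (2 powr real_of_int n) * A1 f1) \<le>
        ennreal (2 powr - real_of_int n) * (2 * K f n)" by (rule mult_left_mono) simp
    then have A1: "A1 f1 \<le> 2 * mirror (K f) (- n)"
      by (simp add: mirror_def mult.assoc[symmetric] powr_minus flip: ennreal_mult)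
        (simp add: mult_ac)
    have cancel: "ennreal (2 powr real_of_int k) * mirror x (- k) = x k"
      "ennreal (2 powr real_of_int k) * x (- k) = mirror x k" for k and x :: "int \<Rightarrow> ennreal"
      by (simp_all add: mirror_def powr_minus mult.assoc[symmetric] flip: ennreal_mult)
    have "K f0 k \<le> ennreal (C * 3) * trunc n (K f) k" for k
    proof (cases "n \<le> k")
      case True
      then show ?thesis
        using order_trans[OF order_trans[OF K_le(1) A0] C2] by (simp add: trunc_def)
    next
      case False
      have "K (f + - f1) k \<le> ennreal C * (K f k + K (- f1) k)" by (rule C)
      moreover have "K (- f1) k \<le> 2 * K f k"
      proof -
        have "K (- f1) k \<le> ennreal (2 powr real_of_int k) * A1 f1"
          using K_le(2)[where ?f1.0 = "- f1"] quasi_norms by (simp add: quasi_norm_uminus)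
        also have "\<dots> \<le> ennreal (2 powr real_of_int k) * (2 * mirror (K f) (- k))"
          using False mirror_Kseq_mono[of "-n" "-k" A0 A1 f]
          by (intro mult_left_mono order_trans[OF A1]) auto
        also have "\<dots> = 2 * K f k" by (subst mult.left_commute) (simp only: cancel(1))
        finally show ?thesis .
      qed
      ultimately have "K (f + - f1) k \<le> ennreal (C * 3) * K f k" by (rule C3)
      then show ?thesis using False by (simp add: trunc_def f(1))
    qed
    moreover have "mirror (K f1) k \<le> ennreal (C * 3) * trunc (- n) (mirror (K f)) k" for k
    proof (cases "- n \<le> k")
      case True
      have "mirror (K f1) k \<le> ennreal (2 powr real_of_int k) * (ennreal (2 powr real_of_int (- k)) * A1 f1)"
        unfolding mirror_def by (intro mult_left_mono K_le) auto
      also have "\<dots> = A1 f1" by (simp add: mult.assoc[symmetric] powr_minus flip: ennreal_mult)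
      finally show ?thesis using True order_trans[OF A1 C2] by (simp add: trunc_def)
    next
      case False
      have "K (- f0) (- k) \<le> 2 * K f (- k)"
        using K_le(1)[where ?f0.0 = "- f0"] quasi_norms Kseq_mono[of n "- k" A0 A1 f] False A0
        by (simp add: quasi_norm_uminus) (meson mult_left_mono order_trans zero_le)
      moreover have "K (f + - f0) (- k) \<le> ennreal C * (K f (- k) + K (- f0) (- k))" by (rule C)
      ultimately have "K (f + - f0) (- k) \<le> ennreal (C * 3) * K f (- k)" by (intro C3)
      then have "K f1 (- k) \<le> ennreal (C * 3) * K f (- k)" by (simp add: f(1))
      then have "ennreal (2 powr real_of_int k) * K f1 (- k) \<le>
          ennreal (2 powr real_of_int k) * (ennreal (C * 3) * K f (- k))" by (rule mult_left_mono) simp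
      then have "mirror (K f1) k \<le> ennreal (C * 3) * mirror (K f) k"
        by (simp add: mirror_def mult.left_commute)
      then show ?thesis using False by (simp add: trunc_def min_def)
    qed
    ultimately show ?thesis using f(1) by blast
  qed
  moreover have "C * 3 > 0" using C(1) by simp
  ultimately show ?thesis using that by blast
qed

section \<open>Holmstedt's formula\<close>

text \<open>The upper bound inserts a decomposition that is nearly optimal at \<open>2\<^sup>n\<close>. For the lower bound let
  \<open>f = g + h\<close>. The truncation of \<open>g\<close> is bounded by the norm of \<open>g\<close> in \<open>X0\<close>. The truncation of \<open>h\<close> has
  to be measured in \<open>X0\<close> as well, but \<open>h\<close> lies in \<open>X1\<close>: there \<open>2\<^sup>-\<^sup>k \<chi>\<^sub>1(k) K(h, k)\<close> is bounded by the
  norm of \<open>h\<close>, which is the same as boundedness of \<open>\<chi>\<^sub>0(k) K(h, k) / \<rho>(k)\<close>, and \<open>hardy_trunc\<close>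
  with outer exponent \<open>\<infinity>\<close> and weight \<open>1/\<rho>\<close> turns this into the required estimate. The roles of
  \<open>g\<close> and \<open>h\<close> are exchanged by mirroring.\<close>

theorem holmstedt:
  fixes X0 X1 :: "'a qspace" and \<rho> :: "int \<Rightarrow> real"
  assumes exponents: "r0 > 0" "q0 > 0" "r1 > 0" "q1 > 0"
    and b: "slow b0" "slow b1"
    and chi0_pos: "\<And>n. chi_seq r0 b0 q0 a0 n > 0"
    and \<rho>: "\<And>n. \<rho> n > 0" "decays (\<lambda>n. ennreal (1 / \<rho> n))" "decays (\<lambda>n. ennreal (\<rho> (- n)))"
    and \<rho>_chi: "(\<lambda>n. chi_seq r0 b0 q0 a0 n) \<asymp>
      (\<lambda>n. ennreal (\<rho> n) * (chi_seq r1 b1 q1 a1 (- n) * ennreal (2 powr - real_of_int n)))"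
    and X0: "X0 \<asymp> (\<lambda>f. Lfun r0 b0 q0 a0 (K f))"
    and X1: "X1 \<asymp> (\<lambda>f. Lfun r1 b1 q1 a1 (mirror (K f)))"
  shows "(\<lambda>(f, n). Kfun X0 X1 (\<rho> n) f) \<asymp> (\<lambda>(f, n). Lfun r0 b0 q0 a0 (trunc n (K f)) +
    ennreal (\<rho> n) * Lfun r1 b1 q1 a1 (trunc (- n) (mirror (K f))))"
proof (rule equivalentI)
  let ?L0 = "Lfun r0 b0 q0 a0" and ?L1 = "Lfun r1 b1 q1 a1"
  let ?chi0 = "chi_seq r0 b0 q0 a0" and ?chi1 = "chi_seq r1 b1 q1 a1"
  have L0_le: "?L0 x \<le> ennreal C * ?L0 y" if "\<And>k. x k \<le> ennreal C * y k" for C x y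
    using Lfun_mono[OF exponents(1,2), of x "\<lambda>k. ennreal C * y k" b0 a0] that
    by (simp add: Lfun_cmult exponents)
  have L1_le: "?L1 x \<le> ennreal C * ?L1 y" if "\<And>k. x k \<le> ennreal C * y k" for C x y
    using Lfun_mono[OF exponents(3,4), of x "\<lambda>k. ennreal C * y k" b1 a1] that
    by (simp add: Lfun_cmult exponents)
  show "(\<lambda>(f, n). Kfun X0 X1 (\<rho> n) f) \<preceq>
      (\<lambda>(f, n). ?L0 (trunc n (K f)) + ennreal (\<rho> n) * ?L1 (trunc (- n) (mirror (K f))))"
  proof -
    obtain C where C: "C > 0" "\<And>f n. K f n < top \<Longrightarrow> \<exists>f0 f1. f = f0 + f1 \<and>
        (\<forall>k. K f0 k \<le> ennreal C * trunc n (K f) k) \<and>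
        (\<forall>k. mirror (K f1) k \<le> ennreal C * trunc (- n) (mirror (K f)) k)"
      by (rule dyadic_decomposition) (rule that)
    obtain D0 where D0: "D0 \<ge> 1" "\<And>f. X0 f \<le> ennreal D0 * ?L0 (K f)"
      using equivalentD(1)[OF X0] by (rule dominatedE) (rule that)
    obtain D1 where D1: "D1 \<ge> 1" "\<And>f. X1 f \<le> ennreal D1 * ?L1 (mirror (K f))"
      using equivalentD(1)[OF X1] by (rule dominatedE) (rule that)
    define D where "D = max D0 D1"
    have D: "X0 f \<le> ennreal D * ?L0 (K f)" "X1 f \<le> ennreal D * ?L1 (mirror (K f))" for f
      unfolding D_def
      by (rule order_trans[OF D0(2)], intro mult_right_mono ennreal_leI, auto)
        (rule order_trans[OF D1(2)], intro mult_right_mono ennreal_leI, auto)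
    have D_pos: "D \<ge> 1" using D0(1) by (auto simp: D_def)
    show ?thesis
    proof (rule dominatedI[where C = "D * C"], clarify)
      fix f n
      let ?R0 = "?L0 (trunc n (K f))" and ?R1 = "?L1 (trunc (- n) (mirror (K f)))"
      show "Kfun X0 X1 (\<rho> n) f \<le> ennreal (D * C) * (?R0 + ennreal (\<rho> n) * ?R1)"
      proof (cases "K f n < top")
        case True
        from C(2)[OF this] obtain f0 f1 where f: "f = f0 + f1"
          "\<And>k. K f0 k \<le> ennreal C * trunc n (K f) k"
          "\<And>k. mirror (K f1) k \<le> ennreal C * trunc (- n) (mirror (K f)) k" by blast
        have "Kfun X0 X1 (\<rho> n) f \<le> X0 f0 + ennreal (\<rho> n) * X1 f1"
          unfolding f(1) by (rule Kfun_le[OF \<rho>(1)])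
        also have "\<dots> \<le> ennreal D * (ennreal C * ?R0) + ennreal (\<rho> n) * (ennreal D * (ennreal C * ?R1))"
          by (intro add_mono mult_left_mono order_trans[OF D(1)] order_trans[OF D(2)] L0_le L1_le f) auto
        also have "\<dots> = ennreal (D * C) * (?R0 + ennreal (\<rho> n) * ?R1)"
          using D_pos C(1) by (simp add: ennreal_mult distrib_left mult_ac)
        finally show ?thesis .
      next
        case False
        then have "?chi0 n * K f n = top"
          using chi0_pos[of n] by (simp add: ennreal_mult_top less_top[symmetric])
        moreover have "?chi0 n * K f n \<le> ?R0"
          by (intro chi_seq_le_Lfun exponents) (auto simp: trunc_def min_def)
        ultimately have "?R0 = top" by (simp add: top_unique)
        then have "ennreal (D * C) * (?R0 + ennreal (\<rho> n) * ?R1) = top"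
          using D_pos C(1) by (simp add: ennreal_mult_top)
        then show ?thesis by simp
      qed
    qed
  qed
  show "(\<lambda>(f, n). ?L0 (trunc n (K f)) + ennreal (\<rho> n) * ?L1 (trunc (- n) (mirror (K f)))) \<preceq>
      (\<lambda>(f, n). Kfun X0 X1 (\<rho> n) f)"
  proof -
    \<comment> \<open>Hardy's inequality with outer exponent \<open>\<infinity>\<close> compares truncations in one space with
      the norm in the other\<close>
    obtain E where E: "E \<ge> 1" "\<And>n. ?chi0 n \<le> ennreal E *
        (ennreal (\<rho> n) * (?chi1 (- n) * ennreal (2 powr - real_of_int n)))"
      using equivalentD(1)[OF \<rho>_chi] by (rule dominatedE) (rule that)
    obtain E' where E': "E' \<ge> 1" "\<And>n. ennreal (\<rho> n) * (?chi1 (- n) * ennreal (2 powr - real_of_int n)) \<le>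
        ennreal E' * ?chi0 n"
      using equivalentD(2)[OF \<rho>_chi] by (rule dominatedE) (rule that)
    obtain H0 where H0: "H0 \<ge> 1" "\<And>x. lnorm top UNIV (\<lambda>n. ennreal (1 / \<rho> n) * ?L0 (trunc n x)) \<le>
        ennreal H0 * lnorm top UNIV (\<lambda>n. ennreal (1 / \<rho> n) * (?chi0 n * x n))"
      by (rule dominatedE[OF hardy_trunc[OF _ exponents(1,2) \<rho>(2) b(1), of top a0]])
        (auto intro: that)
    obtain H1 where H1: "H1 \<ge> 1" "\<And>x. lnorm top UNIV (\<lambda>n. ennreal (\<rho> (- n)) * ?L1 (trunc n x)) \<le>
        ennreal H1 * lnorm top UNIV (\<lambda>n. ennreal (\<rho> (- n)) * (?chi1 n * x n))"
      by (rule dominatedE[OF hardy_trunc[OF _ exponents(3,4) \<rho>(3) b(2), of top a1]])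
        (auto intro: that)
    have cross0: "?L0 (trunc n (K g)) \<le> ennreal (H0 * E) * (ennreal (\<rho> n) * ?L1 (mirror (K g)))" for g n
    proof -
      have "ennreal (1 / \<rho> m) * (?chi0 m * K g m) \<le> ennreal E * ?L1 (mirror (K g))" for m
      proof -
        have "ennreal (1 / \<rho> m) * (?chi0 m * K g m) \<le> ennreal (1 / \<rho> m) * ((ennreal E *
            (ennreal (\<rho> m) * (?chi1 (- m) * ennreal (2 powr - real_of_int m)))) * K g m)"
          by (intro mult_left_mono mult_right_mono E) auto
        also have "\<dots> = (ennreal (1 / \<rho> m) * ennreal (\<rho> m)) * (ennreal E * (?chi1 (- m) * mirror (K g) (- m)))"
          by (simp add: mirror_def mult_ac)
        also have "ennreal (1 / \<rho> m) * ennreal (\<rho> m) = 1"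
          using \<rho>(1)[of m] by (simp flip: ennreal_mult)
        also have "1 * (ennreal E * (?chi1 (- m) * mirror (K g) (- m))) \<le> ennreal E * ?L1 (mirror (K g))"
          by (simp, intro mult_left_mono chi_seq_le_Lfun exponents mirror_Kseq_mono) auto
        finally show ?thesis .
      qed
      then have "lnorm top UNIV (\<lambda>n. ennreal (1 / \<rho> n) * (?chi0 n * K g n)) \<le> ennreal E * ?L1 (mirror (K g))"
        unfolding lnorm_infinity by (intro SUP_least)
      then have "lnorm top UNIV (\<lambda>n. ennreal (1 / \<rho> n) * ?L0 (trunc n (K g))) \<le>
          ennreal H0 * (ennreal E * ?L1 (mirror (K g)))"
        by (intro order_trans[OF H0(2)] mult_left_mono) auto
      moreover have "ennreal (1 / \<rho> n) * ?L0 (trunc n (K g)) \<le>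
          lnorm top UNIV (\<lambda>n. ennreal (1 / \<rho> n) * ?L0 (trunc n (K g)))"
        by (rule lnorm_ge) auto
      ultimately have "ennreal (1 / \<rho> n) * ?L0 (trunc n (K g)) \<le> ennreal H0 * (ennreal E * ?L1 (mirror (K g)))"
        by (rule order_trans[rotated])
      then have "ennreal (\<rho> n) * (ennreal (1 / \<rho> n) * ?L0 (trunc n (K g))) \<le>
          ennreal (\<rho> n) * (ennreal H0 * (ennreal E * ?L1 (mirror (K g))))"
        by (rule mult_left_mono) simp
      moreover have "ennreal (\<rho> n) * (ennreal (1 / \<rho> n) * ?L0 (trunc n (K g))) = ?L0 (trunc n (K g))"
        using \<rho>(1)[of n] by (simp flip: mult.assoc ennreal_mult)
      ultimately show ?thesis
        using H0(1) E(1) by (simp add: ennreal_mult mult_ac)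
    qed
    have cross1: "ennreal (\<rho> n) * ?L1 (trunc (- n) (mirror (K g))) \<le> ennreal (H1 * E') * ?L0 (K g)" for g n
    proof -
      have "ennreal (\<rho> (- m)) * (?chi1 m * mirror (K g) m) \<le> ennreal E' * ?L0 (K g)" for m
      proof -
        have "ennreal (\<rho> (- m)) * (?chi1 m * mirror (K g) m) =
            (ennreal (\<rho> (- m)) * (?chi1 (- (- m)) * ennreal (2 powr - real_of_int (- m)))) * K g (- m)"
          by (simp add: mirror_def mult_ac)
        also have "\<dots> \<le> (ennreal E' * ?chi0 (- m)) * K g (- m)"
          by (intro mult_right_mono E') auto
        also have "\<dots> \<le> ennreal E' * ?L0 (K g)"
          unfolding mult.assoc by (intro mult_left_mono chi_seq_le_Lfun exponents Kseq_mono) auto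
        finally show ?thesis .
      qed
      then have "lnorm top UNIV (\<lambda>n. ennreal (\<rho> (- n)) * (?chi1 n * mirror (K g) n)) \<le> ennreal E' * ?L0 (K g)"
        unfolding lnorm_infinity by (intro SUP_least)
      then have "lnorm top UNIV (\<lambda>n. ennreal (\<rho> (- n)) * ?L1 (trunc n (mirror (K g)))) \<le>
          ennreal H1 * (ennreal E' * ?L0 (K g))"
        by (intro order_trans[OF H1(2)] mult_left_mono) auto
      moreover have "ennreal (\<rho> (- (- n))) * ?L1 (trunc (- n) (mirror (K g))) \<le>
          lnorm top UNIV (\<lambda>n. ennreal (\<rho> (- n)) * ?L1 (trunc n (mirror (K g))))"
        by (rule lnorm_ge) auto
      ultimately have "ennreal (\<rho> (- (- n))) * ?L1 (trunc (- n) (mirror (K g))) \<le>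
          ennreal H1 * (ennreal E' * ?L0 (K g))"
        by (rule order_trans[rotated])
      then show ?thesis using H1(1) E'(1) by (simp add: ennreal_mult mult.assoc)
    qed
    obtain C where C: "C \<ge> 1" "\<And>f g k. K (f + g) k \<le> ennreal C * (K f k + K g k)"
      by (rule Kseq_add) (rule that)
    obtain S0 where S0: "S0 \<ge> 1" "\<And>x y. ?L0 (\<lambda>k. x k + y k) \<le> ennreal S0 * (?L0 x + ?L0 y)"
      by (rule dominatedE2[OF Lfun_add[OF exponents(1,2)]]) (rule that)
    obtain S1 where S1: "S1 \<ge> 1" "\<And>x y. ?L1 (\<lambda>k. x k + y k) \<le> ennreal S1 * (?L1 x + ?L1 y)"
      by (rule dominatedE2[OF Lfun_add[OF exponents(3,4)]]) (rule that)
    obtain D0 where D0: "D0 \<ge> 1" "\<And>f. ?L0 (K f) \<le> ennreal D0 * X0 f"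
      using equivalentD(2)[OF X0] by (rule dominatedE) (rule that)
    obtain D1 where D1: "D1 \<ge> 1" "\<And>f. ?L1 (mirror (K f)) \<le> ennreal D1 * X1 f"
      using equivalentD(2)[OF X1] by (rule dominatedE) (rule that)
    define M where "M = C * S0 + C * S1 * (H1 * E')"
    define N where "N = C * S0 * (H0 * E) + C * S1"
    have MN: "M > 0" "N > 0"
      unfolding M_def N_def using C(1) S0(1) S1(1) H0(1) H1(1) E(1) E'(1)
      by (auto intro!: add_pos_pos mult_pos_pos)
    show ?thesis
    proof (rule dominatedI[where C = "M * D0 + N * D1"], clarify)
      fix f n
      show "?L0 (trunc n (K f)) + ennreal (\<rho> n) * ?L1 (trunc (- n) (mirror (K f))) \<le>
          ennreal (M * D0 + N * D1) * Kfun X0 X1 (\<rho> n) f"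
      proof (rule le_cmult_Kfun)
        fix g h assume f: "f = g + h"
        let ?r = "ennreal (\<rho> n)"
        let ?G = "?L0 (K g)" and ?H = "?L1 (mirror (K h))"
        have "?L0 (trunc n (K f)) \<le> ennreal C * ?L0 (\<lambda>k. trunc n (K g) k + trunc n (K h) k)"
          using C(2) f by (intro L0_le) (auto simp: trunc_def)
        also have "\<dots> \<le> ennreal C * (ennreal S0 * (?L0 (trunc n (K g)) + ?L0 (trunc n (K h))))"
          by (intro mult_left_mono S0) auto
        also have "\<dots> \<le> ennreal C * (ennreal S0 * (?G + ennreal (H0 * E) * (?r * ?H)))"
          by (intro mult_left_mono add_mono Lfun_mono exponents cross0) (auto simp: trunc_def intro: Kseq_mono)
        also have "\<dots> = ennreal (C * S0) * ?G + ennreal (C * S0 * (H0 * E)) * (?r * ?H)"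
        proof -
          have "ennreal (C * S0 * (H0 * E)) = ennreal C * (ennreal S0 * ennreal (H0 * E))"
            using C(1) S0(1) H0(1) E(1) by (simp add: ennreal_mult mult.assoc)
          moreover have "ennreal (C * S0) = ennreal C * ennreal S0"
            using C(1) S0(1) by (simp add: ennreal_mult)
          ultimately show ?thesis by (simp add: distrib_left mult.assoc)
        qed
        finally have 0: "?L0 (trunc n (K f)) \<le>
            ennreal (C * S0) * ?G + ennreal (C * S0 * (H0 * E)) * (?r * ?H)" .
        have "mirror (K f) k \<le> ennreal C * (mirror (K g) k + mirror (K h) k)" for k
          using mult_left_mono[OF C(2)[of g h "- k"], of "ennreal (2 powr real_of_int k)"] f
          by (simp add: mirror_def distrib_left mult_ac)
        then have "?L1 (trunc (- n) (mirror (K f))) \<le>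
            ennreal C * ?L1 (\<lambda>k. trunc (- n) (mirror (K g)) k + trunc (- n) (mirror (K h)) k)"
          by (intro L1_le) (auto simp: trunc_def)
        also have "\<dots> \<le> ennreal C * (ennreal S1 *
            (?L1 (trunc (- n) (mirror (K g))) + ?L1 (trunc (- n) (mirror (K h)))))"
          by (intro mult_left_mono S1) auto
        also have "\<dots> \<le> ennreal C * (ennreal S1 * (?L1 (trunc (- n) (mirror (K g))) + ?H))"
          by (intro mult_left_mono add_mono Lfun_mono exponents)
            (auto simp: trunc_def intro: mirror_Kseq_mono)
        finally have "?r * ?L1 (trunc (- n) (mirror (K f))) \<le>
            ?r * (ennreal C * (ennreal S1 * (?L1 (trunc (- n) (mirror (K g))) + ?H)))"
          by (rule mult_left_mono) simp
        also have "\<dots> = ennreal C * (ennreal S1 * (?r * ?L1 (trunc (- n) (mirror (K g))) + ?r * ?H))"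
          by (simp add: distrib_left mult_ac)
        also have "\<dots> \<le> ennreal C * (ennreal S1 * (ennreal (H1 * E') * ?G + ?r * ?H))"
          by (intro mult_left_mono add_mono cross1) auto
        also have "\<dots> = ennreal (C * S1 * (H1 * E')) * ?G + ennreal (C * S1) * (?r * ?H)"
        proof -
          have "ennreal (C * S1 * (H1 * E')) = ennreal C * (ennreal S1 * ennreal (H1 * E'))"
            using C(1) S1(1) H1(1) E'(1) by (simp add: ennreal_mult mult.assoc)
          moreover have "ennreal (C * S1) = ennreal C * ennreal S1"
            using C(1) S1(1) by (simp add: ennreal_mult)
          ultimately show ?thesis by (simp add: distrib_left mult.assoc)
        qed
        finally have "?L0 (trunc n (K f)) + ?r * ?L1 (trunc (- n) (mirror (K f))) \<le>
            (ennreal (C * S0) * ?G + ennreal (C * S0 * (H0 * E)) * (?r * ?H)) +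
            (ennreal (C * S1 * (H1 * E')) * ?G + ennreal (C * S1) * (?r * ?H))"
          using 0 by (intro add_mono)
        also have "\<dots> = ennreal M * ?G + ennreal N * (?r * ?H)"
        proof -
          have "ennreal M = ennreal (C * S0) + ennreal (C * S1 * (H1 * E'))"
            "ennreal N = ennreal (C * S0 * (H0 * E)) + ennreal (C * S1)"
            unfolding M_def N_def using C(1) S0(1) S1(1) H0(1) H1(1) E(1) E'(1)
            by (intro ennreal_plus; simp)+
          then show ?thesis by (simp only: distrib_right add_ac)
        qed
        also have "\<dots> \<le> ennreal M * (ennreal D0 * X0 g) + ennreal N * (?r * (ennreal D1 * X1 h))"
          by (intro add_mono mult_left_mono D0 D1) auto
        also have "\<dots> = ennreal (M * D0) * X0 g + ennreal (N * D1) * (?r * X1 h)"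
          using MN D0(1) D1(1) by (simp add: ennreal_mult mult_ac)
        also have "\<dots> \<le> ennreal (M * D0 + N * D1) * X0 g + ennreal (M * D0 + N * D1) * (?r * X1 h)"
          using MN D0(1) D1(1) by (intro add_mono mult_right_mono ennreal_leI) auto
        finally show "?L0 (trunc n (K f)) + ?r * ?L1 (trunc (- n) (mirror (K f))) \<le>
            ennreal (M * D0 + N * D1) * (X0 g + ?r * X1 h)"
          by (simp only: distrib_left)
      qed (use MN D0(1) D1(1) in \<open>auto intro!: add_pos_pos mult_pos_pos\<close>)
    qed
  qed
qed

end

section \<open>Slowly varying functions\<close>

text \<open>Slow variation as one inequality, symmetric in the two points and phrased in logarithmic
  distance. In this form it is inherited by powers of either sign and by compositions.\<close>

definition slowly_varying :: "(real \<Rightarrow> real) \<Rightarrow> bool" where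
  "slowly_varying w \<longleftrightarrow> (\<forall>t>0. w t > 0) \<and>
     (\<forall>\<epsilon>>0. \<exists>C>0. \<forall>s>0. \<forall>t>0. w s \<le> C * 2 powr (\<epsilon> * \<bar>log 2 s - log 2 t\<bar>) * w t)"

text \<open>The weight at the dyadic points, as a sequence of extended reals.\<close>

definition dyadic :: "(real \<Rightarrow> real) \<Rightarrow> int \<Rightarrow> ennreal" where
  "dyadic w k = ennreal (w (2 powr real_of_int k))"

lemma slowly_varying_pos: "slowly_varying w \<Longrightarrow> t > 0 \<Longrightarrow> w t > 0"
  unfolding slowly_varying_def by simp

lemma slowly_varyingE:
  assumes "slowly_varying w" "\<epsilon> > 0"
  obtains C where "C > 0"
    "\<And>s t. s > 0 \<Longrightarrow> t > 0 \<Longrightarrow> w s \<le> C * 2 powr (\<epsilon> * \<bar>log 2 s - log 2 t\<bar>) * w t"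
proof -
  have "\<exists>C>0. \<forall>s>0. \<forall>t>0. w s \<le> C * 2 powr (\<epsilon> * \<bar>log 2 s - log 2 t\<bar>) * w t"
    using assms by (simp only: slowly_varying_def)
  then obtain C where C: "C > 0"
    "\<forall>s>0. \<forall>t>0. w s \<le> C * 2 powr (\<epsilon> * \<bar>log 2 s - log 2 t\<bar>) * w t"
    by (elim exE conjE) (rule that)
  show ?thesis by (rule that[OF C(1) C(2)[rule_format]])
qed

text \<open>An increasing function comparable with \<open>t\<^sup>\<epsilon> a(t)\<close> bounds \<open>a s\<close> by \<open>a t\<close> for \<open>s \<le> t\<close>, a decreasing one
  comparable with \<open>t\<^sup>-\<^sup>\<epsilon> a(t)\<close> does so for \<open>s \<ge> t\<close>.\<close>

lemma SV_slowly_varying: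
  assumes "a \<in> SV"
  shows "slowly_varying a"
proof -
  have pos: "a t > 0" if "t > 0" for t using assms that by (simp add: SV_def)
  have almost_monotone: "(\<exists>g. mono_on {0<..} g \<and> equiv_pos (\<lambda>t. t powr \<epsilon> * a t) g) \<and>
      (\<exists>h. antimono_on {0<..} h \<and> equiv_pos (\<lambda>t. t powr (- \<epsilon>) * a t) h)" if "\<epsilon> > 0" for \<epsilon>
  proof -
    have "(\<exists>g. (\<forall>t>0. g t > 0) \<and> mono_on {0<..} g \<and> equiv_pos (\<lambda>t. t powr \<epsilon> * a t) g) \<and>
      (\<exists>g. (\<forall>t>0. g t > 0) \<and> antimono_on {0<..} g \<and> equiv_pos (\<lambda>t. t powr (- \<epsilon>) * a t) g)"
      using assms that by (simp only: SV_def mem_Collect_eq)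
    then show ?thesis by (elim conjE exE) (intro conjI exI)
  qed
  show ?thesis
    unfolding slowly_varying_def
  proof (intro conjI allI impI pos)
    fix \<epsilon> :: real assume \<epsilon>: "\<epsilon> > 0"
    obtain g where g: "mono_on {0<..} g" "equiv_pos (\<lambda>t. t powr \<epsilon> * a t) g"
      using almost_monotone[OF \<epsilon>] by (elim conjE exE) (rule that)
    obtain h where h: "antimono_on {0<..} h" "equiv_pos (\<lambda>t. t powr (- \<epsilon>) * a t) h"
      using almost_monotone[OF \<epsilon>] by (elim conjE exE) (rule that)
    obtain C where C: "C > 0" "\<And>t. t > 0 \<Longrightarrow> g t / C \<le> t powr \<epsilon> * a t" "\<And>t. t > 0 \<Longrightarrow> t powr \<epsilon> * a t \<le> C * g t"
      using g(2) unfolding equiv_pos_def by (elim exE conjE) (rule that, auto)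
    obtain D where D: "D > 0" "\<And>t. t > 0 \<Longrightarrow> h t / D \<le> t powr - \<epsilon> * a t" "\<And>t. t > 0 \<Longrightarrow> t powr - \<epsilon> * a t \<le> D * h t"
      using h(2) unfolding equiv_pos_def by (elim exE conjE) (rule that, auto)
    show "\<exists>C>0. \<forall>s>0. \<forall>t>0. a s \<le> C * 2 powr (\<epsilon> * \<bar>log 2 s - log 2 t\<bar>) * a t"
    proof (intro exI[of _ "C * C + D * D"] conjI allI impI)
      fix s t :: real assume st: "s > 0" "t > 0"
      have two: "2 powr (\<epsilon> * (log 2 x - log 2 y)) = x powr \<epsilon> / y powr \<epsilon>" if "x > 0" "y > 0" for x y
      proof -
        have "2 powr (\<epsilon> * (log 2 x - log 2 y)) = (2 powr log 2 (x / y)) powr \<epsilon>"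
          using that by (simp add: powr_powr log_divide mult.commute)
        then show ?thesis using that by (simp add: powr_divide)
      qed
      show "a s \<le> (C * C + D * D) * 2 powr (\<epsilon> * \<bar>log 2 s - log 2 t\<bar>) * a t"
      proof (cases "s \<le> t")
        case True
        have "s powr \<epsilon> * a s \<le> C * g s" using C st by simp
        also have "\<dots> \<le> C * g t" using g(1) True st C(1) by (auto simp: mono_on_def)
        also have "\<dots> \<le> C * (C * (t powr \<epsilon> * a t))"
          using C(1) C(2)[OF st(2)] by (intro mult_left_mono) (auto simp: field_simps)
        finally have "a s \<le> C * C * (t powr \<epsilon> / s powr \<epsilon>) * a t"
          using st by (simp add: field_simps)
        also have "\<dots> \<le> (C * C + D * D) * (t powr \<epsilon> / s powr \<epsilon>) * a t"
          using pos[OF st(2)] by (intro mult_right_mono) auto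
        finally show ?thesis using True st two[of t s] by (simp add: abs_minus_commute)
      next
        case False
        have "s powr - \<epsilon> * a s \<le> D * h s" using D st by simp
        also have "\<dots> \<le> D * h t" using h(1) False st D(1) by (auto simp: monotone_on_def)
        also have "\<dots> \<le> D * (D * (t powr - \<epsilon> * a t))"
          using D(1) D(2)[OF st(2)] by (intro mult_left_mono) (auto simp: field_simps)
        finally have "a s \<le> D * D * (s powr \<epsilon> / t powr \<epsilon>) * a t"
          using st by (simp add: powr_minus field_simps)
        also have "\<dots> \<le> (C * C + D * D) * (s powr \<epsilon> / t powr \<epsilon>) * a t"
          using pos[OF st(2)] by (intro mult_right_mono) auto
        finally show ?thesis using False st two[of s t] by simp
      qed
    qed (use C(1) D(1) in \<open>auto intro!: add_pos_pos mult_pos_pos\<close>)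
  qed
qed

lemma slowly_varying_mult:
  assumes "slowly_varying v" "slowly_varying w"
  shows "slowly_varying (\<lambda>t. v t * w t)"
  unfolding slowly_varying_def
proof (intro conjI allI impI)
  show "v t * w t > 0" if "t > 0" for t using assms that by (simp add: slowly_varying_pos)
  fix \<epsilon> :: real assume \<epsilon>: "\<epsilon> > 0"
  obtain C where C: "C > 0"
    "\<And>s t. s > 0 \<Longrightarrow> t > 0 \<Longrightarrow> v s \<le> C * 2 powr (\<epsilon> / 2 * \<bar>log 2 s - log 2 t\<bar>) * v t"
    by (rule slowly_varyingE[OF assms(1) half_gt_zero[OF \<epsilon>]]) (rule that)
  obtain D where D: "D > 0"
    "\<And>s t. s > 0 \<Longrightarrow> t > 0 \<Longrightarrow> w s \<le> D * 2 powr (\<epsilon> / 2 * \<bar>log 2 s - log 2 t\<bar>) * w t"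
    by (rule slowly_varyingE[OF assms(2) half_gt_zero[OF \<epsilon>]]) (rule that)
  show "\<exists>C>0. \<forall>s>0. \<forall>t>0. v s * w s \<le> C * 2 powr (\<epsilon> * \<bar>log 2 s - log 2 t\<bar>) * (v t * w t)"
  proof (intro exI[of _ "C * D"] conjI allI impI)
    fix s t :: real assume st: "s > 0" "t > 0"
    let ?p = "2 powr (\<epsilon> / 2 * \<bar>log 2 s - log 2 t\<bar>)"
    have "v s * w s \<le> (C * ?p * v t) * (D * ?p * w t)"
      using st C(1) slowly_varying_pos[OF assms(1)] slowly_varying_pos[OF assms(2)]
      by (intro mult_mono C D) (simp_all add: less_imp_le)
    also have "\<dots> = C * D * (?p * ?p) * (v t * w t)" by (simp only: mult_ac)
    also have "?p * ?p = 2 powr (\<epsilon> * \<bar>log 2 s - log 2 t\<bar>)" by (simp flip: powr_add)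
    finally show "v s * w s \<le> C * D * 2 powr (\<epsilon> * \<bar>log 2 s - log 2 t\<bar>) * (v t * w t)" .
  qed (use C(1) D(1) in auto)
qed

lemma slowly_varying_powr:
  assumes "slowly_varying w"
  shows "slowly_varying (\<lambda>t. w t powr p)"
  unfolding slowly_varying_def
proof (intro conjI allI impI)
  show "w t powr p > 0" if "t > 0" for t using slowly_varying_pos[OF assms that] by simp
  fix \<epsilon> :: real assume \<epsilon>: "\<epsilon> > 0"
  have \<delta>: "\<epsilon> / (\<bar>p\<bar> + 1) > 0" using \<epsilon> by simp
  obtain C where C: "C > 0"
    "\<And>s t. s > 0 \<Longrightarrow> t > 0 \<Longrightarrow> w s \<le> C * 2 powr (\<epsilon> / (\<bar>p\<bar> + 1) * \<bar>log 2 s - log 2 t\<bar>) * w t"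
    by (rule slowly_varyingE[OF assms \<delta>]) (rule that)
  show "\<exists>C>0. \<forall>s>0. \<forall>t>0. w s powr p \<le> C * 2 powr (\<epsilon> * \<bar>log 2 s - log 2 t\<bar>) * w t powr p"
  proof (intro exI[of _ "C powr \<bar>p\<bar>"] conjI allI impI)
    fix s t :: real assume st: "s > 0" "t > 0"
    let ?d = "\<bar>log 2 s - log 2 t\<bar>"
    have ws: "w s > 0" "w t > 0" using st slowly_varying_pos[OF assms] by auto
    have key: "(w x / w y) powr \<bar>p\<bar> \<le> C powr \<bar>p\<bar> * 2 powr (\<epsilon> * ?d)"
      if "x > 0" "y > 0" "\<bar>log 2 x - log 2 y\<bar> = ?d" for x y
    proof -
      have "w x / w y \<le> C * 2 powr (\<epsilon> / (\<bar>p\<bar> + 1) * ?d)"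
        using C(2)[OF that(1,2)] slowly_varying_pos[OF assms that(2)] that(3) by (simp add: divide_simps)
      then have "(w x / w y) powr \<bar>p\<bar> \<le> (C * 2 powr (\<epsilon> / (\<bar>p\<bar> + 1) * ?d)) powr \<bar>p\<bar>"
        using slowly_varying_pos[OF assms that(1)] slowly_varying_pos[OF assms that(2)]
        by (intro powr_mono2) auto
      also have "\<dots> = C powr \<bar>p\<bar> * 2 powr (\<epsilon> / (\<bar>p\<bar> + 1) * ?d * \<bar>p\<bar>)"
        using C(1) by (simp add: powr_mult powr_powr)
      also have "\<dots> \<le> C powr \<bar>p\<bar> * 2 powr (\<epsilon> * ?d)"
      proof (intro mult_left_mono powr_mono)
        have "\<bar>p\<bar> / (\<bar>p\<bar> + 1) \<le> 1" by simp
        then have "\<epsilon> * ?d * (\<bar>p\<bar> / (\<bar>p\<bar> + 1)) \<le> \<epsilon> * ?d * 1"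
          using \<epsilon> by (intro mult_left_mono) auto
        then show "\<epsilon> / (\<bar>p\<bar> + 1) * ?d * \<bar>p\<bar> \<le> \<epsilon> * ?d" by (simp add: mult_ac)
      qed auto
      finally show ?thesis .
    qed
    have "w s powr p = (w s / w t) powr p * w t powr p"
      using ws by (simp add: powr_divide)
    also have "(w s / w t) powr p \<le> C powr \<bar>p\<bar> * 2 powr (\<epsilon> * ?d)"
    proof (cases "p \<ge> 0")
      case True
      then show ?thesis using key[OF st] by simp
    next
      case False
      have "(w s / w t) powr p = (w t / w s) powr \<bar>p\<bar>"
        using ws False powr_minus_divide[of "w s" "- p"] powr_minus_divide[of "w t" "- p"]
        by (simp add: powr_divide)
      then show ?thesis using key[OF st(2,1)] by (simp add: abs_minus_commute)
    qed
    finally show "w s powr p \<le> C powr \<bar>p\<bar> * 2 powr (\<epsilon> * ?d) * w t powr p"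
      by (simp add: mult_right_mono)
  qed (use C(1) in auto)
qed

lemma slowly_varying_cong:
  assumes v: "slowly_varying v" and eq: "\<And>t. t > 0 \<Longrightarrow> v t = w t"
  shows "slowly_varying w"
  unfolding slowly_varying_def
proof (intro conjI allI impI)
  show "w t > 0" if "t > 0" for t using slowly_varying_pos[OF v that] eq[OF that] by simp
  fix \<epsilon> :: real assume \<epsilon>: "\<epsilon> > 0"
  obtain C where C: "C > 0"
    "\<And>s t. s > 0 \<Longrightarrow> t > 0 \<Longrightarrow> v s \<le> C * 2 powr (\<epsilon> * \<bar>log 2 s - log 2 t\<bar>) * v t"
    by (rule slowly_varyingE[OF v \<epsilon>]) (rule that)
  have "w s \<le> C * 2 powr (\<epsilon> * \<bar>log 2 s - log 2 t\<bar>) * w t" if "s > 0" "t > 0" for s t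
    using C(2)[OF that] eq that by simp
  then show "\<exists>C>0. \<forall>s>0. \<forall>t>0. w s \<le> C * 2 powr (\<epsilon> * \<bar>log 2 s - log 2 t\<bar>) * w t"
    using C(1) by (intro exI[of _ C] conjI allI impI)
qed

lemma slowly_varying_divide:
  assumes "slowly_varying v" "slowly_varying w"
  shows "slowly_varying (\<lambda>t. v t / w t)"
proof -
  have sv: "slowly_varying (\<lambda>t. v t * w t powr (- 1))"
    by (intro slowly_varying_mult slowly_varying_powr assms)
  have "v t * w t powr (- 1) = v t / w t" if "t > 0" for t
    using slowly_varying_pos[OF assms(2) that] by (simp add: powr_minus divide_inverse)
  then show ?thesis by (rule slowly_varying_cong[OF sv])
qed

text \<open>The map \<open>t \<mapsto> t * h t\<close> changes logarithmic distances at most by a factor \<open>2\<close> and an additive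
  constant.\<close>

lemma slowly_varying_compose:
  assumes "slowly_varying a" "slowly_varying h"
  shows "slowly_varying (\<lambda>t. a (t * h t))"
  unfolding slowly_varying_def
proof (intro conjI allI impI)
  have h: "t * h t > 0" if "t > 0" for t using assms(2) that by (simp add: slowly_varying_pos)
  then show "a (t * h t) > 0" if "t > 0" for t using assms(1) that by (simp add: slowly_varying_pos)
  fix \<epsilon> :: real assume \<epsilon>: "\<epsilon> > 0"
  obtain C where C: "C > 0"
    "\<And>s t. s > 0 \<Longrightarrow> t > 0 \<Longrightarrow> a s \<le> C * 2 powr (\<epsilon> / 2 * \<bar>log 2 s - log 2 t\<bar>) * a t"
    by (rule slowly_varyingE[OF assms(1) half_gt_zero[OF \<epsilon>]]) (rule that)
  obtain D where D: "D > 0"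
    "\<And>s t. s > 0 \<Longrightarrow> t > 0 \<Longrightarrow> h s \<le> D * 2 powr (1 * \<bar>log 2 s - log 2 t\<bar>) * h t"
    by (rule slowly_varyingE[OF assms(2) zero_less_one]) (rule that)
  show "\<exists>C>0. \<forall>s>0. \<forall>t>0.
      a (s * h s) \<le> C * 2 powr (\<epsilon> * \<bar>log 2 s - log 2 t\<bar>) * a (t * h t)"
  proof (intro exI[of _ "C * 2 powr (\<epsilon> / 2 * \<bar>log 2 D\<bar>)"] conjI allI impI)
    fix s t :: real assume st: "s > 0" "t > 0"
    let ?d = "\<bar>log 2 s - log 2 t\<bar>"
    have diff: "log 2 (h x) - log 2 (h y) \<le> log 2 D + \<bar>log 2 x - log 2 y\<bar>" if "x > 0" "y > 0" for x y
    proof -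
      have "log 2 (h x) \<le> log 2 (D * 2 powr (1 * \<bar>log 2 x - log 2 y\<bar>) * h y)"
        using D that assms(2) by (subst log_le_cancel_iff) (auto simp: slowly_varying_pos)
      then show ?thesis
        using D(1) slowly_varying_pos[OF assms(2) that(2)] by (simp add: log_mult)
    qed
    have "\<bar>log 2 (s * h s) - log 2 (t * h t)\<bar> \<le> \<bar>log 2 D\<bar> + 2 * ?d"
    proof -
      have "log 2 (h s) - log 2 (h t) \<le> \<bar>log 2 D\<bar> + ?d"
        using diff[OF st] abs_ge_self[of "log 2 D"] by linarith
      moreover have "log 2 (h t) - log 2 (h s) \<le> \<bar>log 2 D\<bar> + ?d"
        using diff[OF st(2,1)] abs_ge_self[of "log 2 D"] abs_minus_commute[of "log 2 s"] by simp
      ultimately have "\<bar>log 2 (h s) - log 2 (h t)\<bar> \<le> \<bar>log 2 D\<bar> + ?d"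
        by (intro abs_leI) auto
      moreover have "log 2 (s * h s) - log 2 (t * h t) =
          (log 2 s - log 2 t) + (log 2 (h s) - log 2 (h t))"
        using st slowly_varying_pos[OF assms(2) st(1)] slowly_varying_pos[OF assms(2) st(2)]
        by (simp add: log_mult)
      ultimately show ?thesis
        using abs_triangle_ineq[of "log 2 s - log 2 t" "log 2 (h s) - log 2 (h t)"] by simp
    qed
    then have "2 powr (\<epsilon> / 2 * \<bar>log 2 (s * h s) - log 2 (t * h t)\<bar>) \<le>
        2 powr (\<epsilon> / 2 * (\<bar>log 2 D\<bar> + 2 * ?d))"
      using \<epsilon> by (intro powr_mono mult_left_mono) auto
    also have "\<dots> = 2 powr (\<epsilon> / 2 * \<bar>log 2 D\<bar>) * 2 powr (\<epsilon> * ?d)"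
      by (simp add: distrib_left flip: powr_add)
    finally have "C * 2 powr (\<epsilon> / 2 * \<bar>log 2 (s * h s) - log 2 (t * h t)\<bar>) * a (t * h t) \<le>
        C * (2 powr (\<epsilon> / 2 * \<bar>log 2 D\<bar>) * 2 powr (\<epsilon> * ?d)) * a (t * h t)"
      using C(1) slowly_varying_pos[OF assms(1) h[OF st(2)]]
      by (intro mult_right_mono mult_left_mono) auto
    then show "a (s * h s) \<le> C * 2 powr (\<epsilon> / 2 * \<bar>log 2 D\<bar>) * 2 powr (\<epsilon> * ?d) * a (t * h t)"
      using C(2)[OF h[OF st(1)] h[OF st(2)]] by (simp add: mult.assoc)
  qed (use C(1) in auto)
qed

lemma slow_dyadic:
  assumes "slowly_varying w"
  shows "slow (dyadic w)"
  unfolding slow_def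
proof (intro allI impI)
  fix \<epsilon> :: real assume \<epsilon>: "\<epsilon> > 0"
  obtain C where C: "C > 0"
    "\<And>s t. s > 0 \<Longrightarrow> t > 0 \<Longrightarrow> w s \<le> C * 2 powr (\<epsilon> * \<bar>log 2 s - log 2 t\<bar>) * w t"
    by (rule slowly_varyingE[OF assms \<epsilon>]) (rule that)
  have "dyadic w m \<le> ennreal (C * 2 powr (\<epsilon> * \<bar>real_of_int m - real_of_int n\<bar>)) * dyadic w n" for m n
    using C(2)[of "2 powr real_of_int m" "2 powr real_of_int n"] C(1)
      slowly_varying_pos[OF assms, of "2 powr real_of_int n"]
    by (simp add: dyadic_def flip: ennreal_mult)
  then show "\<exists>C>0. \<forall>m n. dyadic w m \<le>
      ennreal (C * 2 powr (\<epsilon> * \<bar>real_of_int m - real_of_int n\<bar>)) * dyadic w n"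
    using C(1) by blast
qed

lemma dyadic_pos: "slowly_varying w \<Longrightarrow> dyadic w k > 0"
  unfolding dyadic_def by (simp add: slowly_varying_pos)

lemma samples_powr_slowly_varying:
  assumes "slowly_varying w"
  shows "samples (\<lambda>_ u. ennreal (u powr p * w u))
    (\<lambda>_ k. ennreal (2 powr (p * real_of_int k)) * dyadic w k)"
proof -
  obtain C where C: "C > 0"
    "\<And>s t. s > 0 \<Longrightarrow> t > 0 \<Longrightarrow> w s \<le> C * 2 powr (1 * \<bar>log 2 s - log 2 t\<bar>) * w t"
    by (rule slowly_varyingE[OF assms zero_less_one]) (rule that)
  define D where "D = 2 powr \<bar>p\<bar> * (C * 2)"
  have D: "D > 0" using C(1) by (simp add: D_def)
  have key: "s powr p * w s \<le> D * (t powr p * w t)"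
    if st: "s > 0" "t > 0" "\<bar>log 2 s - log 2 t\<bar> \<le> 1" for s t
  proof -
    have "(s / t) powr p = 2 powr (log 2 (s / t) * p)"
      unfolding powr_powr[symmetric] using st by simp
    also have "\<dots> \<le> 2 powr \<bar>p\<bar>"
    proof (intro powr_mono)
      have "\<bar>log 2 (s / t) * p\<bar> \<le> 1 * \<bar>p\<bar>"
        unfolding abs_mult using st by (intro mult_right_mono) (auto simp: log_divide)
      then show "log 2 (s / t) * p \<le> \<bar>p\<bar>" by simp
    qed simp
    finally have p: "s powr p \<le> 2 powr \<bar>p\<bar> * t powr p"
      using st by (simp add: powr_divide field_simps)
    have "2 powr (1 * \<bar>log 2 s - log 2 t\<bar>) \<le> 2 powr 1"
      using st(3) by (intro powr_mono) auto
    then have "C * 2 powr (1 * \<bar>log 2 s - log 2 t\<bar>) * w t \<le> C * 2 * w t"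
      using C(1) slowly_varying_pos[OF assms st(2)] by (intro mult_right_mono mult_left_mono) auto
    then have "w s \<le> C * 2 * w t" using C(2)[OF st(1,2)] by linarith
    with p have "s powr p * w s \<le> (2 powr \<bar>p\<bar> * t powr p) * (C * 2 * w t)"
      using slowly_varying_pos[OF assms st(1)] by (intro mult_mono) auto
    then show ?thesis by (simp add: D_def mult_ac)
  qed
  have key': "ennreal (s powr p * w s) \<le> ennreal D * ennreal (t powr p * w t)"
    if st: "s > 0" "t > 0" "\<bar>log 2 s - log 2 t\<bar> \<le> 1" for s t
    using key[OF st] D slowly_varying_pos[OF assms st(2)]
    by (simp add: ennreal_leI flip: ennreal_mult)
  have dyadic: "ennreal (2 powr (p * real_of_int k)) * dyadic w k =
      ennreal ((2 powr real_of_int k) powr p * w (2 powr real_of_int k))" for k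
    using slowly_varying_pos[OF assms, of "2 powr real_of_int k"]
    by (simp add: dyadic_def powr_powr mult.commute[of p] ennreal_mult)
  show ?thesis unfolding dyadic
  proof (rule samplesI[of D D])
    fix u :: real assume u: "u > 0"
    have "real_of_int (level u) \<le> log 2 u" "log 2 u < real_of_int (level u) + 1"
      unfolding level_def by linarith+
    then have "\<bar>log 2 u - log 2 (2 powr real_of_int (level u))\<bar> \<le> 1"
      "\<bar>log 2 (2 powr real_of_int (level u)) - log 2 u\<bar> \<le> 1" by simp_all
    then show "ennreal (u powr p * w u) \<le> ennreal D *
          ennreal ((2 powr real_of_int (level u)) powr p * w (2 powr real_of_int (level u)))"
      "ennreal ((2 powr real_of_int (level u)) powr p * w (2 powr real_of_int (level u))) \<le>
          ennreal D * ennreal (u powr p * w u)"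
      using u by (auto intro!: key')
  qed (use D in \<open>auto intro!: key'\<close>)
qed

lemma samples_slowly_varying:
  assumes "slowly_varying w"
  shows "samples (\<lambda>_ u. ennreal (w u)) (\<lambda>_. dyadic w)"
  using samples_cong[OF samples_powr_slowly_varying[OF assms, of 0], of "\<lambda>_ u. ennreal (w u)"]
  by simp

lemma slowly_varying_of_samples:
  assumes pos: "\<And>t. t > 0 \<Longrightarrow> w t > 0"
    and w: "samples (\<lambda>_ :: unit. \<lambda>t. ennreal (w t)) (\<lambda>_. X)" and X: "slow X"
  shows "slowly_varying w"
  unfolding slowly_varying_def
proof (intro conjI allI impI)
  fix \<epsilon> :: real assume \<epsilon>: "\<epsilon> > 0"
  obtain D where D: "D \<ge> 1"
    "\<And>u. u > 0 \<Longrightarrow> ennreal (w u) \<le> ennreal D * X (level u)"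
    "\<And>u. u > 0 \<Longrightarrow> X (level u) \<le> ennreal D * ennreal (w u)"
    using w by (rule samplesE) (rule that)
  obtain C where C: "C > 0"
    "\<And>m n. X m \<le> ennreal (C * 2 powr (\<epsilon> * \<bar>real_of_int m - real_of_int n\<bar>)) * X n"
    by (rule slowE[OF X \<epsilon>]) (rule that)
  show "\<exists>C>0. \<forall>s>0. \<forall>t>0. w s \<le> C * 2 powr (\<epsilon> * \<bar>log 2 s - log 2 t\<bar>) * w t"
  proof (intro exI[of _ "D * (C * 2 powr \<epsilon>) * D"] conjI allI impI)
    fix s t :: real assume st: "s > 0" "t > 0"
    let ?p = "2 powr (\<epsilon> * \<bar>real_of_int (level s) - real_of_int (level t)\<bar>)"
    have "ennreal (w s) \<le> ennreal D * (ennreal (C * ?p) * (ennreal D * ennreal (w t)))"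
      by (rule order_trans[OF D(2)[OF st(1)] mult_left_mono[OF order_trans[OF C(2)
            mult_left_mono[OF D(3)[OF st(2)]]]]]) auto
    also have "\<dots> = ennreal (D * (C * ?p) * D * w t)"
      using C(1) D(1) pos[OF st(2)] by (simp add: ennreal_mult mult.assoc)
    finally have "w s \<le> D * (C * ?p) * D * w t"
      using C(1) D(1) pos[OF st(2)] by (subst (asm) ennreal_le_iff) auto
    also have "?p \<le> 2 powr \<epsilon> * 2 powr (\<epsilon> * \<bar>log 2 s - log 2 t\<bar>)"
    proof -
      have "\<bar>real_of_int (level s) - real_of_int (level t)\<bar> \<le> 1 + \<bar>log 2 s - log 2 t\<bar>"
        unfolding level_def by linarith
      then have "\<epsilon> * \<bar>real_of_int (level s) - real_of_int (level t)\<bar> \<le> \<epsilon> * (1 + \<bar>log 2 s - log 2 t\<bar>)"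
        using \<epsilon> by (intro mult_left_mono) auto
      then have "?p \<le> 2 powr (\<epsilon> * (1 + \<bar>log 2 s - log 2 t\<bar>))"
        by (intro powr_mono) auto
      then show ?thesis by (simp add: distrib_left powr_add)
    qed
    finally show "w s \<le> D * (C * 2 powr \<epsilon>) * D * 2 powr (\<epsilon> * \<bar>log 2 s - log 2 t\<bar>) * w t"
      using C(1) D(1) pos[OF st(2)] by (simp add: mult_ac mult_left_mono mult_right_mono)
  qed (use C(1) D(1) in auto)
qed (rule pos)

text \<open>A norm that is comparable with a slowly varying sequence is finite everywhere as soon as it is
  finite at one point, and then its real value is a slowly varying function. This is how
  \<open>\<chi>\<^sub>0\<close>, \<open>\<chi>\<^sub>1\<close> and the tails in \<open>B\<^sub>0\<close> and \<open>B\<^sub>1\<close> are handled.\<close>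

lemma slowly_varying_enn2real:
  assumes W: "samples (\<lambda>_ :: unit. W) (\<lambda>_. X)" and X: "slow X" "\<And>n. X n > 0" and fin: "X 0 < top"
  shows "slowly_varying (\<lambda>t. enn2real (W t))" "dyadic (\<lambda>t. enn2real (W t)) \<asymp> X"
proof -
  obtain D where D: "D \<ge> 1"
    "\<And>u. u > 0 \<Longrightarrow> W u \<le> ennreal D * X (level u)"
    "\<And>u. u > 0 \<Longrightarrow> X (level u) \<le> ennreal D * W u"
    using W by (rule samplesE) (rule that)
  obtain C where C: "C > 0"
    "\<And>m n. X m \<le> ennreal (C * 2 powr (1 * \<bar>real_of_int m - real_of_int n\<bar>)) * X n"
    by (rule slowE[OF X(1), of 1]) (auto intro: that)
  have X_fin: "X n < top" for n
    using fin by (intro le_less_trans[OF C(2)[of n 0]]) (auto simp: ennreal_mult_less_top)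
  have W_pos: "0 < W t" if "t > 0" for t
    using less_le_trans[OF X(2) D(3)[OF that]] by (cases "W t = 0") (auto simp: zero_less_iff_neq_zero)
  have W_fin: "W t < top" if "t > 0" for t
    using X_fin by (intro le_less_trans[OF D(2)[OF that]]) (auto simp: ennreal_mult_less_top)
  have W_eq: "ennreal (enn2real (W t)) = W t" if "t > 0" for t
    using W_fin[OF that] by simp
  show "slowly_varying (\<lambda>t. enn2real (W t))"
    by (rule slowly_varying_of_samples[OF _ samples_cong[OF W] X(1)])
      (auto simp: W_eq enn2real_positive_iff W_pos W_fin)
  show "dyadic (\<lambda>t. enn2real (W t)) \<asymp> X"
    using D(2,3)[of "2 powr real_of_int _"]
    by (intro equivalentI dominatedI[where C = D]) (auto simp: dyadic_def W_eq)
qed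

section \<open>Change of variables\<close>

lemma int_crossing:
  fixes P :: "int \<Rightarrow> bool"
  assumes "P k" "\<not> P l" "k \<le> l"
  shows "\<exists>n. P n \<and> \<not> P (n + 1)"
proof (rule ccontr)
  assume *: "\<nexists>n. P n \<and> \<not> P (n + 1)"
  from assms(3) have "P l"
    by (induction l rule: int_ge_induct) (use * assms(1) in auto)
  then show False using assms(2) by simp
qed

text \<open>The substitution \<open>u = \<rho>(t)\<close> without differentiability. The levels \<open>\<sigma> n\<close> of the points
  \<open>\<rho>(2\<^sup>n)\<close> grow essentially linearly, since \<open>\<rho>(t)/t\<close> varies slowly: \<open>\<sigma>\<close> is bounded-to-one, and every
  integer is at bounded distance from some \<open>\<sigma> n\<close>. A sequence with comparable neighbours has
  therefore the same norm, up to constants, before and after composition with \<open>\<sigma>\<close>.\<close>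

lemma change_of_variables:
  assumes r: "r > 0" and h: "slowly_varying h" and H: "samples H Y"
    and \<rho>: "\<And>n. \<rho> n = 2 powr real_of_int n * h (2 powr real_of_int n)"
  shows "(\<lambda>i. lnorm r UNIV (Y i)) \<asymp> (\<lambda>i. lnorm r UNIV (\<lambda>n. H i (\<rho> n)))"
proof -
  obtain D where D: "D \<ge> 1"
    "\<And>i u. u > 0 \<Longrightarrow> H i u \<le> ennreal D * Y i (level u)"
    "\<And>i u. u > 0 \<Longrightarrow> Y i (level u) \<le> ennreal D * H i u"
    "\<And>i k. Y i k \<le> ennreal D * Y i (k + 1)"
    "\<And>i k. Y i (k + 1) \<le> ennreal D * Y i k"
    using H by (rule samplesE) (rule that)
  obtain C where C: "C > 0"
    "\<And>s t. s > 0 \<Longrightarrow> t > 0 \<Longrightarrow> h s \<le> C * 2 powr (1/2 * \<bar>log 2 s - log 2 t\<bar>) * h t"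
    by (rule slowly_varyingE[OF h half_gt_zero[OF zero_less_one]]) (rule that)
  define L where "L n = log 2 (\<rho> n)" for n
  define c where "c = \<bar>log 2 C\<bar>"
  have \<rho>_pos: "\<rho> n > 0" for n using h unfolding \<rho> by (simp add: slowly_varying_pos)
  have L: "\<bar>(L n - L m) - (real_of_int n - real_of_int m)\<bar> \<le> c + 1/2 * \<bar>real_of_int n - real_of_int m\<bar>" for m n
  proof -
    have lh: "log 2 (h (2 powr real_of_int n)) - log 2 (h (2 powr real_of_int m)) \<le>
        log 2 C + 1/2 * \<bar>real_of_int n - real_of_int m\<bar>" for n m
    proof -
      have "log 2 (h (2 powr real_of_int n)) \<le>
          log 2 (C * 2 powr (1/2 * \<bar>real_of_int n - real_of_int m\<bar>) * h (2 powr real_of_int m))"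
        using C(2)[of "2 powr real_of_int n" "2 powr real_of_int m"] C(1) h
        by (subst log_le_cancel_iff) (auto simp: slowly_varying_pos)
      then show ?thesis
        using C(1) slowly_varying_pos[OF h, of "2 powr real_of_int m"] by (simp add: log_mult)
    qed
    have "L n = real_of_int n + log 2 (h (2 powr real_of_int n))" for n
      unfolding L_def \<rho> using slowly_varying_pos[OF h, of "2 powr real_of_int n"] by (simp add: log_mult)
    then show ?thesis using lh[of n m] lh[of m n] unfolding c_def by (simp add: abs_minus_commute)
  qed
  define \<sigma> where "\<sigma> n = level (\<rho> n)" for n
  have \<sigma>: "real_of_int (\<sigma> n) \<le> L n" "L n < real_of_int (\<sigma> n) + 1" for n
    unfolding \<sigma>_def L_def level_def by linarith+
  have H_Y: "(\<lambda>p. H (fst p) (\<rho> (snd p))) \<asymp> (\<lambda>p. Y (fst p) (\<sigma> (snd p)))"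
    unfolding \<sigma>_def
    by (intro equivalentI dominatedI[where C = D] D(2,3) \<rho>_pos)
  have 1: "(\<lambda>i. lnorm r UNIV (\<lambda>n. Y i (\<sigma> n))) \<preceq> (\<lambda>i. lnorm r UNIV (Y i))"
  proof (rule dominated_comp[OF lnorm_bounded_to_one[OF r]])
    show "\<bar>m - n\<bar> \<le> \<lceil>2 * (c + 1)\<rceil>" if "\<sigma> m = \<sigma> n" for m n
    proof -
      have "\<bar>L n - L m\<bar> \<le> 1" using \<sigma>[of m] \<sigma>[of n] that by linarith
      moreover have "\<bar>x\<bar> \<le> \<bar>y - x\<bar> + \<bar>y\<bar>" for x y :: real by linarith
      ultimately have "\<bar>real_of_int n - real_of_int m\<bar> \<le> c + 1/2 * \<bar>real_of_int n - real_of_int m\<bar> + 1"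
        using L[of n m] by (meson add_mono order_trans)
      then have "\<bar>real_of_int n - real_of_int m\<bar> \<le> 2 * (c + 1)" by simp
      then show ?thesis by linarith
    qed
  qed
  have "\<exists>n. \<bar>\<sigma> n - m\<bar> \<le> \<lceil>c + 4\<rceil>" for m
  proof -
    have c0: "c \<ge> 0" unfolding c_def by simp
    obtain A where A: "A \<ge> 0" "real_of_int m \<le> A" "- real_of_int m \<le> A" "L 0 \<le> A" "- L 0 \<le> A"
      by (rule that[of "\<bar>real_of_int m\<bar> + \<bar>L 0\<bar>"]) auto
    obtain R :: int where R: "real_of_int R \<ge> 2 * (c + A + A + 1)"
      using ex_le_of_int by blast
    have R0: "real_of_int R \<ge> 0" using c0 A(1) by (intro order_trans[OF _ R]) simp
    have "L (- R) - L 0 + real_of_int R \<le> c + 1/2 * real_of_int R"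
      using abs_le_D1[OF L[of "- R" 0]] R0 by simp
    moreover have "- L R + L 0 + real_of_int R \<le> c + 1/2 * real_of_int R"
      using abs_le_D2[OF L[of R 0]] R0 by simp
    ultimately have "L (- R) \<le> real_of_int m \<and> \<not> L R \<le> real_of_int m"
      using R R0 A by argo
    then have "L (- R) \<le> real_of_int m" "\<not> L R \<le> real_of_int m" "- R \<le> R"
      using R0 by simp_all
    from int_crossing[of "\<lambda>n. L n \<le> real_of_int m", OF this] obtain n where
      n: "L n \<le> real_of_int m" "\<not> L (n + 1) \<le> real_of_int m" by blast
    then have "L n \<ge> real_of_int m - c - 3/2" using L[of "n + 1" n] by simp
    then have "\<bar>real_of_int (\<sigma> n) - real_of_int m\<bar> \<le> c + 4" using n(1) \<sigma>[of n] c0 by linarith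
    then have "\<bar>\<sigma> n - m\<bar> \<le> \<lceil>c + 4\<rceil>" by linarith
    then show ?thesis ..
  qed
  then obtain \<tau> where \<tau>: "\<And>m. \<bar>\<sigma> (\<tau> m) - m\<bar> \<le> \<lceil>c + 4\<rceil>" by metis
  have 2: "(\<lambda>i. lnorm r UNIV (\<lambda>m. Y i (\<sigma> (\<tau> m)))) \<preceq> (\<lambda>i. lnorm r UNIV (\<lambda>n. Y i (\<sigma> n)))"
  proof (rule dominated_comp[OF lnorm_bounded_to_one[OF r], of \<tau> _ "\<lambda>i n. Y i (\<sigma> n)"])
    show "\<bar>m - n\<bar> \<le> 2 * \<lceil>c + 4\<rceil>" if "\<tau> m = \<tau> n" for m n
      using \<tau>[of m] \<tau>[of n] abs_triangle_ineq4[of "\<sigma> (\<tau> m) - n" "\<sigma> (\<tau> m) - m"] that by simp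
  qed
  have up: "Y i k \<le> ennreal (D ^ j) * Y i (k + int j)" for i k j
  proof (induction j)
    case (Suc j)
    have "Y i k \<le> ennreal (D ^ j) * (ennreal D * Y i (k + int j + 1))"
      by (rule order_trans[OF Suc mult_left_mono[OF D(4)]]) simp
    then show ?case using D(1) by (simp add: ennreal_mult mult_ac add_ac)
  qed simp
  have down: "Y i (k + int j) \<le> ennreal (D ^ j) * Y i k" for i k j
  proof (induction j)
    case (Suc j)
    have "Y i (k + int j + 1) \<le> ennreal D * (ennreal (D ^ j) * Y i k)"
      by (rule order_trans[OF D(5) mult_left_mono[OF Suc]]) simp
    then show ?case using D(1) by (simp add: ennreal_mult mult_ac add_ac)
  qed simp
  have near: "Y i k \<le> ennreal (D ^ N) * Y i l" if "\<bar>l - k\<bar> \<le> int N" for i k l N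
  proof -
    obtain j where j: "j \<le> N" "l = k + int j \<or> k = l + int j"
    proof (cases "k \<le> l")
      case True
      show ?thesis by (rule that[of "nat (l - k)"]) (use True \<open>\<bar>l - k\<bar> \<le> int N\<close> in auto)
    next
      case False
      show ?thesis by (rule that[of "nat (k - l)"]) (use False \<open>\<bar>l - k\<bar> \<le> int N\<close> in auto)
    qed
    have "Y i k \<le> ennreal (D ^ j) * Y i l" using j(2) up down by auto
    also have "\<dots> \<le> ennreal (D ^ N) * Y i l"
      using D(1) j(1) by (intro mult_right_mono ennreal_leI power_increasing) auto
    finally show ?thesis .
  qed
  have 3: "(\<lambda>i. lnorm r UNIV (Y i)) \<preceq> (\<lambda>i. lnorm r UNIV (\<lambda>m. Y i (\<sigma> (\<tau> m))))"
  proof (intro dominated_lnorm r dominatedI[where C = "D ^ nat \<lceil>c + 4\<rceil>"] near)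
    show "\<bar>\<sigma> (\<tau> (snd p)) - snd p\<bar> \<le> int (nat \<lceil>c + 4\<rceil>)" for p :: "'x \<times> int"
      using \<tau>[of "snd p"] by linarith
  qed
  show ?thesis
    using dominated_trans[OF 3 2] 1 equivalent_lnorm[OF r H_Y, of "\<lambda>_. UNIV"]
    by (meson equivalentI equivalent_sym equivalent_trans)
qed

section \<open>Spaces as sequence norms\<close>

lemma same_space_of_equivalent:
  assumes "X \<asymp> Y"
  shows "same_space X Y"
proof -
  have "cont_embedded X Y" if YX: "Y \<preceq> X" for X Y :: "'a qspace"
  proof -
    obtain C where C: "C \<ge> 1" "\<And>f. Y f \<le> ennreal C * X f"
      by (rule dominatedE[OF YX]) (rule that)
    have "Y f < top" if "X f < top" for f
      using that by (intro le_less_trans[OF C(2)]) (auto simp: ennreal_mult_less_top)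
    then have "carrier_of X \<subseteq> carrier_of Y" unfolding carrier_of_def by auto
    then show ?thesis
      unfolding cont_embedded_def using C by (intro conjI exI[of _ C]) auto
  qed
  then show ?thesis unfolding same_space_def using assms by (auto dest: equivalentD)
qed

lemma inter_space_equivalent:
  assumes "X \<asymp> X'" "Y \<asymp> Y'"
  shows "inter_space X Y \<asymp> (\<lambda>f. X' f + Y' f)"
proof -
  have "inter_space X Y \<asymp> (\<lambda>f. X f + Y f)"
    unfolding inter_space_def
  proof (rule equivalentI)
    show "(\<lambda>f. max (X f) (Y f)) \<preceq> (\<lambda>f. X f + Y f)"
      by (intro dominated_leI) (auto simp: max_def)
    show "(\<lambda>f. X f + Y f) \<preceq> (\<lambda>f. max (X f) (Y f))"
      by (intro dominated_add dominated_leI) auto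
  qed
  also have "\<dots> \<asymp> (\<lambda>f. X' f + Y' f)" by (rule equivalent_add[OF assms])
  finally show ?thesis .
qed

text \<open>For \<open>S\<close> the sum of two spaces: outside it the K-functional is infinite, and so is \<open>G\<close>.\<close>

lemma restrict_to_equivalent:
  assumes "F \<asymp> G" "\<And>f. f \<notin> S \<Longrightarrow> G f = top"
  shows "restrict_to S F \<asymp> G"
proof (rule equivalentI)
  obtain C where C: "C \<ge> 1" "\<And>f. F f \<le> ennreal C * G f"
    using equivalentD(1)[OF assms(1)] by (rule dominatedE) (rule that)
  show "restrict_to S F \<preceq> G"
  proof (rule dominatedI[where C = C])
    fix f
    show "restrict_to S F f \<le> ennreal C * G f"
      using C assms(2)[of f] by (cases "f \<in> S") (auto simp: restrict_to_def ennreal_mult_top)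
  qed
  have "F \<preceq> restrict_to S F" by (rule dominated_leI) (simp add: restrict_to_def)
  then show "G \<preceq> restrict_to S F" using equivalentD(2)[OF assms(1)] by (rule dominated_trans[rotated])
qed

lemma lnorm_eq_top: "q > 0 \<Longrightarrow> k \<in> S \<Longrightarrow> x k = top \<Longrightarrow> lnorm q S x = top"
  using lnorm_ge[of q k S x] by (simp add: top_unique)

lemma lnorm_mult_eq_top:
  "q > 0 \<Longrightarrow> k \<in> S \<Longrightarrow> w k > 0 \<Longrightarrow> x k = top \<Longrightarrow> lnorm q S (\<lambda>k. w k * x k) = top"
  by (rule lnorm_eq_top[where k = k]) (auto simp: ennreal_mult_top)

lemma lnorm_atLeast_uminus: "lnorm q {n..} x = lnorm q {..- n} (\<lambda>k. x (- k))"
proof -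
  have "bij_betw uminus {..- n} {n..}"
    by (rule bij_betw_byWitness[of _ uminus]) auto
  from lnorm_reindex[OF this, of q x] show ?thesis by simp
qed

lemma lnorm_UNIV_uminus: "lnorm q UNIV x = lnorm q UNIV (\<lambda>k. x (- k))"
proof -
  have "bij_betw uminus (UNIV :: int set) UNIV"
    by (rule bij_betw_byWitness[of _ uminus]) auto
  from lnorm_reindex[OF this, of q x] show ?thesis by simp
qed

lemma chi_seq_flip: "chi_seq r (flip B) q (flip A) (- n) = lnorm r {..n} (\<lambda>k. B k * lnorm q {k..n} A)"
proof -
  have "lnorm q {k..n} A = lnorm q {- n..- k} (flip A)" for k
  proof -
    have "bij_betw uminus {- n..- k} {k..n}"
      by (rule bij_betw_byWitness[of _ uminus]) auto
    from lnorm_reindex[OF this, of q A] show ?thesis by (simp add: flip_def[abs_def])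
  qed
  then show ?thesis
    unfolding chi_seq_def lnorm_atLeast_uminus by (simp add: flip_def)
qed

lemma samples_weighted:
  assumes "slowly_varying w" "samples G X"
  shows "samples (\<lambda>i u. ennreal (u powr -\<theta> * w u) * G i u)
    (\<lambda>i k. (ennreal (2 powr (-\<theta> * real_of_int k)) * dyadic w k) * X i k)"
  by (rule samples_mult[OF samples_powr_slowly_varying[OF assms(1)] assms(2)])

lemma samples_weighted_0:
  assumes "slowly_varying w" "samples G X"
  shows "samples (\<lambda>i u. ennreal (u powr - 0 * w u) * G i u) (\<lambda>i k. dyadic w k * X i k)"
  using samples_weighted[OF assms, of 0] by simp

lemma interp_space_equivalent:
  assumes "r > 0" "slowly_varying a"
  shows "interp_space X0 X1 \<theta> r a \<asymp>
    (\<lambda>f. lnorm r UNIV (\<lambda>k. (ennreal (2 powr (-\<theta> * real_of_int k)) * dyadic a k) * Kseq X0 X1 f k))"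
  unfolding interp_space_def
proof (rule restrict_to_equivalent)
  show "(\<lambda>f. wnorm \<theta> r a {0<..} (\<lambda>u. Kfun X0 X1 u f)) \<asymp>
      (\<lambda>f. lnorm r UNIV (\<lambda>k. (ennreal (2 powr (-\<theta> * real_of_int k)) * dyadic a k) * Kseq X0 X1 f k))"
    by (intro wnorm_equivalent_lnorm assms samples_weighted samples_Kfun)
  show "lnorm r UNIV (\<lambda>k. (ennreal (2 powr (-\<theta> * real_of_int k)) * dyadic a k) * Kseq X0 X1 f k) = top"
    if "f \<notin> sum_set X0 X1" for f
    using Kfun_eq_top[OF that] dyadic_pos[OF assms(2), of 0]
    by (intro lnorm_mult_eq_top[where k = 0] assms(1)) (auto simp: Kseq_def)
qed

lemma samples_Iio_K:
  assumes "q > 0" "slowly_varying a"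
  shows "samples (\<lambda>f t. wnorm 0 q a {0<..<t} (\<lambda>u. Kfun A0 A1 u f))
    (\<lambda>f n. lnorm q {..n} (\<lambda>j. dyadic a j * Kseq A0 A1 f j))"
  by (intro downward.samples_wnorm samples_weighted_0 samples_Kfun assms)

lemma samples_Ioi_K:
  assumes "q > 0" "slowly_varying a"
  shows "samples (\<lambda>f t. wnorm 1 q a {t<..} (\<lambda>u. Kfun A0 A1 u f))
    (\<lambda>f n. lnorm q {..- n} (\<lambda>j. flip (dyadic a) j * mirror (Kseq A0 A1 f) j))"
proof -
  have "samples (\<lambda>f t. wnorm 1 q a {t<..} (\<lambda>u. Kfun A0 A1 u f))
      (\<lambda>f n. lnorm q {n..} (\<lambda>k. (ennreal (2 powr (- 1 * real_of_int k)) * dyadic a k) * Kseq A0 A1 f k))"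
    by (intro upward.samples_wnorm samples_weighted samples_Kfun assms)
  moreover have "lnorm q {n..} (\<lambda>k. (ennreal (2 powr (- 1 * real_of_int k)) * dyadic a k) * Kseq A0 A1 f k) =
      lnorm q {..- n} (\<lambda>j. flip (dyadic a) j * mirror (Kseq A0 A1 f) j)" for f n
    unfolding lnorm_atLeast_uminus by (intro lnorm_cong) (simp add: flip_def mirror_def mult_ac)
  ultimately show ?thesis by simp
qed

lemma K_top_lnorm:
  assumes "f \<notin> sum_set A0 A1" "q > 0" "\<And>k. a k > 0"
  shows "lnorm q {..k::int} (\<lambda>j. a j * Kseq A0 A1 f j) = top"
    "lnorm q {..k::int} (\<lambda>j. a j * mirror (Kseq A0 A1 f) j) = top"
  using Kfun_eq_top[OF assms(1)] assms(3)
  by (intro lnorm_mult_eq_top[where k = k] assms(2); simp add: Kseq_def mirror_def ennreal_mult_top)+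

lemma flip_dyadic_pos: "slowly_varying w \<Longrightarrow> flip (dyadic w) k > 0"
  by (simp add: flip_def dyadic_pos)

lemma L_space_equivalent:
  assumes "r > 0" "q > 0" "slowly_varying b" "slowly_varying a"
  shows "L_space A0 A1 0 r b q a \<asymp> (\<lambda>f. lnorm r UNIV (\<lambda>k. dyadic b k *
    lnorm q {..k} (\<lambda>j. dyadic a j * Kseq A0 A1 f j)))"
  unfolding L_space_def
  by (intro restrict_to_equivalent wnorm_equivalent_lnorm samples_weighted_0 samples_Iio_K
      lnorm_mult_eq_top[where k = 0] K_top_lnorm dyadic_pos assms) auto

lemma LL_space_equivalent:
  assumes "p > 0" "r > 0" "q > 0" "slowly_varying c" "slowly_varying b" "slowly_varying a"
  shows "LL_space A0 A1 0 p c r b q a \<asymp> (\<lambda>f. lnorm p UNIV (\<lambda>n. dyadic c n *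
    lnorm r {..n} (\<lambda>k. dyadic b k * lnorm q {..k} (\<lambda>j. dyadic a j * Kseq A0 A1 f j))))"
  unfolding LL_space_def
  by (intro restrict_to_equivalent wnorm_equivalent_lnorm downward.samples_wnorm samples_weighted_0 samples_Iio_K
      lnorm_mult_eq_top[where k = 0] K_top_lnorm dyadic_pos assms) auto

lemma R_space_equivalent:
  assumes "r > 0" "q > 0" "slowly_varying b" "slowly_varying a"
  shows "R_space A0 A1 1 r b q a \<asymp> (\<lambda>f. lnorm r UNIV (\<lambda>k. flip (dyadic b) k *
    lnorm q {..k} (\<lambda>j. flip (dyadic a) j * mirror (Kseq A0 A1 f) j)))"
proof -
  let ?P = "\<lambda>f k. lnorm q {..k} (\<lambda>j. flip (dyadic a) j * mirror (Kseq A0 A1 f) j)"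
  have "(\<lambda>f. wnorm 0 r b {0<..} (\<lambda>t. wnorm 1 q a {t<..} (\<lambda>u. Kfun A0 A1 u f))) \<asymp>
      (\<lambda>f. lnorm r UNIV (\<lambda>k. dyadic b k * ?P f (- k)))"
    by (intro wnorm_equivalent_lnorm samples_weighted_0 samples_Ioi_K assms)
  then have "(\<lambda>f. wnorm 0 r b {0<..} (\<lambda>t. wnorm 1 q a {t<..} (\<lambda>u. Kfun A0 A1 u f))) \<asymp>
      (\<lambda>f. lnorm r UNIV (\<lambda>k. flip (dyadic b) k * ?P f k))"
    by (subst (asm) lnorm_UNIV_uminus) (simp add: flip_def)
  then show ?thesis unfolding R_space_def
    by (intro restrict_to_equivalent lnorm_mult_eq_top[where k = 0] K_top_lnorm flip_dyadic_pos assms) auto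
qed

lemma RR_space_equivalent:
  assumes "p > 0" "r > 0" "q > 0" "slowly_varying c" "slowly_varying b" "slowly_varying a"
  shows "RR_space A0 A1 1 p c r b q a \<asymp> (\<lambda>f. lnorm p UNIV (\<lambda>n. flip (dyadic c) n *
    lnorm r {..n} (\<lambda>k. flip (dyadic b) k * lnorm q {..k} (\<lambda>j. flip (dyadic a) j * mirror (Kseq A0 A1 f) j))))"
proof -
  let ?P = "\<lambda>f k. lnorm q {..k} (\<lambda>j. flip (dyadic a) j * mirror (Kseq A0 A1 f) j)"
  let ?w = "\<lambda>f. wnorm 0 p c {0<..} (\<lambda>t. wnorm 0 r b {t<..} (\<lambda>u. wnorm 1 q a {u<..} (\<lambda>v. Kfun A0 A1 v f)))"
  have "?w \<asymp> (\<lambda>f. lnorm p UNIV (\<lambda>n. dyadic c n * lnorm r {n..} (\<lambda>k. dyadic b k * ?P f (- k))))"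
    by (intro wnorm_equivalent_lnorm upward.samples_wnorm samples_weighted_0 samples_Ioi_K assms)
  then have "?w \<asymp> (\<lambda>f. lnorm p UNIV (\<lambda>n. flip (dyadic c) n * lnorm r {..n} (\<lambda>k. flip (dyadic b) k * ?P f k)))"
    unfolding lnorm_atLeast_uminus
    by (subst (asm) lnorm_UNIV_uminus) (simp add: flip_def)
  then show ?thesis unfolding RR_space_def
    by (intro restrict_to_equivalent lnorm_mult_eq_top[where k = 0] K_top_lnorm flip_dyadic_pos assms) auto
qed

section \<open>Reiteration\<close>

lemma slowly_varying_const_1: "slowly_varying (\<lambda>_. 1)"
  unfolding slowly_varying_def
  by (auto intro!: exI[of _ 1] ge_one_powr_ge_zero)

lemma finite_at_0:
  assumes "samples (\<lambda>_ :: unit. W) (\<lambda>_. X)" "W 1 < top"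
  shows "X 0 < top"
proof -
  obtain D where D: "D \<ge> 1" "\<And>u. u > 0 \<Longrightarrow> X (level u) \<le> ennreal D * W u"
    using assms(1) by (rule samplesE) (rule that)
  have "X (level 1) \<le> ennreal D * W 1" by (rule D) simp
  also have "\<dots> < top" using assms(2) by (simp add: ennreal_mult_less_top)
  finally show ?thesis by (simp add: level_def)
qed

lemma lnorm_tail_finite:
  assumes "r > 0" "q > 0" "chi_seq r b q a n < top" "a n > 0"
  shows "lnorm r {n..} b < top"
proof (rule ccontr)
  assume "\<not> lnorm r {n..} b < top"
  then have "lnorm r {n..} b * a n = top"
    using assms(4) by (simp add: less_top[symmetric] ennreal_top_mult)
  then show False using chi_seq_ge(1)[OF assms(1,2), of n b a] assms(3) by (simp add: top_unique)
qed

lemma lnorm_tail_pos: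
  assumes "r > 0" "b n > 0"
  shows "lnorm r {n..} b > 0"
  by (rule less_le_trans[OF assms(2)]) (intro lnorm_ge assms(1), simp)

text \<open>In this locale \<open>\<rho>s\<close> denotes the values of
  \<open>\<rho>\<close> at the dyadic points, \<open>tail0\<close> and \<open>tail1\<close> are the one-weight norms in \<open>B\<^sub>0\<close> and \<open>B\<^sub>1\<close>, and weights
  with index \<open>1\<close> are reflected.\<close>

locale reiteration = quasi_Banach_couple A0 A1
  for A0 A1 :: "'a::hausdorff_tvs qspace" +
  fixes q0 r0 q1 r1 r :: ennreal and a0 b0 a1 b1 a :: "real \<Rightarrow> real"
  assumes exponents: "q1 > 0" "r1 > 0" "r > 0" "r0 > 0" "q0 > 0"
    and sv: "slowly_varying a1" "slowly_varying b1" "slowly_varying a" "slowly_varying a0" "slowly_varying b0"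
    and finite1: "wnorm 0 r1 b1 {0<..<1} (\<lambda>s. wnorm 0 q1 a1 {s<..<1} (\<lambda>_. 1)) < top"
    and finite0: "wnorm 0 r0 b0 {1<..} (\<lambda>s. wnorm 0 q0 a0 {1<..<s} (\<lambda>_. 1)) < top"
begin

definition "c0 = chi0 r0 b0 q0 a0"
definition "c1 = chi1 r1 b1 q1 a1"
definition "\<rho> t = t * (c0 t / c1 t)"
definition "tail0 t = enn2real (wnorm 0 r0 b0 {t<..} (\<lambda>_. 1))"
definition "tail1 t = enn2real (wnorm 0 r1 b1 {0<..<t} (\<lambda>_. 1))"

abbreviation "\<alpha>0 \<equiv> dyadic a0"
abbreviation "\<beta>0 \<equiv> dyadic b0"
abbreviation "\<alpha>1 \<equiv> flip (dyadic a1)"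
abbreviation "\<beta>1 \<equiv> flip (dyadic b1)"
abbreviation "\<chi>0 \<equiv> chi_seq r0 \<beta>0 q0 \<alpha>0"
abbreviation "\<chi>1 \<equiv> chi_seq r1 \<beta>1 q1 \<alpha>1"
abbreviation "\<L>0 \<equiv> Lfun r0 \<beta>0 q0 \<alpha>0"
abbreviation "\<L>1 \<equiv> Lfun r1 \<beta>1 q1 \<alpha>1"

lemma slow_weights: "slow \<alpha>0" "slow \<beta>0" "slow \<alpha>1" "slow \<beta>1"
  by (intro slow_flip slow_dyadic sv)+

lemma slow_chi: "slow \<chi>0" "slow \<chi>1"
  by (intro slow_chi_seq exponents slow_weights)+

lemma weights_pos: "\<alpha>0 n > 0" "\<beta>0 n > 0" "\<alpha>1 n > 0" "\<beta>1 n > 0"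
  by (intro dyadic_pos flip_dyadic_pos sv)+

lemma chi_pos: "\<chi>0 n > 0" "\<chi>1 n > 0"
proof -
  have "0 < \<beta>0 n * \<alpha>0 n" "0 < \<beta>1 n * \<alpha>1 n"
    by (simp_all add: ennreal_zero_less_mult_iff weights_pos)
  then show "\<chi>0 n > 0" "\<chi>1 n > 0"
    using chi_seq_ge(2)[OF exponents(4,5)] chi_seq_ge(2)[OF exponents(2,1)]
    by (blast intro: less_le_trans)+
qed

lemma c0: "slowly_varying c0" "dyadic c0 \<asymp> \<chi>0" and chi0_finite: "\<chi>0 0 < top"
proof -
  have samples: "samples (\<lambda>_ :: unit. \<lambda>t. wnorm 0 r0 b0 {t<..} (\<lambda>s. wnorm 0 q0 a0 {t<..<s} (\<lambda>_. 1))) (\<lambda>_. \<chi>0)"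
    using upward.samples_nested[OF exponents(4,5) samples_slowly_varying[OF sv(4)] samples_slowly_varying[OF sv(5)]]
    by (simp add: chi_seq_def[abs_def])
  show fin: "\<chi>0 0 < top" by (rule finite_at_0[OF samples]) (rule finite0)
  have "c0 = (\<lambda>t. enn2real (wnorm 0 r0 b0 {t<..} (\<lambda>s. wnorm 0 q0 a0 {t<..<s} (\<lambda>_. 1))))"
    unfolding c0_def by (rule ext) (simp add: chi0_def)
  then show "slowly_varying c0" "dyadic c0 \<asymp> \<chi>0"
    using slowly_varying_enn2real[OF samples slow_chi(1) chi_pos(1) fin] by simp_all
qed

lemma c1: "slowly_varying c1" "dyadic c1 \<asymp> flip \<chi>1" and chi1_finite: "\<chi>1 0 < top"
proof -
  have samples: "samples (\<lambda>_ :: unit. \<lambda>t. wnorm 0 r1 b1 {0<..<t} (\<lambda>s. wnorm 0 q1 a1 {s<..<t} (\<lambda>_. 1))) (\<lambda>_. flip \<chi>1)"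
    using downward.samples_nested[OF exponents(2,1) samples_slowly_varying[OF sv(1)] samples_slowly_varying[OF sv(2)]]
    unfolding chi_seq_flip[symmetric] by (simp add: flip_def[abs_def])
  have fin: "flip \<chi>1 0 < top" by (rule finite_at_0[OF samples]) (rule finite1)
  then show "\<chi>1 0 < top" by (simp add: flip_def)
  have "c1 = (\<lambda>t. enn2real (wnorm 0 r1 b1 {0<..<t} (\<lambda>s. wnorm 0 q1 a1 {s<..<t} (\<lambda>_. 1))))"
    unfolding c1_def by (rule ext) (simp add: chi1_def)
  moreover have "flip \<chi>1 n > 0" for n by (simp add: flip_def chi_pos)
  ultimately show "slowly_varying c1" "dyadic c1 \<asymp> flip \<chi>1"
    using slowly_varying_enn2real[OF samples slow_flip[OF slow_chi(2)] _ fin] by simp_all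
qed

lemma tail0: "slowly_varying tail0" "dyadic tail0 \<asymp> (\<lambda>n. lnorm r0 {n..} \<beta>0)"
proof -
  have "samples (\<lambda>_ :: unit. \<lambda>t. wnorm 0 r0 b0 {t<..} (\<lambda>_. 1)) (\<lambda>_ n. lnorm r0 {n..} (\<lambda>k. \<beta>0 k * 1))"
    by (intro upward.samples_wnorm samples_weighted_0 exponents sv samples_const_1)
  then have samples: "samples (\<lambda>_ :: unit. \<lambda>t. wnorm 0 r0 b0 {t<..} (\<lambda>_. 1)) (\<lambda>_ n. lnorm r0 {n..} \<beta>0)"
    by simp
  have "tail0 = (\<lambda>t. enn2real (wnorm 0 r0 b0 {t<..} (\<lambda>_. 1)))" by (rule ext) (simp add: tail0_def)
  then show "slowly_varying tail0" "dyadic tail0 \<asymp> (\<lambda>n. lnorm r0 {n..} \<beta>0)"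
    using slowly_varying_enn2real[OF samples slow_lnorm_atLeast[OF exponents(4) slow_weights(2)]
        lnorm_tail_pos[OF exponents(4) weights_pos(2)]
        lnorm_tail_finite[OF exponents(4,5) chi0_finite weights_pos(1)]]
    by simp_all
qed

lemma tail1: "slowly_varying tail1" "dyadic tail1 \<asymp> flip (\<lambda>n. lnorm r1 {n..} \<beta>1)"
proof -
  have "samples (\<lambda>_ :: unit. \<lambda>t. wnorm 0 r1 b1 {0<..<t} (\<lambda>_. 1)) (\<lambda>_ n. lnorm r1 {..n} (\<lambda>k. dyadic b1 k * 1))"
    by (intro downward.samples_wnorm samples_weighted_0 exponents sv samples_const_1)
  then have samples: "samples (\<lambda>_ :: unit. \<lambda>t. wnorm 0 r1 b1 {0<..<t} (\<lambda>_. 1))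
      (\<lambda>_. flip (\<lambda>n. lnorm r1 {n..} \<beta>1))"
    by (simp add: flip_def[abs_def] lnorm_atLeast_uminus)
  have "tail1 = (\<lambda>t. enn2real (wnorm 0 r1 b1 {0<..<t} (\<lambda>_. 1)))" by (rule ext) (simp add: tail1_def)
  moreover have "flip (\<lambda>n. lnorm r1 {n..} \<beta>1) 0 < top"
    unfolding flip_def[of "\<lambda>n. lnorm r1 {n..} \<beta>1"]
    using lnorm_tail_finite[OF exponents(2,1) chi1_finite weights_pos(3)] by simp
  moreover have "flip (\<lambda>n. lnorm r1 {n..} \<beta>1) n > 0" for n
    unfolding flip_def[of "\<lambda>n. lnorm r1 {n..} \<beta>1"]
    by (rule lnorm_tail_pos[OF exponents(2) weights_pos(4)])
  ultimately show "slowly_varying tail1" "dyadic tail1 \<asymp> flip (\<lambda>n. lnorm r1 {n..} \<beta>1)"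
    using slowly_varying_enn2real[OF samples
        slow_flip[OF slow_lnorm_atLeast[OF exponents(2) slow_weights(4)]]]
    by simp_all
qed

definition "\<rho>s n = \<rho> (2 powr real_of_int n)"

lemma slowly_varying_ratio: "slowly_varying (\<lambda>t. c0 t / c1 t)"
  by (rule slowly_varying_divide[OF c0(1) c1(1)])

lemma rho_pos: "t > 0 \<Longrightarrow> \<rho> t > 0"
  unfolding \<rho>_def by (intro mult_pos_pos slowly_varying_pos[OF slowly_varying_ratio])

lemma rhos_pos: "\<rho>s n > 0"
  unfolding \<rho>s_def by (rule rho_pos) simp

lemma slowly_varying_a_rho: "slowly_varying (a \<circ> \<rho>)"
  unfolding comp_def \<rho>_def by (rule slowly_varying_compose[OF sv(3) slowly_varying_ratio])

lemma decays_rho: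
  assumes "\<theta> > 0" "slowly_varying w"
  shows "decays (\<lambda>n. ennreal (\<rho>s n powr - \<theta>) * dyadic w n)"
    "decays (\<lambda>n. ennreal (\<rho>s (- n) powr \<theta>) * flip (dyadic w) n)"
proof -
  have eq: "ennreal (\<rho>s n powr p) =
      ennreal (2 powr (p * real_of_int n)) * dyadic (\<lambda>t. (c0 t / c1 t) powr p) n" for p n
  proof -
    have "\<rho>s n powr p = 2 powr (p * real_of_int n) *
        (c0 (2 powr real_of_int n) / c1 (2 powr real_of_int n)) powr p"
      unfolding \<rho>s_def \<rho>_def using slowly_varying_pos[OF slowly_varying_ratio, of "2 powr real_of_int n"]
      by (subst powr_mult) (simp_all add: powr_powr mult.commute)
    then show ?thesis by (simp add: dyadic_def ennreal_mult)
  qed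
  have "decays (\<lambda>n. ennreal (2 powr (- \<theta> * real_of_int n)) * (dyadic (\<lambda>t. (c0 t / c1 t) powr - \<theta>) n * dyadic w n))"
    by (intro decays_mult_slow decays_powr slow_mult slow_dyadic slowly_varying_powr slowly_varying_ratio assms)
  then show "decays (\<lambda>n. ennreal (\<rho>s n powr - \<theta>) * dyadic w n)"
    by (simp add: eq mult.assoc)
  have "decays (\<lambda>n. ennreal (2 powr (- \<theta> * real_of_int n)) *
      (flip (dyadic (\<lambda>t. (c0 t / c1 t) powr \<theta>)) n * flip (dyadic w) n))"
    by (intro decays_mult_slow decays_powr slow_mult slow_flip slow_dyadic slowly_varying_powr slowly_varying_ratio assms)
  then show "decays (\<lambda>n. ennreal (\<rho>s (- n) powr \<theta>) * flip (dyadic w) n)"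
    by (simp add: eq flip_def mult.assoc)
qed

definition "X0 = L_space A0 A1 0 r0 b0 q0 a0"
definition "X1 = R_space A0 A1 1 r1 b1 q1 a1"

text \<open>This is the definition of \<open>\<rho>\<close>, solved for \<open>\<chi>\<^sub>0\<close>.\<close>

lemma chi0_equivalent:
  "\<chi>0 \<asymp> (\<lambda>n. ennreal (\<rho>s n) * (\<chi>1 (- n) * ennreal (2 powr - real_of_int n)))"
proof -
  have "dyadic c0 = (\<lambda>n. ennreal (\<rho>s n) * (dyadic c1 n * ennreal (2 powr - real_of_int n)))"
  proof
    fix n
    show "dyadic c0 n = ennreal (\<rho>s n) * (dyadic c1 n * ennreal (2 powr - real_of_int n))"
    using slowly_varying_pos[OF c0(1), of "2 powr real_of_int n"]
      slowly_varying_pos[OF c1(1), of "2 powr real_of_int n"]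
    by (simp add: dyadic_def \<rho>s_def \<rho>_def powr_minus flip: ennreal_mult)
  qed
  then have "\<chi>0 \<asymp> (\<lambda>n. ennreal (\<rho>s n) * (dyadic c1 n * ennreal (2 powr - real_of_int n)))"
    using equivalent_sym[OF c0(2)] by simp
  also have "\<dots> \<asymp> (\<lambda>n. ennreal (\<rho>s n) * (flip \<chi>1 n * ennreal (2 powr - real_of_int n)))"
    by (intro equivalent_mult equivalent_refl c1(2))
  finally show ?thesis by (simp add: flip_def)
qed

lemma holmstedt_reiteration:
  "(\<lambda>(f, n). Kfun X0 X1 (\<rho>s n) f) \<asymp> (\<lambda>(f, n). \<L>0 (trunc n (K f)) +
    ennreal (\<rho>s n) * \<L>1 (trunc (- n) (mirror (K f))))"
proof (rule holmstedt[OF exponents(4,5) exponents(2,1) slow_weights(2,4) chi_pos(1) rhos_pos _ _ chi0_equivalent])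
  have "ennreal (1 / \<rho>s n) = ennreal (\<rho>s n powr - 1) * dyadic (\<lambda>_. 1) n" for n
    using rhos_pos[of n] by (simp add: powr_minus_divide dyadic_def)
  then show "decays (\<lambda>n. ennreal (1 / \<rho>s n))"
    using decays_rho(1)[OF zero_less_one slowly_varying_const_1] by simp
  have "ennreal (\<rho>s (- n)) = ennreal (\<rho>s (- n) powr 1) * flip (dyadic (\<lambda>_. 1)) n" for n
    using rhos_pos[of "- n"] by (simp add: dyadic_def flip_def)
  then show "decays (\<lambda>n. ennreal (\<rho>s (- n)))"
    using decays_rho(2)[OF zero_less_one slowly_varying_const_1] by simp
  show "X0 \<asymp> (\<lambda>f. \<L>0 (K f))"
    unfolding X0_def Lfun_def by (intro L_space_equivalent exponents sv)
  show "X1 \<asymp> (\<lambda>f. \<L>1 (mirror (K f)))"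
    unfolding X1_def Lfun_def by (intro R_space_equivalent exponents sv)
qed

text \<open>After Holmstedt's formula and the change of variables, the interpolation norm is the \<open>l\<^sub>r\<close> norm
  of the truncated norms in \<open>X0\<close> with weight \<open>v \<theta> = \<rho>\<^sup>-\<^sup>\<theta> (a \<circ> \<rho>)\<close> plus that of the truncated
  norms in \<open>X1\<close> with weight \<open>\<rho>\<^sup>1\<^sup>-\<^sup>\<theta> (a \<circ> \<rho>)\<close>, whose reflection is \<open>u \<theta>\<close>.\<close>

definition "v \<theta> n = ennreal (\<rho>s n powr - \<theta>) * dyadic (a \<circ> \<rho>) n"
definition "u \<theta> n = ennreal (\<rho>s (- n) powr (1 - \<theta>)) * flip (dyadic (a \<circ> \<rho>)) n"

lemma v_rho: "v \<theta> n * ennreal (\<rho>s n) = u \<theta> (- n)"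
proof -
  have "\<rho>s n powr - \<theta> * \<rho>s n = \<rho>s n powr (1 - \<theta>)"
    using powr_add[of "\<rho>s n" "- \<theta>" 1] rhos_pos[of n] by simp
  then have "ennreal (\<rho>s n powr - \<theta>) * ennreal (\<rho>s n) = ennreal (\<rho>s n powr (1 - \<theta>))"
    using rhos_pos[of n] by (simp flip: ennreal_mult)
  then show ?thesis
    by (simp add: v_def u_def flip_def mult_ac) (metis mult.left_commute)
qed

text \<open>\<open>M0\<close> and \<open>M1\<close> are the two summands. \<open>N0\<close> and \<open>N1\<close> are what the third term of \<open>Lfun_trunc\<close>
  contributes to each of them; by the choice of \<open>\<rho>\<close> they coincide, and they are the norm of the
  space with weight \<open>a\<^sup>#\<close>.\<close>

definition "M0 \<theta> f = lnorm r UNIV (\<lambda>n. v \<theta> n * \<L>0 (trunc n (K f)))"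
definition "M1 \<theta> f = lnorm r UNIV (\<lambda>n. u \<theta> n * \<L>1 (trunc n (mirror (K f))))"
definition "N0 \<theta> f = lnorm r UNIV (\<lambda>n. v \<theta> n * (\<chi>0 n * K f n))"
definition "N1 \<theta> f = lnorm r UNIV (\<lambda>n. u \<theta> n * (\<chi>1 n * mirror (K f) n))"

lemma interp_space_M: "interp_space X0 X1 \<theta> r a \<asymp> (\<lambda>f. M0 \<theta> f + M1 \<theta> f)"
proof -
  have samples: "samples (\<lambda>f t. ennreal (t powr - \<theta> * a t) * Kfun X0 X1 t f)
      (\<lambda>f k. (ennreal (2 powr (- \<theta> * real_of_int k)) * dyadic a k) * Kseq X0 X1 f k)"
    by (intro samples_weighted sv samples_Kfun)
  have "interp_space X0 X1 \<theta> r a \<asymp>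
      (\<lambda>f. lnorm r UNIV (\<lambda>k. (ennreal (2 powr (- \<theta> * real_of_int k)) * dyadic a k) * Kseq X0 X1 f k))"
    by (intro interp_space_equivalent exponents sv)
  also have "\<dots> \<asymp> (\<lambda>f. lnorm r UNIV (\<lambda>n. ennreal (\<rho>s n powr - \<theta> * a (\<rho>s n)) * Kfun X0 X1 (\<rho>s n) f))"
    by (rule change_of_variables[OF exponents(3) slowly_varying_ratio samples]) (simp add: \<rho>s_def \<rho>_def)
  also have "\<dots> = (\<lambda>f. lnorm r UNIV (\<lambda>n. v \<theta> n * Kfun X0 X1 (\<rho>s n) f))"
  proof -
    have "ennreal (\<rho>s n powr - \<theta> * a (\<rho>s n)) = v \<theta> n" for n
      using slowly_varying_pos[OF sv(3) rhos_pos[of n]]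
      by (simp add: v_def dyadic_def \<rho>s_def flip: ennreal_mult)
    then show ?thesis by simp
  qed
  also have "\<dots> \<asymp> (\<lambda>f. lnorm r UNIV (\<lambda>n. v \<theta> n * \<L>0 (trunc n (K f)) +
      (v \<theta> n * ennreal (\<rho>s n)) * \<L>1 (trunc (- n) (mirror (K f)))))"
    using equivalent_mult[OF equivalent_refl holmstedt_reiteration, of "\<lambda>p. v \<theta> (snd p)"]
    by (intro equivalent_lnorm exponents) (simp add: case_prod_unfold distrib_left mult.assoc)
  also have "\<dots> \<asymp> (\<lambda>f. M0 \<theta> f + lnorm r UNIV (\<lambda>n. (v \<theta> n * ennreal (\<rho>s n)) * \<L>1 (trunc (- n) (mirror (K f)))))"
    unfolding M0_def by (rule lnorm_add_equivalent[OF exponents(3)])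
  also have "(\<lambda>f. lnorm r UNIV (\<lambda>n. (v \<theta> n * ennreal (\<rho>s n)) * \<L>1 (trunc (- n) (mirror (K f))))) = M1 \<theta>"
    unfolding M1_def v_rho by (subst lnorm_UNIV_uminus) simp
  finally show ?thesis .
qed

lemma N0_N1: "N0 \<theta> \<asymp> N1 \<theta>"
proof -
  have "(\<lambda>f. N0 \<theta> f) \<asymp> (\<lambda>f. lnorm r UNIV (\<lambda>n. v \<theta> n *
      ((ennreal (\<rho>s n) * (\<chi>1 (- n) * ennreal (2 powr - real_of_int n))) * K f n)))"
    unfolding N0_def
    using equivalent_comp[OF chi0_equivalent, of snd]
    by (intro equivalent_lnorm exponents equivalent_mult equivalent_refl)
  also have "\<dots> = N1 \<theta>"
  proof
    fix f
    have "v \<theta> n * ((ennreal (\<rho>s n) * (\<chi>1 (- n) * ennreal (2 powr - real_of_int n))) * K f n) =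
        (v \<theta> n * ennreal (\<rho>s n)) * (\<chi>1 (- n) * mirror (K f) (- n))" for n
      by (simp add: mirror_def mult_ac)
    then show "lnorm r UNIV (\<lambda>n. v \<theta> n *
        ((ennreal (\<rho>s n) * (\<chi>1 (- n) * ennreal (2 powr - real_of_int n))) * K f n)) = N1 \<theta> f"
      unfolding N1_def by (subst lnorm_UNIV_uminus[of _ "\<lambda>n. u \<theta> n * _ n"]) (simp add: v_rho)
  qed
  finally show ?thesis .
qed

lemma M0_ge: "N0 \<theta> \<preceq> M0 \<theta>" and M1_ge: "N1 \<theta> \<preceq> M1 \<theta>"
  unfolding N0_def[abs_def] M0_def[abs_def] N1_def[abs_def] M1_def[abs_def]
  by (intro dominated_leI lnorm_mono exponents mult_left_mono chi_seq_le_Lfun;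
      simp add: trunc_def min_def)+

text \<open>The weight \<open>v \<theta>\<close> decays for \<open>\<theta> > 0\<close>, and \<open>u \<theta>\<close> for \<open>\<theta> < 1\<close>; this decides which of the two summands
  Hardy's inequality can absorb.\<close>

lemma M0_le: "\<theta> > 0 \<Longrightarrow> M0 \<theta> \<preceq> N0 \<theta>"
  unfolding N0_def[abs_def] M0_def[abs_def]
  using dominated_comp[OF hardy_trunc[OF exponents(3-5) decays_rho(1)[OF _ slowly_varying_a_rho] slow_weights(2)], of \<theta> \<alpha>0 K]
  by (simp add: v_def)

lemma M1_le: "\<theta> < 1 \<Longrightarrow> M1 \<theta> \<preceq> N1 \<theta>"
  unfolding N1_def[abs_def] M1_def[abs_def]
  using dominated_comp[OF hardy_trunc[OF exponents(3,2,1) decays_rho(2)[OF _ slowly_varying_a_rho] slow_weights(4)],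
      of "1 - \<theta>" \<alpha>1 "\<lambda>f. mirror (K f)"]
  by (simp add: u_def)

lemma interp_space_sharp:
  "interp_space A0 A1 \<theta> r (a_sharp c0 c1 \<rho> a \<theta>) \<asymp> N0 \<theta>"
proof -
  have "a_sharp c0 c1 \<rho> a \<theta> = (\<lambda>t. (c0 t powr (1 - \<theta>) * c1 t powr \<theta>) * (a \<circ> \<rho>) t)"
    by (rule ext) (simp add: a_sharp_def)
  then have "slowly_varying (a_sharp c0 c1 \<rho> a \<theta>)"
    by (simp only:) (intro slowly_varying_mult slowly_varying_powr c0 c1 slowly_varying_a_rho)
  then have "interp_space A0 A1 \<theta> r (a_sharp c0 c1 \<rho> a \<theta>) \<asymp>
      (\<lambda>f. lnorm r UNIV (\<lambda>k. (ennreal (2 powr (-\<theta> * real_of_int k)) * dyadic (a_sharp c0 c1 \<rho> a \<theta>) k) * K f k))"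
    by (intro interp_space_equivalent exponents)
  also have "\<dots> = (\<lambda>f. lnorm r UNIV (\<lambda>n. v \<theta> n * (dyadic c0 n * K f n)))"
  proof -
    have "ennreal (2 powr (-\<theta> * real_of_int k)) * dyadic (a_sharp c0 c1 \<rho> a \<theta>) k = v \<theta> k * dyadic c0 k" for k
    proof -
      define t where "t = 2 powr real_of_int k"
      have t: "t > 0" "c0 t > 0" "c1 t > 0" "a (\<rho> t) > 0"
        using slowly_varying_pos[OF c0(1)] slowly_varying_pos[OF c1(1)] slowly_varying_pos[OF sv(3)] rho_pos
        by (simp_all add: t_def)
      have "c0 t powr (1 - \<theta>) = c0 t powr - \<theta> * c0 t"
        using powr_add[of "c0 t" "- \<theta>" 1] t by simp
      moreover have "(t * (c0 t / c1 t)) powr - \<theta> = t powr - \<theta> * c0 t powr - \<theta> * c1 t powr \<theta>"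
        using t by (simp add: powr_mult powr_divide powr_minus field_simps)
      moreover have "2 powr (-\<theta> * real_of_int k) = t powr - \<theta>"
        by (simp add: t_def powr_powr mult.commute)
      ultimately have "2 powr (-\<theta> * real_of_int k) * a_sharp c0 c1 \<rho> a \<theta> t = \<rho> t powr - \<theta> * a (\<rho> t) * c0 t"
        by (simp add: a_sharp_def \<rho>_def mult_ac)
      moreover have "a_sharp c0 c1 \<rho> a \<theta> t > 0"
        using t by (simp add: a_sharp_def)
      ultimately show ?thesis
        using t by (simp add: v_def dyadic_def \<rho>s_def t_def[symmetric] flip: ennreal_mult)
    qed
    then show ?thesis by (simp add: mult.assoc)
  qed
  also have "\<dots> \<asymp> N0 \<theta>"
    unfolding N0_def[abs_def]
    using equivalent_comp[OF c0(2), of snd]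
    by (intro equivalent_lnorm exponents equivalent_mult equivalent_refl)
  finally show ?thesis .
qed

text \<open>Both \<open>M0\<close> and \<open>M1\<close> are absorbed by the common third term.\<close>

theorem reiteration_interior:
  assumes "0 < \<theta>" "\<theta> < 1"
  shows "interp_space X0 X1 \<theta> r a \<asymp> interp_space A0 A1 \<theta> r (a_sharp c0 c1 \<rho> a \<theta>)"
proof -
  have "(\<lambda>f. M0 \<theta> f + M1 \<theta> f) \<asymp> N0 \<theta>"
  proof (rule equivalentI)
    show "(\<lambda>f. M0 \<theta> f + M1 \<theta> f) \<preceq> N0 \<theta>"
      using M1_le[OF assms(2)] equivalentD(2)[OF N0_N1]
      by (intro dominated_add M0_le assms) (rule dominated_trans)
    show "N0 \<theta> \<preceq> (\<lambda>f. M0 \<theta> f + M1 \<theta> f)" by (intro dominated_add_left M0_ge)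
  qed
  then show ?thesis
    using interp_space_M interp_space_sharp equivalent_sym equivalent_trans by blast
qed

text \<open>At \<open>\<theta> = 0\<close> only \<open>M1\<close> can be absorbed. What is left is \<open>M0\<close>, where the weight
  \<open>v 0 = a \<circ> \<rho>\<close> does not decay, so that all three terms of \<open>Lfun_trunc\<close> survive.\<close>

theorem reiteration_0:
  "interp_space X0 X1 0 r a \<asymp>
    inter_space (interp_space A0 A1 0 r (a_sharp c0 c1 \<rho> a 0))
      (inter_space (L_space A0 A1 0 r (\<lambda>t. tail0 t * a (\<rho> t)) q0 a0)
        (LL_space A0 A1 0 r (a \<circ> \<rho>) r0 b0 q0 a0))"
proof -
  let ?P = "\<lambda>f k. lnorm q0 {..k} (\<lambda>j. \<alpha>0 j * K f j)"
  let ?LL = "\<lambda>f. lnorm r UNIV (\<lambda>n. dyadic (a \<circ> \<rho>) n * lnorm r0 {..n} (\<lambda>k. \<beta>0 k * ?P f k))"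
  let ?L = "\<lambda>f. lnorm r UNIV (\<lambda>n. dyadic (a \<circ> \<rho>) n * (lnorm r0 {n..} \<beta>0 * ?P f n))"
  have v0: "v 0 n = dyadic (a \<circ> \<rho>) n" for n
    using rhos_pos[of n] by (simp add: v_def)
  have "(\<lambda>f. M0 0 f + M1 0 f) \<asymp> M0 0"
  proof (rule equivalentI)
    have "M1 0 \<preceq> M0 0"
      using M1_le[of 0] equivalentD(2)[OF N0_N1[of 0]] M0_ge[of 0] by (meson dominated_trans zero_less_one)
    then show "(\<lambda>f. M0 0 f + M1 0 f) \<preceq> M0 0" by (intro dominated_add dominated_refl)
    show "M0 0 \<preceq> (\<lambda>f. M0 0 f + M1 0 f)" by (intro dominated_add_left dominated_refl)
  qed
  also have "M0 0 \<asymp> (\<lambda>f. (?LL f + ?L f) + N0 0 f)"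
    unfolding M0_def[abs_def] N0_def[abs_def] v0
    by (rule equivalent_comp[OF lnorm_Lfun_trunc[OF exponents(3-5)]])
  also have "\<dots> = (\<lambda>f. N0 0 f + (?L f + ?LL f))" by (simp add: add_ac)
  also have "\<dots> \<asymp> inter_space (interp_space A0 A1 0 r (a_sharp c0 c1 \<rho> a 0))
      (inter_space (L_space A0 A1 0 r (\<lambda>t. tail0 t * a (\<rho> t)) q0 a0)
        (LL_space A0 A1 0 r (a \<circ> \<rho>) r0 b0 q0 a0))"
  proof (intro equivalent_sym[OF inter_space_equivalent] inter_space_equivalent interp_space_sharp
      LL_space_equivalent exponents sv slowly_varying_a_rho)
    have "slowly_varying (\<lambda>t. tail0 t * (a \<circ> \<rho>) t)"
      by (intro slowly_varying_mult tail0 slowly_varying_a_rho)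
    then have "L_space A0 A1 0 r (\<lambda>t. tail0 t * a (\<rho> t)) q0 a0 \<asymp>
        (\<lambda>f. lnorm r UNIV (\<lambda>n. dyadic (\<lambda>t. tail0 t * a (\<rho> t)) n * ?P f n))"
      by (intro L_space_equivalent exponents sv) (simp add: comp_def)
    also have "\<dots> = (\<lambda>f. lnorm r UNIV (\<lambda>n. dyadic (a \<circ> \<rho>) n * (dyadic tail0 n * ?P f n)))"
    proof -
      have "dyadic (\<lambda>t. tail0 t * a (\<rho> t)) n = dyadic (a \<circ> \<rho>) n * dyadic tail0 n" for n
        using slowly_varying_pos[OF tail0(1), of "2 powr real_of_int n"]
          slowly_varying_pos[OF slowly_varying_a_rho, of "2 powr real_of_int n"]
        by (simp add: dyadic_def mult.commute flip: ennreal_mult)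
      then show ?thesis by (simp add: mult.assoc)
    qed
    also have "\<dots> \<asymp> ?L"
      using equivalent_comp[OF tail0(2), of snd]
      by (intro equivalent_lnorm exponents equivalent_mult equivalent_refl)
    finally show "L_space A0 A1 0 r (\<lambda>t. tail0 t * a (\<rho> t)) q0 a0 \<asymp> ?L" .
  qed
  finally show ?thesis using interp_space_M[of 0] by (blast intro: equivalent_trans)
qed

text \<open>The mirror image of \<open>\<theta> = 0\<close>.\<close>

theorem reiteration_1:
  "interp_space X0 X1 1 r a \<asymp>
    inter_space (interp_space A0 A1 1 r (a_sharp c0 c1 \<rho> a 1))
      (inter_space (R_space A0 A1 1 r (\<lambda>t. tail1 t * a (\<rho> t)) q1 a1)
        (RR_space A0 A1 1 r (a \<circ> \<rho>) r1 b1 q1 a1))"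
proof -
  let ?P = "\<lambda>f k. lnorm q1 {..k} (\<lambda>j. \<alpha>1 j * mirror (K f) j)"
  let ?RR = "\<lambda>f. lnorm r UNIV (\<lambda>n. flip (dyadic (a \<circ> \<rho>)) n * lnorm r1 {..n} (\<lambda>k. \<beta>1 k * ?P f k))"
  let ?R = "\<lambda>f. lnorm r UNIV (\<lambda>n. flip (dyadic (a \<circ> \<rho>)) n * (lnorm r1 {n..} \<beta>1 * ?P f n))"
  have u1: "u 1 n = flip (dyadic (a \<circ> \<rho>)) n" for n
    using rhos_pos[of "- n"] by (simp add: u_def)
  have "(\<lambda>f. M0 1 f + M1 1 f) \<asymp> M1 1"
  proof (rule equivalentI)
    have "M0 1 \<preceq> M1 1"
      using M0_le[of 1] equivalentD(1)[OF N0_N1[of 1]] M1_ge[of 1] by (meson dominated_trans zero_less_one)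
    then show "(\<lambda>f. M0 1 f + M1 1 f) \<preceq> M1 1" by (intro dominated_add dominated_refl)
    show "M1 1 \<preceq> (\<lambda>f. M0 1 f + M1 1 f)" by (intro dominated_add_right dominated_refl)
  qed
  also have "M1 1 \<asymp> (\<lambda>f. (?RR f + ?R f) + N1 1 f)"
    unfolding M1_def[abs_def] N1_def[abs_def] u1
    by (rule equivalent_comp[OF lnorm_Lfun_trunc[OF exponents(3,2,1)]])
  also have "\<dots> = (\<lambda>f. N1 1 f + (?R f + ?RR f))" by (simp add: add_ac)
  also have "\<dots> \<asymp> inter_space (interp_space A0 A1 1 r (a_sharp c0 c1 \<rho> a 1))
      (inter_space (R_space A0 A1 1 r (\<lambda>t. tail1 t * a (\<rho> t)) q1 a1)
        (RR_space A0 A1 1 r (a \<circ> \<rho>) r1 b1 q1 a1))"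
  proof (intro equivalent_sym[OF inter_space_equivalent] inter_space_equivalent
      equivalent_trans[OF interp_space_sharp N0_N1] RR_space_equivalent exponents sv slowly_varying_a_rho)
    have "slowly_varying (\<lambda>t. tail1 t * (a \<circ> \<rho>) t)"
      by (intro slowly_varying_mult tail1 slowly_varying_a_rho)
    then have "R_space A0 A1 1 r (\<lambda>t. tail1 t * a (\<rho> t)) q1 a1 \<asymp>
        (\<lambda>f. lnorm r UNIV (\<lambda>n. flip (dyadic (\<lambda>t. tail1 t * a (\<rho> t))) n * ?P f n))"
      by (intro R_space_equivalent exponents sv) (simp add: comp_def)
    also have "\<dots> = (\<lambda>f. lnorm r UNIV (\<lambda>n. flip (dyadic (a \<circ> \<rho>)) n * (flip (dyadic tail1) n * ?P f n)))"
    proof -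
      have "flip (dyadic (\<lambda>t. tail1 t * a (\<rho> t))) n = flip (dyadic (a \<circ> \<rho>)) n * flip (dyadic tail1) n" for n
        using slowly_varying_pos[OF tail1(1), of "2 powr real_of_int (- n)"]
          slowly_varying_pos[OF slowly_varying_a_rho, of "2 powr real_of_int (- n)"]
        by (simp add: dyadic_def flip_def mult.commute flip: ennreal_mult)
      then show ?thesis by (simp add: mult.assoc)
    qed
    also have "\<dots> \<asymp> ?R"
    proof -
      have "(\<lambda>n. flip (dyadic tail1) n) \<asymp> (\<lambda>n. lnorm r1 {n..} \<beta>1)"
        using equivalent_comp[OF tail1(2), of uminus] by (simp add: flip_def[abs_def])
      from equivalent_comp[OF this, of snd] show ?thesis
        by (intro equivalent_lnorm exponents equivalent_mult equivalent_refl)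
    qed
    finally show "R_space A0 A1 1 r (\<lambda>t. tail1 t * a (\<rho> t)) q1 a1 \<asymp> ?R" .
  qed
  finally show ?thesis using interp_space_M[of 1] by (blast intro: equivalent_trans)
qed

end

theorem theorem46:
  fixes A0 A1 :: "'a::hausdorff_tvs qspace"
    and q0 r0 q1 r1 r :: ennreal
    and a0 b0 a1 b1 a c0 c1 \<rho> B0 B1 :: "real \<Rightarrow> real"
    and X0 X1 :: "'a qspace"
  assumes couple: "compatible_quasi_Banach_couple A0 A1"
    and nontrivial: "carrier_of A0 \<inter> carrier_of A1 \<noteq> {0}"
    and exponents: "0 < q1" "0 < r1" "0 < r" "0 < r0" "0 < q0"
    and slowly_varying: "a1 \<in> SV" "b1 \<in> SV" "a \<in> SV" "a0 \<in> SV" "b0 \<in> SV"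
    and finite1: "wnorm 0 r1 b1 {0<..<1} (\<lambda>s. wnorm 0 q1 a1 {s<..<1} (\<lambda>_. 1)) < \<infinity>"
    and finite0: "wnorm 0 r0 b0 {1<..} (\<lambda>s. wnorm 0 q0 a0 {1<..<s} (\<lambda>_. 1)) < \<infinity>"
    and c1: "c1 = chi1 r1 b1 q1 a1"
    and c0: "c0 = chi0 r0 b0 q0 a0"
    and \<rho>: "\<rho> = (\<lambda>t. t * (c0 t / c1 t))"
    and B0: "B0 = (\<lambda>t. enn2real (wnorm 0 r0 b0 {t<..} (\<lambda>_. 1)) * a (\<rho> t))"
    and B1: "B1 = (\<lambda>t. enn2real (wnorm 0 r1 b1 {0<..<t} (\<lambda>_. 1)) * a (\<rho> t))"
    and X0: "X0 = L_space A0 A1 0 r0 b0 q0 a0"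
    and X1: "X1 = R_space A0 A1 1 r1 b1 q1 a1"
  shows
    "(\<forall>\<theta>. 0 < \<theta> \<and> \<theta> < 1 \<longrightarrow>
        same_space (interp_space X0 X1 \<theta> r a)
          (interp_space A0 A1 \<theta> r (a_sharp c0 c1 \<rho> a \<theta>))) \<and>
     (wnorm 0 r a {1<..} (\<lambda>_. 1) < \<infinity> \<longrightarrow>
        same_space (interp_space X0 X1 0 r a)
          (inter_space (interp_space A0 A1 0 r (a_sharp c0 c1 \<rho> a 0))
            (inter_space (L_space A0 A1 0 r B0 q0 a0)
              (LL_space A0 A1 0 r (a \<circ> \<rho>) r0 b0 q0 a0)))) \<and>
     (wnorm 0 r a {0<..<1} (\<lambda>_. 1) < \<infinity> \<longrightarrow>
        same_space (interp_space X0 X1 1 r a)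
          (inter_space (interp_space A0 A1 1 r (a_sharp c0 c1 \<rho> a 1))
            (inter_space (R_space A0 A1 1 r B1 q1 a1)
              (RR_space A0 A1 1 r (a \<circ> \<rho>) r1 b1 q1 a1))))"
proof -
  interpret R: reiteration A0 A1 q0 r0 q1 r1 r a0 b0 a1 b1 a
    using couple exponents slowly_varying finite1 finite0
    by unfold_locales (simp_all add: SV_slowly_varying)
  have "c0 = R.c0" "c1 = R.c1" "X0 = R.X0" "X1 = R.X1"
    by (simp_all add: c0 c1 X0 X1 R.c0_def R.c1_def R.X0_def R.X1_def)
  moreover from this have "\<rho> = R.\<rho>" by (intro ext) (simp add: \<rho> R.\<rho>_def)
  moreover from this have "B0 = (\<lambda>t. R.tail0 t * a (R.\<rho> t))" "B1 = (\<lambda>t. R.tail1 t * a (R.\<rho> t))"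
    by (simp_all add: B0 B1 R.tail0_def R.tail1_def)
  ultimately show ?thesis
    using R.reiteration_interior R.reiteration_0 R.reiteration_1
    by (simp add: same_space_of_equivalent)
qed

end
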